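(* Let $\phi: M^n \rightarrow \mathbb R^{n+1}$ be a (positive definite) hyperbolic affine hypersphere with mean curvature $\lambda$, $\lambda<0$, with affine metric $h$ and difference tensor $K$. Assume that there exist (smooth) distributions $\mathcal D_1$ (of dimension $1$, spanned by a vector field $T$ of unit length with respect to $h$), $\mathcal D_2$ (of dimension $n_2>0$) and $\mathcal D_3$ (of dimension $n_3>0$) on $M$ such that (i) $1+n_2+n_3 = n$; (ii) $\mathcal D_1$, $\mathcal D_2$ and $\mathcal D_3$ are mutually orthogonal with respect to $h$; (iii) there exist real numbers $\lambda_1$, $\lambda_2$ and $\lambda_3$ with $\lambda_1=\lambda_2+\lambda_3$ and $\lambda_2\lambda_3=\lambda$ such that, for all $V\in\mathcal D_2$ and $W\in\mathcal D_3$, $$K(T,T)=\lambda_1 T,\quad K(T,V)=\lambda_2 V,\quad K(T,W)=\lambda_3 W,\quad K(V,W)=0.$$ Then $\phi$ can be decomposed (locally, in the sense defined in the context) as the Calabi product of two hyperbolic affine hypersphere immersions $\psi_1:M_1^{n_2} \rightarrow \mathbb R^{n_2+1}$ and $\psi_2:M_2^{n_3} \rightarrow \mathbb R^{n_3+1}$.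
   Context: Affine hypersurfaces. $\mathbb R^{n+1}$ carries its standard flat connection $D$ and the volume form $\det$. Let $\phi:M^n\to\mathbb R^{n+1}$ be a (smooth) nondegenerate hypersurface immersion. Its affine normal $\xi$ is the canonical (Blaschke) transversal vector field: writing $D_XY=\nabla_XY+h(X,Y)\xi$ (with $\nabla_XY$ tangent and $\phi$ suppressed from the notation), $\xi$ is determined (up to sign) by requiring that $D_X\xi$ is tangent for all $X$ and that $|\det(X_1,\dots,X_n,\xi)|=|\det (h(X_i,X_j))|^{1/2}$ for all tangent $X_1,\dots,X_n$. Then $h$ is called the affine metric, $\nabla$ the induced affine connection, and the affine shape operator $S$ is defined by $D_X\xi=-SX$. The sign of $\xi$ is chosen so that $h$ is positive definite (this is possible by assumption: all affine hyperspheres considered are positive definite). $\widehat\nabla$ denotes the Levi-Civita connection of $h$, and the difference tensor is $K(X,Y)=K_XY=\nabla_XY-\widehat\nabla_XY$. $M$ is an affine hypersphere with mean curvature $\lambda$ if $S=\lambda I$ with $\lambda$ constant; it is hyperbolic if $\lambda<0$ (all affine normals then pass through a fixed point, the center). If $\lambda=-1$ and the center is the origin, then $\xi=\phi$. All hyperbolic affine hyperspheres of mean curvature $-1$ occurring as factors of a Calabi product are taken with center at the origin. Calabi product. Let $\psi_1:M_1^{n_2}\to\mathbb R^{n_2+1}$ and $\psi_2:M_2^{n_3}\to\mathbb R^{n_3+1}$ be hyperbolic affine hyperspheres with mean curvature $-1$. Their Calabi product is the immersion $$\psi(t,p,q)=\Bigl(c_1e^{\frac{\sqrt{n_3+1}}{\sqrt{n_2+1}}t}\,\psi_1(p),\;c_2e^{-\frac{\sqrt{n_2+1}}{\sqrt{n_3+1}}t}\,\psi_2(q)\Bigr)\in\mathbb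 R^{n_2+1}\times\mathbb R^{n_3+1},\qquad p\in M_1,\ q\in M_2,\ t\in\mathbb R,$$ with nonzero constants $c_1,c_2$. "$\phi$ can be decomposed as the Calabi product of $\psi_1$ and $\psi_2$" means: every point of $M$ has a neighbourhood which can be identified (by a diffeomorphism) with $I\times M_1\times M_2$, $I\subset\mathbb R$ an open interval and $M_1,M_2$ manifolds of dimensions $n_2,n_3$, such that on this neighbourhood $\phi$ coincides, up to an affine transformation of $\mathbb R^{n+1}$, with the Calabi product $\psi(t,p,q)=\Bigl(c_1e^{\frac{\sqrt{n_3+1}}{\sqrt{n_2+1}}t}\,\psi_1(p),\;c_2e^{-\frac{\sqrt{n_2+1}}{\sqrt{n_3+1}}t}\,\psi_2(q)\Bigr)$ of $M_1$ with $M_2$, for some nonzero constants $c_1,c_2$ (restricted to $t\in I$), for some hyperbolic affine hyperspheres $\psi_1:M_1\to\mathbb R^{n_2+1}$, $\psi_2:M_2\to\mathbb R^{n_3+1}$ with mean curvature $-1$. *)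

theory Defs
  imports "HOL-Analysis.Analysis"
begin

text \<open>Iterated Frechet differentiability; meant for open \<open>S\<close>. On an open set, \<open>smooth_on\<close> is the usual
  \<open>C\<^sup>\<infinity>\<close>.\<close>

primrec Ck_on :: "nat \<Rightarrow> 'a set \<Rightarrow> ('a::real_normed_vector \<Rightarrow> 'b::real_normed_vector) \<Rightarrow> bool" where
  "Ck_on 0 S f \<longleftrightarrow> continuous_on S f"
| "Ck_on (Suc k) S f \<longleftrightarrow> (\<forall>x\<in>S. f differentiable (at x)) \<and>
     (\<forall>v. Ck_on k S (\<lambda>x. frechet_derivative f (at x) v))"

definition smooth_on :: "'a set \<Rightarrow> ('a::real_normed_vector \<Rightarrow> 'b::real_normed_vector) \<Rightarrow> bool" where
  "smooth_on S f \<longleftrightarrow> (\<forall>k. Ck_on k S f)"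

text \<open>A chart is a pair \<open>(V, x)\<close> of an open set \<open>V\<close> and a map \<open>x\<close>, of which only the values on \<open>V\<close>
  matter. Atlases are not required to be maximal.\<close>

record ('m, 'e) manifold =
  mfd_top :: "'m topology"
  atlas :: "('m set \<times> ('m \<Rightarrow> 'e)) set"

abbreviation carrier_mfd :: "('m, 'e) manifold \<Rightarrow> 'm set" where
  "carrier_mfd M \<equiv> topspace (mfd_top M)"

definition smooth_manifold :: "('m, 'e::euclidean_space) manifold \<Rightarrow> bool" where
  "smooth_manifold M \<longleftrightarrow>
     Hausdorff_space (mfd_top M) \<and> second_countable (mfd_top M) \<and>
     (\<Union>(V, x)\<in>atlas M. V) = carrier_mfd M \<and>
     (\<forall>(V, x)\<in>atlas M. openin (mfd_top M) V \<and> open (x ` V) \<and>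
        homeomorphic_map (subtopology (mfd_top M) V) (top_of_set (x ` V)) x) \<and>
     (\<forall>(V, x)\<in>atlas M. \<forall>(W, y)\<in>atlas M. smooth_on (x ` (V \<inter> W)) (y \<circ> inv_into V x))"

definition open_manifold :: "'e::euclidean_space set \<Rightarrow> ('e, 'e) manifold" where
  "open_manifold S = \<lparr>mfd_top = top_of_set S, atlas = {(S, id)}\<rparr>"

definition prod_manifold ::
    "('m, 'e) manifold \<Rightarrow> ('k, 'f) manifold \<Rightarrow> ('m \<times> 'k, 'e \<times> 'f) manifold" (infixr "\<times>\<^sub>M\<^sub>f" 80) where
  "prod_manifold M N = \<lparr>mfd_top = prod_topology (mfd_top M) (mfd_top N),
     atlas = {(V \<times> W, map_prod x y) |V x W y. (V, x) \<in> atlas M \<and> (W, y) \<in> atlas N}\<rparr>"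

definition open_submanifold :: "('m, 'e) manifold \<Rightarrow> 'm set \<Rightarrow> ('m, 'e) manifold" where
  "open_submanifold M U = \<lparr>mfd_top = subtopology (mfd_top M) U,
     atlas = {(V \<inter> U, x) |V x. (V, x) \<in> atlas M}\<rparr>"

definition smooth_map ::
    "('m, 'e::euclidean_space) manifold \<Rightarrow> ('k, 'f::euclidean_space) manifold \<Rightarrow> ('m \<Rightarrow> 'k) \<Rightarrow> bool" where
  "smooth_map M N g \<longleftrightarrow> continuous_map (mfd_top M) (mfd_top N) g \<and>
     (\<forall>(V, x)\<in>atlas M. \<forall>(W, y)\<in>atlas N.
        smooth_on (x ` {p \<in> V. g p \<in> W}) (y \<circ> g \<circ> inv_into V x))"

definition diffeomorphism ::
    "('m, 'e::euclidean_space) manifold \<Rightarrow> ('k, 'f::euclidean_space) manifold \<Rightarrow> ('m \<Rightarrow> 'k) \<Rightarrow> bool" where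
  "diffeomorphism M N g \<longleftrightarrow> bij_betw g (carrier_mfd M) (carrier_mfd N) \<and>
     smooth_map M N g \<and> smooth_map N M (inv_into (carrier_mfd M) g)"

text \<open>Smoothness, on an open subset \<open>U\<close> of \<open>M\<close>, of a function with values in a normed space; the values
  outside \<open>U\<close> are irrelevant.\<close>

definition smooth_fun_on ::
    "('m, 'e::euclidean_space) manifold \<Rightarrow> 'm set \<Rightarrow> ('m \<Rightarrow> 'b::real_normed_vector) \<Rightarrow> bool" where
  "smooth_fun_on M U g \<longleftrightarrow> (\<forall>(V, x)\<in>atlas M. smooth_on (x ` (V \<inter> U)) (g \<circ> inv_into V x))"

definition chart_deriv :: "'m set \<times> ('m \<Rightarrow> 'e) \<Rightarrow> ('m \<Rightarrow> 'b) \<Rightarrow> 'm \<Rightarrow>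
    'e::euclidean_space \<Rightarrow> 'b::real_normed_vector" where
  "chart_deriv c g p = frechet_derivative (g \<circ> inv_into (fst c) (snd c)) (at (snd c p))"

definition immersion :: "('m, 'e::euclidean_space) manifold \<Rightarrow> ('m \<Rightarrow> 'v::euclidean_space) \<Rightarrow> bool" where
  "immersion M \<phi> \<longleftrightarrow> smooth_fun_on M (carrier_mfd M) \<phi> \<and>
     (\<forall>c\<in>atlas M. \<forall>p\<in>fst c. inj (chart_deriv c \<phi> p))"

text \<open>As usual for an immersion \<open>\<phi>\<close>, a tangent vector of \<open>M\<close> at \<open>p\<close> is identified with its image under
  \<open>d\<phi>\<^sub>p\<close>. Thus \<open>T\<^sub>pM\<close> is a linear subspace of the ambient space, vector fields are ambient-valued
  functions, and tensors on \<open>M\<close> (such as \<open>h\<close> and \<open>K\<close>) at \<open>p\<close> are functions on ambient vectors of which only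
  the values on \<open>T\<^sub>pM\<close> matter. Since \<open>\<phi>\<close> is an immersion, a vector field is smooth iff it is smooth as
  an ambient-valued function.\<close>

definition tangent_space ::
    "('m, 'e::euclidean_space) manifold \<Rightarrow> ('m \<Rightarrow> 'v::euclidean_space) \<Rightarrow> 'm \<Rightarrow> 'v set" where
  "tangent_space M \<phi> p = (\<Union>c\<in>{c \<in> atlas M. p \<in> fst c}. range (chart_deriv c \<phi> p))"

text \<open>Derivative at \<open>p\<close> of the function \<open>Y\<close> in the direction of the tangent vector (identified with)
  \<open>w = d\<phi>\<^sub>p u\<close>. For ambient-valued \<open>Y\<close> this is the flat derivative \<open>D\<^sub>w Y\<close>, for real-valued \<open>Y\<close> it is \<open>w(Y)\<close>.
  It does not depend on the chart.\<close>

definition deriv_along :: "('m, 'e::euclidean_space) manifold \<Rightarrow> ('m \<Rightarrow> 'v::euclidean_space) \<Rightarrow>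
    'v \<Rightarrow> ('m \<Rightarrow> 'b::real_normed_vector) \<Rightarrow> 'm \<Rightarrow> 'b" where
  "deriv_along M \<phi> w Y p = (THE d. \<exists>c\<in>atlas M. p \<in> fst c \<and>
     (\<exists>u. chart_deriv c \<phi> p u = w \<and> chart_deriv c Y p u = d))"

definition vector_field_on :: "('m, 'e::euclidean_space) manifold \<Rightarrow> ('m \<Rightarrow> 'v::euclidean_space) \<Rightarrow>
    'm set \<Rightarrow> ('m \<Rightarrow> 'v) \<Rightarrow> bool" where
  "vector_field_on M \<phi> U X \<longleftrightarrow> smooth_fun_on M U X \<and> (\<forall>p\<in>U. X p \<in> tangent_space M \<phi> p)"

text \<open>\<open>[X, Y] = D\<^sub>X Y - D\<^sub>Y X\<close>, as \<open>D\<close> is torsion free.\<close>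

definition lie_bracket :: "('m, 'e::euclidean_space) manifold \<Rightarrow> ('m \<Rightarrow> 'v::euclidean_space) \<Rightarrow>
    ('m \<Rightarrow> 'v) \<Rightarrow> ('m \<Rightarrow> 'v) \<Rightarrow> 'm \<Rightarrow> 'v" where
  "lie_bracket M \<phi> X Y p = deriv_along M \<phi> (X p) Y p - deriv_along M \<phi> (Y p) X p"

text \<open>Covariant derivatives act on vector fields defined on arbitrary open sets \<open>U\<close>.\<close>

definition affine_connection :: "('m, 'e::euclidean_space) manifold \<Rightarrow> ('m \<Rightarrow> 'v::euclidean_space) \<Rightarrow>
    (('m \<Rightarrow> 'v) \<Rightarrow> ('m \<Rightarrow> 'v) \<Rightarrow> 'm \<Rightarrow> 'v) \<Rightarrow> bool" where
  "affine_connection M \<phi> nab \<longleftrightarrow>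
     (\<forall>U X Y Z (f :: 'm \<Rightarrow> real).
        openin (mfd_top M) U \<and> vector_field_on M \<phi> U X \<and> vector_field_on M \<phi> U Y \<and>
        vector_field_on M \<phi> U Z \<and> smooth_fun_on M U f \<longrightarrow>
        vector_field_on M \<phi> U (nab X Y) \<and>
        (\<forall>p\<in>U.
           nab (\<lambda>q. X q + Z q) Y p = nab X Y p + nab Z Y p \<and>
           nab (\<lambda>q. f q *\<^sub>R X q) Y p = f p *\<^sub>R nab X Y p \<and>
           nab X (\<lambda>q. Y q + Z q) p = nab X Y p + nab X Z p \<and>
           nab X (\<lambda>q. f q *\<^sub>R Y q) p = deriv_along M \<phi> (X p) f p *\<^sub>R Y p + f p *\<^sub>R nab X Y p))"

definition levi_civita :: "('m, 'e::euclidean_space) manifold \<Rightarrow> ('m \<Rightarrow> 'v::euclidean_space) \<Rightarrow>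
    ('m \<Rightarrow> 'v \<Rightarrow> 'v \<Rightarrow> real) \<Rightarrow> (('m \<Rightarrow> 'v) \<Rightarrow> ('m \<Rightarrow> 'v) \<Rightarrow> 'm \<Rightarrow> 'v) \<Rightarrow> bool" where
  "levi_civita M \<phi> h nab \<longleftrightarrow> affine_connection M \<phi> nab \<and>
     (\<forall>U X Y Z. openin (mfd_top M) U \<and> vector_field_on M \<phi> U X \<and> vector_field_on M \<phi> U Y \<and>
        vector_field_on M \<phi> U Z \<longrightarrow>
        (\<forall>p\<in>U.
           nab X Y p - nab Y X p = lie_bracket M \<phi> X Y p \<and>
           deriv_along M \<phi> (X p) (\<lambda>q. h q (Y q) (Z q)) p =
             h p (nab X Y p) (Z p) + h p (Y p) (nab X Z p)))"

definition smooth_distribution :: "('m, 'e::euclidean_space) manifold \<Rightarrow>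
    ('m \<Rightarrow> 'v::euclidean_space) \<Rightarrow> nat \<Rightarrow> ('m \<Rightarrow> 'v set) \<Rightarrow> bool" where
  "smooth_distribution M \<phi> k D \<longleftrightarrow>
     (\<forall>p\<in>carrier_mfd M. subspace (D p) \<and> D p \<subseteq> tangent_space M \<phi> p \<and> dim (D p) = k) \<and>
     (\<forall>p\<in>carrier_mfd M. \<exists>U E. openin (mfd_top M) U \<and> p \<in> U \<and>
        (\<forall>i<k. vector_field_on M \<phi> U (E i)) \<and> (\<forall>q\<in>U. D q = span {E i q |i. i < k}))"

text \<open>The model space of the \<open>n\<close>-manifold is \<open>real ^ 'n\<close>, and \<open>real ^ ('n option)\<close> plays the role of
  \<open>\<real>\<^sup>n\<^sup>+\<^sup>1\<close>.\<close>

text \<open>\<open>h\<close> is the symmetric bilinear form in \<open>D\<^sub>X Y = \<nabla>\<^sub>X Y + h(X, Y) \<xi>\<close> with \<open>\<nabla>\<^sub>X Y\<close> tangent; it is unique when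
  \<open>\<xi>\<close> is transversal.\<close>

definition affine_fundamental_form :: "('m, 'e::euclidean_space) manifold \<Rightarrow>
    ('m \<Rightarrow> 'v::euclidean_space) \<Rightarrow> ('m \<Rightarrow> 'v) \<Rightarrow> ('m \<Rightarrow> 'v \<Rightarrow> 'v \<Rightarrow> real) \<Rightarrow> bool" where
  "affine_fundamental_form M \<phi> \<xi> h \<longleftrightarrow>
     (\<forall>U X Y. openin (mfd_top M) U \<and> vector_field_on M \<phi> U X \<and> vector_field_on M \<phi> U Y \<longrightarrow>
        (\<forall>p\<in>U. deriv_along M \<phi> (X p) Y p - h p (X p) (Y p) *\<^sub>R \<xi> p \<in> tangent_space M \<phi> p))"

definition induced_connection :: "('m, 'e::euclidean_space) manifold \<Rightarrow> ('m \<Rightarrow> 'v::euclidean_space) \<Rightarrow>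
    ('m \<Rightarrow> 'v) \<Rightarrow> ('m \<Rightarrow> 'v \<Rightarrow> 'v \<Rightarrow> real) \<Rightarrow> ('m \<Rightarrow> 'v) \<Rightarrow> ('m \<Rightarrow> 'v) \<Rightarrow> 'm \<Rightarrow> 'v" where
  "induced_connection M \<phi> \<xi> h X Y p = deriv_along M \<phi> (X p) Y p - h p (X p) (Y p) *\<^sub>R \<xi> p"

definition shape_operator :: "('m, 'e::euclidean_space) manifold \<Rightarrow> ('m \<Rightarrow> 'v::euclidean_space) \<Rightarrow>
    ('m \<Rightarrow> 'v) \<Rightarrow> 'm \<Rightarrow> 'v \<Rightarrow> 'v" where
  "shape_operator M \<phi> \<xi> p w = - deriv_along M \<phi> w \<xi> p"

text \<open>\<open>\<xi>\<close> is an affine normal and \<open>h\<close> the corresponding affine metric. The rows of the first matrix are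
  \<open>X\<^sub>1, \<dots>, X\<^sub>n\<close> and \<open>\<xi>\<close>.\<close>

definition affine_normal_metric :: "('m, real ^ 'n) manifold \<Rightarrow> ('m \<Rightarrow> real ^ ('n::finite option)) \<Rightarrow>
    ('m \<Rightarrow> real ^ ('n option)) \<Rightarrow>
    ('m \<Rightarrow> real ^ ('n option) \<Rightarrow> real ^ ('n option) \<Rightarrow> real) \<Rightarrow> bool" where
  "affine_normal_metric M \<phi> \<xi> h \<longleftrightarrow>
     smooth_fun_on M (carrier_mfd M) \<xi> \<and>
     (\<forall>p\<in>carrier_mfd M. \<xi> p \<notin> tangent_space M \<phi> p) \<and>
     affine_fundamental_form M \<phi> \<xi> h \<and>
     (\<forall>p\<in>carrier_mfd M. \<forall>w\<in>tangent_space M \<phi> p. deriv_along M \<phi> w \<xi> p \<in> tangent_space M \<phi> p) \<and>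
     (\<forall>p\<in>carrier_mfd M. \<forall>X :: 'n \<Rightarrow> real ^ ('n option). (\<forall>i. X i \<in> tangent_space M \<phi> p) \<longrightarrow>
        \<bar>det (\<chi> a. case a of Some i \<Rightarrow> X i | None \<Rightarrow> \<xi> p)\<bar> =
        sqrt \<bar>det (\<chi> i j. h p (X i) (X j))\<bar>)"

text \<open>Positive definite affine hypersphere with mean curvature \<open>lam\<close>; positive definiteness of \<open>h\<close> entails
  nondegeneracy and fixes the sign of the affine normal \<open>\<xi>\<close>.\<close>

definition affine_hypersphere :: "('m, real ^ 'n) manifold \<Rightarrow> ('m \<Rightarrow> real ^ ('n::finite option)) \<Rightarrow>
    ('m \<Rightarrow> real ^ ('n option)) \<Rightarrow>
    ('m \<Rightarrow> real ^ ('n option) \<Rightarrow> real ^ ('n option) \<Rightarrow> real) \<Rightarrow> real \<Rightarrow> bool" where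
  "affine_hypersphere M \<phi> \<xi> h lam \<longleftrightarrow>
     smooth_manifold M \<and> immersion M \<phi> \<and> affine_normal_metric M \<phi> \<xi> h \<and>
     (\<forall>p\<in>carrier_mfd M. \<forall>w\<in>tangent_space M \<phi> p. w \<noteq> 0 \<longrightarrow> h p w w > 0) \<and>
     (\<forall>p\<in>carrier_mfd M. \<forall>w\<in>tangent_space M \<phi> p. shape_operator M \<phi> \<xi> p w = lam *\<^sub>R w)"

definition hyperbolic_affine_hypersphere :: "('m, real ^ 'n) manifold \<Rightarrow>
    ('m \<Rightarrow> real ^ ('n::finite option)) \<Rightarrow> ('m \<Rightarrow> real ^ ('n option)) \<Rightarrow>
    ('m \<Rightarrow> real ^ ('n option) \<Rightarrow> real ^ ('n option) \<Rightarrow> real) \<Rightarrow> real \<Rightarrow> bool" where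
  "hyperbolic_affine_hypersphere M \<phi> \<xi> h lam \<longleftrightarrow> affine_hypersphere M \<phi> \<xi> h lam \<and> lam < 0"

definition center_at :: "('m, 'e) manifold \<Rightarrow> ('m \<Rightarrow> 'v::real_vector) \<Rightarrow> ('m \<Rightarrow> 'v) \<Rightarrow> 'v \<Rightarrow> bool" where
  "center_at M \<phi> \<xi> c \<longleftrightarrow> (\<forall>p\<in>carrier_mfd M. \<exists>s. \<phi> p + s *\<^sub>R \<xi> p = c)"

text \<open>\<open>K(X, Y) = \<nabla>\<^sub>X Y - \<nabla>'\<^sub>X Y\<close>, where \<open>\<nabla>'\<close> is the Levi-Civita connection of \<open>h\<close>.\<close>

definition difference_tensor :: "('m, 'e::euclidean_space) manifold \<Rightarrow> ('m \<Rightarrow> 'v::euclidean_space) \<Rightarrow>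
    ('m \<Rightarrow> 'v) \<Rightarrow> ('m \<Rightarrow> 'v \<Rightarrow> 'v \<Rightarrow> real) \<Rightarrow> ('m \<Rightarrow> 'v \<Rightarrow> 'v \<Rightarrow> 'v) \<Rightarrow> bool" where
  "difference_tensor M \<phi> \<xi> h K \<longleftrightarrow> (\<exists>nab. levi_civita M \<phi> h nab \<and>
     (\<forall>U X Y. openin (mfd_top M) U \<and> vector_field_on M \<phi> U X \<and> vector_field_on M \<phi> U Y \<longrightarrow>
        (\<forall>p\<in>U. K p (X p) (Y p) = induced_connection M \<phi> \<xi> h X Y p - nab X Y p)))"

definition calabi_product :: "real \<Rightarrow> real \<Rightarrow> ('a \<Rightarrow> real ^ ('k::finite option)) \<Rightarrow>
    ('b \<Rightarrow> real ^ ('l::finite option)) \<Rightarrow> real \<times> 'a \<times> 'b \<Rightarrow>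
    (real ^ ('k option)) \<times> (real ^ ('l option))" where
  "calabi_product c1 c2 \<psi>1 \<psi>2 = (\<lambda>(t, p, q).
     ((c1 * exp (sqrt (real CARD('l) + 1) / sqrt (real CARD('k) + 1) * t)) *\<^sub>R \<psi>1 p,
      (c2 * exp (- (sqrt (real CARD('k) + 1) / sqrt (real CARD('l) + 1)) * t)) *\<^sub>R \<psi>2 q))"

text \<open>Near each point, \<open>\<phi>\<close> is, up to a diffeomorphism \<open>\<Theta>\<close> and an affine transformation \<open>z \<mapsto> L z + b\<close>, a
  Calabi product. The factor manifolds live on subsets of the types \<open>real ^ 'k\<close> and \<open>real ^ 'l\<close>, but with
  arbitrary topology and atlas. This is no restriction: a second countable manifold of positive dimension
  has at most continuum many points, so it can be transported to such a subset.\<close>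

definition locally_calabi_product :: "'k::finite itself \<Rightarrow> 'l::finite itself \<Rightarrow>
    ('m, 'e::euclidean_space) manifold \<Rightarrow> ('m \<Rightarrow> 'v::euclidean_space) \<Rightarrow> bool" where
  "locally_calabi_product k l M \<phi> \<longleftrightarrow>
     (\<forall>x\<in>carrier_mfd M.
        \<exists>W I (M1 :: (real ^ 'k, real ^ 'k) manifold) (M2 :: (real ^ 'l, real ^ 'l) manifold)
          \<psi>1 \<xi>1 h1 \<psi>2 \<xi>2 h2 c1 c2 \<Theta> L b.
          openin (mfd_top M) W \<and> x \<in> W \<and> open I \<and> is_interval I \<and>
          hyperbolic_affine_hypersphere M1 \<psi>1 \<xi>1 h1 (-1) \<and> center_at M1 \<psi>1 \<xi>1 0 \<and>
          hyperbolic_affine_hypersphere M2 \<psi>2 \<xi>2 h2 (-1) \<and> center_at M2 \<psi>2 \<xi>2 0 \<and>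
          c1 \<noteq> 0 \<and> c2 \<noteq> 0 \<and>
          diffeomorphism (open_manifold I \<times>\<^sub>M\<^sub>f M1 \<times>\<^sub>M\<^sub>f M2) (open_submanifold M W) \<Theta> \<and>
          linear L \<and> bij L \<and>
          (\<forall>z\<in>I \<times> carrier_mfd M1 \<times> carrier_mfd M2.
             \<phi> (\<Theta> z) = L (calabi_product c1 c2 \<psi>1 \<psi>2 z) + b))"

end

theory Submission
  imports Defs
begin

text \<open>Translate the center to the origin and let the multiples \<open>r f(u)\<close> of the immersion sweep out an open
  cone. On the cone, \<open>F (r f(u)) = ln r\<close> has the hypersurface as its zero level, \<open>G = - D\<^sup>2F\<close> is positive
  definite, \<open>G\<close> restricts to a multiple of \<open>h\<close> on the hypersurface, and \<open>DG\<close> encodes the difference tensor \<open>K\<close>.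
  Split the position vector as \<open>y = e + (y - e)\<close>, where \<open>e\<close> is the multiple of \<open>r (T - \<lambda>\<^sub>3 f)\<close> by \<open>1 / (\<lambda>\<^sub>2 - \<lambda>\<^sub>3)\<close>.
  The hypotheses on \<open>K\<close> make \<open>E2 = span e + D2\<close> and \<open>E3 = span (y - e) + D3\<close> orthogonal for \<open>G\<close> and for
  \<open>DG\<close>, and the total symmetry of \<open>D\<^sup>2G\<close> then forces \<open>D\<^sup>2e = 0\<close>. So \<open>e\<close> is a constant linear projection
  \<open>\<pi>\<close>, and \<open>F (a + b) = P(a) + Q(b)\<close> on \<open>range \<pi> + ker \<pi>\<close>. The zero levels of \<open>P\<close> and \<open>Q\<close> are the two
  factors, and the volume normalisation, a Monge-Ampere equation for \<open>F\<close>, is inherited by each of them.\<close>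

text \<open>The hypotheses give \<open>h\<close> only pointwise and the Levi-Civita connection only
  through its axioms; on the cone both become partial derivatives of one smooth function, so that
  curvature computations turn into symmetries of \<open>d3 F\<close> and \<open>d4 F\<close>. The
  field e is forced: among the fields \<alpha> T + \<beta> f it must satisfy C(e, v) = - 2 G(v) on
  D2 and C(e, w) = 0 on D3, as the projection onto a factor of a Calabi product does, and this gives
  \<beta> = - \<alpha> lam3 and \<alpha> (lam2 - lam3) = r. Then lam2 lam3 = lam says that e and y -
  e are G-orthogonal, and together with lam1 = lam2 + lam3 it gives C(e, e) = - 2 G(e). Splitting
  the volume condition is less direct: the Monge-Ampere equation only makes the product of two Gram
  determinants constant on F = 0. With one factor frozen the determinant of the other is constant,
  and a rescaled frame absorbs its value. Comparing homogeneities ties the ratio of the weights k2 =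
  G(e, e) and k3 = G(y - e, y - e) to that of the dimensions n2 + 1 and n3 + 1, which produces the
  exponents of the Calabi product.\<close>

section \<open>Smooth functions\<close>

lemma Ck_on_cong:
  assumes "open S" "\<And>x. x \<in> S \<Longrightarrow> f x = g x" "Ck_on k S f"
  shows "Ck_on k S g"
  using assms(2,3)
proof (induction k arbitrary: f g)
  case 0
  then show ?case by (metis Ck_on.simps(1) continuous_on_cong)
next
  case (Suc k)
  have "frechet_derivative f (at x) = frechet_derivative g (at x)" and "g differentiable (at x)" if "x \<in> S" for x
    using that Suc.prems frechet_derivative_transform_within_open[of f x S g] \<open>open S\<close>
      has_derivative_transform_within_open[of f _ x UNIV S g]
    by (auto simp: differentiable_def, blast)
  then have "g differentiable (at x)" "frechet_derivative f (at x) v = frechet_derivative g (at x) v" if "x \<in> S" for x v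
    using that by auto
  moreover have "Ck_on k S (\<lambda>x. frechet_derivative f (at x) v)" for v
    using Suc.prems by simp
  ultimately have "Ck_on k S (\<lambda>x. frechet_derivative g (at x) v)" for v
    using Suc.IH[of "\<lambda>x. frechet_derivative f (at x) v" "\<lambda>x. frechet_derivative g (at x) v"] by simp
  with \<open>\<And>x. x \<in> S \<Longrightarrow> g differentiable (at x)\<close> show ?case by simp
qed

lemma Ck_on_SucI:
  assumes "open S" "\<And>x. x \<in> S \<Longrightarrow> (f has_derivative f' x) (at x)" "\<And>v. Ck_on k S (\<lambda>x. f' x v)"
  shows "Ck_on (Suc k) S f"
proof -
  have "f' x = frechet_derivative f (at x)" if "x \<in> S" for x
    using assms(2)[OF that] by (rule frechet_derivative_at)
  then have "Ck_on k S (\<lambda>x. frechet_derivative f (at x) v)" for v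
    using Ck_on_cong[OF assms(1) _ assms(3)] by simp
  then show ?thesis using assms(2) by (auto simp: differentiable_def)
qed

lemma Ck_on_SucD: "Ck_on (Suc k) S f \<Longrightarrow> Ck_on k S f"
proof (induction k arbitrary: f)
  case 0
  then have "isCont f x" if "x \<in> S" for x
    using that differentiable_imp_continuous_within by auto
  then show ?case by (simp add: continuous_at_imp_continuous_on)
next
  case (Suc k)
  from Suc.prems have "\<forall>x\<in>S. f differentiable (at x)"
    and "Ck_on (Suc k) S (\<lambda>x. frechet_derivative f (at x) v)" for v
    unfolding Ck_on.simps(2)[of "Suc k"] by blast+
  with Suc.IH show ?case unfolding Ck_on.simps(2)[of k] by blast
qed

lemma Ck_on_has_derivative:
  assumes "Ck_on (Suc k) S f" "x \<in> S"
  shows "(f has_derivative frechet_derivative f (at x)) (at x)"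
  using assms unfolding Ck_on.simps frechet_derivative_works by blast

lemma Ck_on_subset: "Ck_on k S f \<Longrightarrow> T \<subseteq> S \<Longrightarrow> Ck_on k T f"
proof (induction k arbitrary: f)
  case 0
  then show ?case using continuous_on_subset by simp blast
next
  case (Suc k)
  then show ?case unfolding Ck_on.simps by blast
qed

lemmas [simp del] = Ck_on.simps(2)

lemma Ck_on_const: "Ck_on k S (\<lambda>x. c)"
  by (induction k arbitrary: c) (auto simp: Ck_on.simps(2))

lemma Ck_on_id: "Ck_on k S (\<lambda>x. x)"
  by (cases k) (auto simp: Ck_on_const Ck_on.simps(2))

lemma Ck_on_bounded_linear:
  assumes "open S" "Ck_on k S f" "bounded_linear L"
  shows "Ck_on k S (\<lambda>x. L (f x))"
  using assms(2)
proof (induction k arbitrary: f)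
  case 0
  then show ?case using bounded_linear.continuous_on[OF assms(3)] by auto
next
  case (Suc k)
  show ?case
  proof (rule Ck_on_SucI[OF assms(1)])
    show "((\<lambda>x. L (f x)) has_derivative (\<lambda>v. L (frechet_derivative f (at x) v))) (at x)" if "x \<in> S" for x
      using bounded_linear.has_derivative[OF assms(3) Ck_on_has_derivative[OF Suc.prems that]] .
  qed (use Suc in \<open>simp add: Ck_on.simps(2)\<close>)
qed

lemma Ck_on_add:
  assumes "open S" "Ck_on k S f" "Ck_on k S g"
  shows "Ck_on k S (\<lambda>x. f x + g x)"
  using assms(2,3)
proof (induction k arbitrary: f g)
  case 0
  then show ?case by (auto intro: continuous_on_add)
next
  case (Suc k)
  show ?case
    by (rule Ck_on_SucI[OF assms(1) has_derivative_add[OF Ck_on_has_derivative[OF Suc.prems(1)] Ck_on_has_derivative[OF Suc.prems(2)]]])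
      (use Suc in \<open>simp_all add: Ck_on.simps(2)\<close>)
qed

lemma Ck_on_sum:
  assumes "open S" "\<And>i. i \<in> I \<Longrightarrow> Ck_on k S (f i)"
  shows "Ck_on k S (\<lambda>x. \<Sum>i\<in>I. f i x)"
  using assms(2) by (induction I rule: infinite_finite_induct) (auto simp: Ck_on_const intro: Ck_on_add[OF assms(1)])

lemma Ck_on_bilinear:
  assumes "open S" "Ck_on k S f" "Ck_on k S g" "bounded_bilinear B"
  shows "Ck_on k S (\<lambda>x. B (f x) (g x))"
  using assms(2,3)
proof (induction k arbitrary: f g)
  case 0
  then show ?case using bounded_bilinear.continuous_on[OF assms(4)] by auto
next
  case (Suc k)
  note pre = Suc.prems[THEN Ck_on_SucD]
  show ?case
    by (rule Ck_on_SucI[OF assms(1) bounded_bilinear.FDERIV[OF assms(4) Ck_on_has_derivative[OF Suc.prems(1)] Ck_on_has_derivative[OF Suc.prems(2)]]])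
      (use Suc pre in \<open>simp_all add: Ck_on.simps(2) Ck_on_add[OF assms(1)]\<close>)
qed

lemma Ck_on_compose:
  fixes g :: "'a::real_normed_vector \<Rightarrow> 'b::euclidean_space"
  assumes "open S" "open T" "Ck_on k S g" "Ck_on k T f" "g ` S \<subseteq> T"
  shows "Ck_on k S (\<lambda>x. f (g x))"
  using assms(3,4)
proof (induction k arbitrary: f)
  case 0
  then show ?case using continuous_on_compose2 assms(5) by auto
next
  case (Suc k)
  have g: "Ck_on k S g" using Suc.prems(1) by (rule Ck_on_SucD)
  show ?case
  proof (rule Ck_on_SucI[OF assms(1)])
    fix x assume x: "x \<in> S"
    \<comment> \<open>The chain rule is expanded over a basis, so that the induction hypothesis,
      which concerns derivatives in fixed directions, applies to each summand.\<close>
    let ?D = "\<lambda>v. \<Sum>b\<in>Basis. (frechet_derivative g (at x) v \<bullet> b) *\<^sub>R frechet_derivative f (at (g x)) b"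
    have f: "(f has_derivative frechet_derivative f (at (g x))) (at (g x))"
      using Suc.prems(2) Ck_on_has_derivative x assms(5) by blast
    then interpret L: linear "frechet_derivative f (at (g x))" by (rule has_derivative_linear)
    have rep: "frechet_derivative f (at (g x)) w = (\<Sum>b\<in>Basis. (w \<bullet> b) *\<^sub>R frechet_derivative f (at (g x)) b)" for w
      using L.sum[of "\<lambda>b. (w \<bullet> b) *\<^sub>R b" Basis] by (simp add: euclidean_representation L.scaleR)
    have "?D = (\<lambda>v. frechet_derivative f (at (g x)) (frechet_derivative g (at x) v))"
      by (rule ext) (rule rep[symmetric])
    then show "((\<lambda>x. f (g x)) has_derivative ?D) (at x)"
      using has_derivative_compose[OF Ck_on_has_derivative[OF Suc.prems(1) x] f] by simp
  next
    fix v
    have "Ck_on k S (\<lambda>x. frechet_derivative g (at x) v \<bullet> b)" for b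
      using Suc.prems(1) unfolding Ck_on.simps(2) by (intro Ck_on_bounded_linear[OF assms(1), where L = "\<lambda>x. x \<bullet> b"]) (auto simp: bounded_linear_inner_left)
    moreover have "Ck_on k S (\<lambda>x. frechet_derivative f (at (g x)) b)" for b
      using Suc.IH[OF g, of "\<lambda>y. frechet_derivative f (at y) b"] Suc.prems(2) unfolding Ck_on.simps(2) by blast
    ultimately show "Ck_on k S (\<lambda>x. \<Sum>b\<in>Basis. (frechet_derivative g (at x) v \<bullet> b) *\<^sub>R frechet_derivative f (at (g x)) b)"
      by (intro Ck_on_sum Ck_on_bilinear[OF assms(1) _ _ bounded_bilinear_scaleR] assms(1))
  qed
qed

lemma Ck_on_exp: "Ck_on k UNIV (exp :: real \<Rightarrow> real)"
proof (induction k)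
  case (Suc k)
  show ?case
    by (rule Ck_on_SucI[where f' = "\<lambda>x v. v * exp x"])
      (auto intro!: derivative_eq_intros Ck_on_bilinear[OF _ _ _ bounded_bilinear_mult] Ck_on_const Suc)
qed (auto intro: continuous_intros)

lemma Ck_on_inverse: "Ck_on k (- {0}) (inverse :: real \<Rightarrow> real)"
proof (induction k)
  case (Suc k)
  show ?case
  proof (rule Ck_on_SucI)
    show "(inverse has_derivative (\<lambda>v. (- v) * (inverse x * inverse x))) (at x)" if "x \<in> - {0}" for x :: real
      using that by (auto intro!: derivative_eq_intros simp: field_simps power2_eq_square)
    show "Ck_on k (- {0}) (\<lambda>x. (- v) * (inverse x * inverse x))" for v :: real
      by (intro Ck_on_bilinear[OF _ _ _ bounded_bilinear_mult] Ck_on_const Suc) auto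
  qed auto
qed (auto intro!: continuous_intros)

lemma Ck_on_ln: "Ck_on k {0<..} (ln :: real \<Rightarrow> real)"
proof (cases k)
  case (Suc k)
  show ?thesis unfolding Suc
  proof (rule Ck_on_SucI)
    show "(ln has_derivative (\<lambda>v. v * inverse x)) (at x)" if "x \<in> {0<..}" for x :: real
      using that by (auto intro!: derivative_eq_intros simp: field_simps)
    show "Ck_on k {0<..} (\<lambda>x. v * inverse x)" for v :: real
      by (intro Ck_on_bilinear[OF _ _ _ bounded_bilinear_mult] Ck_on_const Ck_on_subset[OF Ck_on_inverse]) auto
  qed auto
qed (auto intro!: continuous_intros)

section \<open>Closure properties of smooth maps\<close>

named_theorems smooth_intros

lemma smooth_on_cong: "smooth_on S f \<Longrightarrow> open S \<Longrightarrow> (\<And>x. x \<in> S \<Longrightarrow> f x = g x) \<Longrightarrow> smooth_on S g"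
  unfolding smooth_on_def using Ck_on_cong by blast

lemma smooth_on_subset: "smooth_on S f \<Longrightarrow> T \<subseteq> S \<Longrightarrow> smooth_on T f"
  unfolding smooth_on_def using Ck_on_subset by blast

lemma smooth_on_has_derivative:
  "smooth_on S f \<Longrightarrow> x \<in> S \<Longrightarrow> (f has_derivative frechet_derivative f (at x)) (at x)"
  unfolding smooth_on_def using Ck_on_has_derivative by blast

lemma smooth_on_differentiable: "smooth_on S f \<Longrightarrow> x \<in> S \<Longrightarrow> f differentiable (at x)"
  using smooth_on_has_derivative differentiable_def by blast

lemma smooth_on_linear: "smooth_on S f \<Longrightarrow> x \<in> S \<Longrightarrow> linear (frechet_derivative f (at x))"
  by (simp add: linear_frechet_derivative smooth_on_differentiable)

lemma smooth_on_continuous: "smooth_on S f \<Longrightarrow> continuous_on S f"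
  unfolding smooth_on_def using Ck_on.simps(1) by blast

lemma smooth_on_derivative: "smooth_on S f \<Longrightarrow> smooth_on S (\<lambda>x. frechet_derivative f (at x) v)"
proof -
  assume "smooth_on S f"
  then have "Ck_on (Suc k) S f" for k by (simp add: smooth_on_def)
  then show ?thesis by (simp add: smooth_on_def Ck_on.simps(2))
qed

lemma smooth_on_const [smooth_intros]: "smooth_on S (\<lambda>x. c)"
  by (simp add: smooth_on_def Ck_on_const)

lemma smooth_on_id [smooth_intros]: "smooth_on S (\<lambda>x. x)"
  by (simp add: smooth_on_def Ck_on_id)

lemma smooth_on_bounded_linear:
  "bounded_linear L \<Longrightarrow> open S \<Longrightarrow> smooth_on S f \<Longrightarrow> smooth_on S (\<lambda>x. L (f x))"
  by (simp add: smooth_on_def Ck_on_bounded_linear)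

lemma smooth_on_linear_compose:
  fixes L :: "'a::euclidean_space \<Rightarrow> 'b::real_normed_vector"
  shows "linear L \<Longrightarrow> open S \<Longrightarrow> smooth_on S f \<Longrightarrow> smooth_on S (\<lambda>x. L (f x))"
  by (simp add: smooth_on_bounded_linear linear_conv_bounded_linear)

lemmas smooth_on_fst [smooth_intros] = smooth_on_bounded_linear[OF bounded_linear_fst]
lemmas smooth_on_snd [smooth_intros] = smooth_on_bounded_linear[OF bounded_linear_snd]
lemmas smooth_on_nth [smooth_intros] = smooth_on_bounded_linear[OF bounded_linear_vec_nth]
lemmas smooth_on_minus [smooth_intros] = smooth_on_bounded_linear[OF bounded_linear_minus[OF bounded_linear_ident]]

lemma smooth_on_add [smooth_intros]:
  "open S \<Longrightarrow> smooth_on S f \<Longrightarrow> smooth_on S g \<Longrightarrow> smooth_on S (\<lambda>x. f x + g x)"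
  by (simp add: smooth_on_def Ck_on_add)

lemma smooth_on_diff [smooth_intros]:
  "open S \<Longrightarrow> smooth_on S f \<Longrightarrow> smooth_on S g \<Longrightarrow> smooth_on S (\<lambda>x. f x - g x)"
  using smooth_on_add[OF _ _ smooth_on_minus] by fastforce

lemma smooth_on_sum [smooth_intros]:
  "open S \<Longrightarrow> (\<And>i. i \<in> I \<Longrightarrow> smooth_on S (f i)) \<Longrightarrow> smooth_on S (\<lambda>x. \<Sum>i\<in>I. f i x)"
  by (simp add: smooth_on_def Ck_on_sum)

lemma smooth_on_bilinear:
  "bounded_bilinear B \<Longrightarrow> open S \<Longrightarrow> smooth_on S f \<Longrightarrow> smooth_on S g \<Longrightarrow> smooth_on S (\<lambda>x. B (f x) (g x))"
  by (simp add: smooth_on_def Ck_on_bilinear)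

lemmas smooth_on_scaleR [smooth_intros] = smooth_on_bilinear[OF bounded_bilinear_scaleR]
lemmas smooth_on_mult [smooth_intros] = smooth_on_bilinear[OF bounded_bilinear_mult[where 'a = real]]
lemmas smooth_on_inner [smooth_intros] = smooth_on_bilinear[OF bounded_bilinear_inner]

lemma smooth_on_prod [smooth_intros]:
  fixes f :: "'i \<Rightarrow> 'a::real_normed_vector \<Rightarrow> real"
  shows "open S \<Longrightarrow> (\<And>i. i \<in> I \<Longrightarrow> smooth_on S (f i)) \<Longrightarrow> smooth_on S (\<lambda>x. \<Prod>i\<in>I. f i x)"
  by (induction I rule: infinite_finite_induct) (auto intro!: smooth_intros)

lemma smooth_on_compose:
  fixes g :: "'a::real_normed_vector \<Rightarrow> 'b::euclidean_space"
  shows "smooth_on T f \<Longrightarrow> smooth_on S g \<Longrightarrow> open S \<Longrightarrow> open T \<Longrightarrow> (\<And>x. x \<in> S \<Longrightarrow> g x \<in> T) \<Longrightarrow>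
    smooth_on S (\<lambda>x. f (g x))"
  unfolding smooth_on_def using Ck_on_compose by blast

lemma smooth_on_exp [smooth_intros]:
  fixes f :: "'a::real_normed_vector \<Rightarrow> real"
  shows "open S \<Longrightarrow> smooth_on S f \<Longrightarrow> smooth_on S (\<lambda>x. exp (f x))"
  by (rule smooth_on_compose[where T = UNIV]) (auto simp: smooth_on_def Ck_on_exp)

lemma smooth_on_ln [smooth_intros]:
  fixes f :: "'a::real_normed_vector \<Rightarrow> real"
  shows "open S \<Longrightarrow> smooth_on S f \<Longrightarrow> (\<And>x. x \<in> S \<Longrightarrow> f x > 0) \<Longrightarrow> smooth_on S (\<lambda>x. ln (f x))"
  by (rule smooth_on_compose[where T = "{0<..}"]) (auto simp: smooth_on_def Ck_on_ln)

lemma smooth_on_divide [smooth_intros]: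
  fixes f g :: "'a::real_normed_vector \<Rightarrow> real"
  assumes "open S" "smooth_on S f" "smooth_on S g" "\<And>x. x \<in> S \<Longrightarrow> g x \<noteq> 0"
  shows "smooth_on S (\<lambda>x. f x / g x)"
proof -
  have "smooth_on S (\<lambda>x. inverse (g x))"
    by (rule smooth_on_compose[where T = "- {0}"]) (use assms in \<open>auto simp: smooth_on_def Ck_on_inverse\<close>)
  then show ?thesis unfolding divide_inverse using assms by (intro smooth_intros)
qed

lemma smooth_on_vec_lambda [smooth_intros]:
  fixes f :: "'i::finite \<Rightarrow> 'a::real_normed_vector \<Rightarrow> real"
  assumes "open S" "\<And>i. smooth_on S (f i)"
  shows "smooth_on S (\<lambda>x. \<chi> i. f i x)"
proof -
  have "(\<lambda>x. \<chi> i. f i x) = (\<lambda>x. \<Sum>i\<in>UNIV. f i x *\<^sub>R axis i 1)"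
    by (simp add: fun_eq_iff vec_eq_iff axis_def if_distrib cong: if_cong)
  then show ?thesis using assms by (auto intro!: smooth_intros)
qed

lemma smooth_on_Pair [smooth_intros]:
  fixes f :: "'a::real_normed_vector \<Rightarrow> 'b::real_normed_vector" and g :: "'a \<Rightarrow> 'c::real_normed_vector"
  assumes "open S" "smooth_on S f" "smooth_on S g"
  shows "smooth_on S (\<lambda>x. (f x, g x))"
proof -
  have "smooth_on S (\<lambda>x. (f x, 0) + (0, g x))"
    using assms by (intro smooth_on_add smooth_on_bounded_linear[where L = "\<lambda>x. (x, 0)"] smooth_on_bounded_linear[where L = "\<lambda>x. (0, x)"])
      (auto intro!: bounded_linear_Pair bounded_linear_ident bounded_linear_zero)
  then show ?thesis by simp
qed

lemma smooth_on_det: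
  fixes A :: "'a::real_normed_vector \<Rightarrow> real^'n^'n"
  assumes "open S" "\<And>i j. smooth_on S (\<lambda>x. A x $ i $ j)"
  shows "smooth_on S (\<lambda>x. det (A x))"
  unfolding det_def by (intro smooth_on_sum smooth_on_mult smooth_on_const smooth_on_prod assms)


section \<open>Symmetry of second derivatives\<close>

lemma derivative_along_line:
  assumes "smooth_on S f" "x + s *\<^sub>R v \<in> S"
  shows "((\<lambda>s. f (x + s *\<^sub>R v)) has_vector_derivative frechet_derivative f (at (x + s *\<^sub>R v)) v) (at s)"
proof -
  have "((\<lambda>s. x + s *\<^sub>R v) has_derivative (\<lambda>h. h *\<^sub>R v)) (at s)"
    by (auto intro!: derivative_eq_intros)
  from has_derivative_compose[OF this smooth_on_has_derivative[OF assms]]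
  show ?thesis
    unfolding has_vector_derivative_def
    by (simp add: linear_cmul[OF smooth_on_linear[OF assms]])
qed

text \<open>The mean value theorem is applied twice: in direction v to the difference
  \<open>g\<close> of two translates, then in direction w to the derivative of f along v.\<close>

lemma second_difference:
  fixes f :: "'a::real_normed_vector \<Rightarrow> real"
  assumes f: "smooth_on S f" and S: "ball x d \<subseteq> S" and h: "h > 0" "h * (norm v + norm w) < d"
  obtains y where "y \<in> ball x d"
    "f (x + h *\<^sub>R v + h *\<^sub>R w) - f (x + h *\<^sub>R v) - f (x + h *\<^sub>R w) + f x =
      h\<^sup>2 * frechet_derivative (\<lambda>y. frechet_derivative f (at y) v) (at y) w"
proof -
  have inS: "x + s *\<^sub>R v + t *\<^sub>R w \<in> ball x d" if "0 \<le> s" "s \<le> h" "0 \<le> t" "t \<le> h" for s t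
  proof -
    have "norm (s *\<^sub>R v + t *\<^sub>R w) \<le> s * norm v + t * norm w"
      using norm_triangle_ineq[of "s *\<^sub>R v" "t *\<^sub>R w"] that by simp
    also have "\<dots> \<le> h * norm v + h * norm w"
      using that by (intro add_mono mult_right_mono) auto
    finally have "norm (- (s *\<^sub>R v + t *\<^sub>R w)) < d" using h unfolding norm_minus_cancel by (simp add: distrib_left)
    then show ?thesis by (simp add: dist_norm)
  qed
  let ?f' = "\<lambda>y. frechet_derivative f (at y) v"
  have f': "smooth_on S ?f'" using f by (rule smooth_on_derivative)
  define g where "g s = f (x + h *\<^sub>R w + s *\<^sub>R v) - f (x + s *\<^sub>R v)" for s
  have "\<exists>z>0. z < h \<and> g h - g 0 = (h - 0) * (?f' (x + h *\<^sub>R w + z *\<^sub>R v) - ?f' (x + z *\<^sub>R v))"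
  proof (rule MVT2[OF h(1)])
    fix s assume s: "0 \<le> s" "s \<le> h"
    have "x + h *\<^sub>R w + s *\<^sub>R v \<in> S" "x + s *\<^sub>R v \<in> S"
      using inS[of s h] inS[of s 0] s h S by (auto simp: algebra_simps)
    then show "(g has_real_derivative ?f' (x + h *\<^sub>R w + s *\<^sub>R v) - ?f' (x + s *\<^sub>R v)) (at s)"
      unfolding g_def has_real_derivative_iff_has_vector_derivative
      by (intro has_vector_derivative_diff derivative_along_line[OF f])
  qed
  then obtain s where s: "0 < s" "s < h"
    and gs: "g h - g 0 = h * (?f' (x + h *\<^sub>R w + s *\<^sub>R v) - ?f' (x + s *\<^sub>R v))" by auto
  have "\<exists>z>0. z < h \<and> ?f' (x + s *\<^sub>R v + h *\<^sub>R w) - ?f' (x + s *\<^sub>R v + 0 *\<^sub>R w) =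
      (h - 0) * frechet_derivative ?f' (at (x + s *\<^sub>R v + z *\<^sub>R w)) w"
  proof (rule MVT2[OF h(1)])
    fix t assume t: "0 \<le> t" "t \<le> h"
    have "x + s *\<^sub>R v + t *\<^sub>R w \<in> S"
      using inS[of s t] s t S by auto
    then show "((\<lambda>t. ?f' (x + s *\<^sub>R v + t *\<^sub>R w)) has_real_derivative frechet_derivative ?f' (at (x + s *\<^sub>R v + t *\<^sub>R w)) w) (at t)"
      unfolding has_real_derivative_iff_has_vector_derivative
      by (rule derivative_along_line[OF f'])
  qed
  then obtain t where t: "0 < t" "t < h"
    and ft: "?f' (x + s *\<^sub>R v + h *\<^sub>R w) - ?f' (x + s *\<^sub>R v) = h * frechet_derivative ?f' (at (x + s *\<^sub>R v + t *\<^sub>R w)) w"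
    by auto
  show ?thesis
  proof (rule that)
    show "x + s *\<^sub>R v + t *\<^sub>R w \<in> ball x d" using inS s t by simp
    have comm: "x + h *\<^sub>R w + s *\<^sub>R v = x + s *\<^sub>R v + h *\<^sub>R w" "x + h *\<^sub>R w + h *\<^sub>R v = x + h *\<^sub>R v + h *\<^sub>R w" by auto
    show "f (x + h *\<^sub>R v + h *\<^sub>R w) - f (x + h *\<^sub>R v) - f (x + h *\<^sub>R w) + f x =
      h\<^sup>2 * frechet_derivative ?f' (at (x + s *\<^sub>R v + t *\<^sub>R w)) w"
      using gs[unfolded g_def comm ft] by (simp add: power2_eq_square)
  qed
qed

text \<open>The second difference is symmetric in v and w, so the two mixed derivatives agree at two
  points arbitrarily close to x; continuity of both moves the equality to x.\<close>

lemma second_derivative_symmetric_real: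
  fixes f :: "'a::real_normed_vector \<Rightarrow> real"
  assumes f: "smooth_on S f" and S: "open S" "x \<in> S"
  shows "frechet_derivative (\<lambda>y. frechet_derivative f (at y) v) (at x) w =
    frechet_derivative (\<lambda>y. frechet_derivative f (at y) w) (at x) v"
proof -
  define A where "A = (\<lambda>z. frechet_derivative (\<lambda>y. frechet_derivative f (at y) v) (at z) w)"
  define B where "B = (\<lambda>z. frechet_derivative (\<lambda>y. frechet_derivative f (at y) w) (at z) v)"
  have "isCont A x" "isCont B x"
    using smooth_on_continuous[OF smooth_on_derivative[OF smooth_on_derivative[OF f]]] S
      continuous_on_eq_continuous_at unfolding A_def B_def by blast+
  have "\<bar>A x - B x\<bar> \<le> e" if e: "e > 0" for e
  proof -
    obtain d1 where d1: "d1 > 0" "\<And>y. dist y x < d1 \<Longrightarrow> \<bar>A y - A x\<bar> < e / 2"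
      using \<open>isCont A x\<close> e unfolding continuous_at_eps_delta by (auto simp: dist_norm dest!: spec[of _ "e/2"])
    obtain d2 where d2: "d2 > 0" "\<And>y. dist y x < d2 \<Longrightarrow> \<bar>B y - B x\<bar> < e / 2"
      using \<open>isCont B x\<close> e unfolding continuous_at_eps_delta by (auto simp: dist_norm dest!: spec[of _ "e/2"])
    obtain d3 where d3: "d3 > 0" "ball x d3 \<subseteq> S"
      using S open_contains_ball by blast
    define d where "d = Min {d1, d2, d3}"
    have d: "d > 0" "d \<le> d1" "d \<le> d2" "ball x d \<subseteq> S"
      using d1 d2 d3 by (auto simp: d_def)
    \<comment> \<open>The summand 1 keeps the denominator positive and makes the bound
      \<open>h * (norm v + norm w) < d\<close> strict, also for v = w = 0.\<close>
    define h where "h = d / (norm v + norm w + 1)"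
    have h: "h > 0" using d(1) by (auto simp: h_def intro!: divide_pos_pos add_nonneg_pos)
    have "h * (norm v + norm w + 1) = d"
      unfolding h_def by (simp add: add_nonneg_eq_0_iff)
    then have hd: "h * (norm v + norm w) < d" "h * (norm w + norm v) < d"
      using h by (auto simp: algebra_simps)
    obtain y where y: "y \<in> ball x d"
      "f (x + h *\<^sub>R v + h *\<^sub>R w) - f (x + h *\<^sub>R v) - f (x + h *\<^sub>R w) + f x = h\<^sup>2 * A y"
      using second_difference[OF f d(4) h hd(1)] unfolding A_def by metis
    obtain z where z: "z \<in> ball x d"
      "f (x + h *\<^sub>R w + h *\<^sub>R v) - f (x + h *\<^sub>R w) - f (x + h *\<^sub>R v) + f x = h\<^sup>2 * B z"
      using second_difference[OF f d(4) h hd(2)] unfolding B_def by metis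
    have comm: "x + h *\<^sub>R w + h *\<^sub>R v = x + h *\<^sub>R v + h *\<^sub>R w" by simp
    have "h\<^sup>2 * A y = h\<^sup>2 * B z"
      using y(2) z(2)[unfolded comm] by linarith
    then have "A y = B z" using h by simp
    moreover have "\<bar>A y - A x\<bar> < e / 2" "\<bar>B z - B x\<bar> < e / 2"
      using d1(2)[of y] d2(2)[of z] y(1) z(1) d by (auto simp: dist_commute)
    ultimately show ?thesis by linarith
  qed
  then have "\<bar>A x - B x\<bar> \<le> 0" by (rule field_le_epsilon) simp
  then show ?thesis by (simp add: A_def B_def)
qed

lemma frechet_derivative_inner:
  assumes "smooth_on S f" "x \<in> S"
  shows "frechet_derivative (\<lambda>y. f y \<bullet> b) (at x) v = frechet_derivative f (at x) v \<bullet> b"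
  using frechet_derivative_at[OF bounded_linear.has_derivative[OF bounded_linear_inner_left smooth_on_has_derivative[OF assms]]]
  by metis

lemma second_derivative_symmetric:
  fixes f :: "'a::real_normed_vector \<Rightarrow> 'b::real_inner"
  assumes f: "smooth_on S f" and S: "open S" "x \<in> S"
  shows "frechet_derivative (\<lambda>y. frechet_derivative f (at y) v) (at x) w =
    frechet_derivative (\<lambda>y. frechet_derivative f (at y) w) (at x) v"
proof -
  have eq: "frechet_derivative (\<lambda>y. frechet_derivative f (at y) v) (at x) w \<bullet> b =
    frechet_derivative (\<lambda>y. frechet_derivative (\<lambda>y. f y \<bullet> b) (at y) v) (at x) w" for v w b
  proof -
    have "frechet_derivative (\<lambda>y. frechet_derivative f (at y) v \<bullet> b) (at x) =
      frechet_derivative (\<lambda>y. frechet_derivative (\<lambda>y. f y \<bullet> b) (at y) v) (at x)"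
      by (rule frechet_derivative_transform_within_open[OF _ S])
        (use frechet_derivative_inner[OF f] smooth_on_differentiable[OF smooth_on_bounded_linear[OF bounded_linear_inner_left S(1) smooth_on_derivative[OF f]] S(2)] in auto)
    then show ?thesis using frechet_derivative_inner[OF smooth_on_derivative[OF f] S(2), of v b w] by simp
  qed
  have "smooth_on S (\<lambda>y. f y \<bullet> b)" for b
    by (rule smooth_on_bounded_linear[OF bounded_linear_inner_left S(1) f])
  then have "frechet_derivative (\<lambda>y. frechet_derivative f (at y) v) (at x) w \<bullet> b =
    frechet_derivative (\<lambda>y. frechet_derivative f (at y) w) (at x) v \<bullet> b" for b
    unfolding eq by (rule second_derivative_symmetric_real[OF _ S])
  then show ?thesis by (rule vector_eq_rdot[THEN iffD1, OF allI])
qed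

section \<open>The smooth inverse function theorem\<close>

lemma smooth_on_inverse_matrix:
  fixes A :: "'a::real_normed_vector \<Rightarrow> real^'n \<Rightarrow> real^'n"
  assumes S: "open S" and A: "\<And>v. smooth_on S (\<lambda>x. A x v)" "\<And>x. x \<in> S \<Longrightarrow> linear (A x)" "\<And>x. x \<in> S \<Longrightarrow> bij (A x)"
  shows "smooth_on S (\<lambda>x. inv (A x) v)"
proof -
  have entry: "smooth_on S (\<lambda>x. matrix (A x) $ i $ j)" for i j
    unfolding matrix_def by (simp add: smooth_on_nth[OF S A(1)])
  have det0: "det (matrix (A x)) \<noteq> 0" if "x \<in> S" for x
    using that A(2,3) det_nz_iff_inj bij_is_inj by blast
  \<comment> \<open>Cramer's rule: each coordinate of the preimage is a quotient of determinants,
    hence smooth.\<close>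
  have "smooth_on S (\<lambda>x. \<chi> k. det (\<chi> i j. if j = k then v $ i else matrix (A x) $ i $ j) / det (matrix (A x)))"
  proof (intro smooth_on_vec_lambda smooth_on_divide smooth_on_det S entry det0)
    show "smooth_on S (\<lambda>x. (\<chi> i j. if j = k then v $ i else matrix (A x) $ i $ j) $ i $ j)" for k i j
      by (cases "j = k") (simp_all add: smooth_on_const entry)
  qed
  then show ?thesis
  proof (rule smooth_on_cong[OF _ S])
    fix x assume x: "x \<in> S"
    have "matrix (A x) *v inv (A x) v = v"
      unfolding matrix_works[OF A(2)[OF x, folded linear_matrix_vector_mul_eq]] by (rule surj_f_inv_f[OF bij_is_surj[OF A(3)[OF x]]])
    from cramer[OF det0[OF x], THEN iffD1, OF this]
    show "(\<chi> k. det (\<chi> i j. if j = k then v $ i else matrix (A x) $ i $ j) / det (matrix (A x))) = inv (A x) v"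
      by (rule sym)
  qed
qed

text \<open>The library theorem gives a once differentiable inverse g. Its derivative at y is the
  inverse of the derivative of f at g y, so \<open>Ck_on k\<close> for g implies
  \<open>Ck_on (Suc k)\<close>, and g is smooth by induction.\<close>

theorem smooth_inverse_function:
  fixes f :: "real^'n \<Rightarrow> real^'n"
  assumes S: "open S" and f: "smooth_on S f" and x0: "x0 \<in> S" and inj: "inj (frechet_derivative f (at x0))"
  obtains U V g where "open U" "U \<subseteq> S" "x0 \<in> U" "open V" "f x0 \<in> V" "homeomorphism U V f g" "smooth_on V g"
    "\<And>x. x \<in> U \<Longrightarrow> bij (frechet_derivative f (at x))"
proof -
  define f' where "f' x = Blinfun (frechet_derivative f (at x))" for x
  have bl: "bounded_linear (frechet_derivative f (at x))" if "x \<in> S" for x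
    using smooth_on_linear[OF f that] by (simp add: linear_conv_bounded_linear)
  have f': "blinfun_apply (f' x) = frechet_derivative f (at x)" if "x \<in> S" for x
    unfolding f'_def using bounded_linear_Blinfun_apply[OF bl[OF that]] .
  have cont: "continuous_on S f'"
  proof (rule continuous_on_blinfun_componentwise)
    fix b :: "real^'n"
    have "continuous_on S (\<lambda>x. frechet_derivative f (at x) b)"
      by (rule smooth_on_continuous[OF smooth_on_derivative[OF f]])
    then show "continuous_on S (\<lambda>x. blinfun_apply (f' x) b)"
      using f' by (simp cong: continuous_on_cong)
  qed
  obtain k where k: "linear k" "k \<circ> frechet_derivative f (at x0) = id"
    using linear_injective_left_inverse[OF smooth_on_linear[OF f x0] inj] by auto
  have inv: "Blinfun k o\<^sub>L f' x0 = id_blinfun"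
    using k f'[OF x0] by (intro blinfun_eqI) (simp add: bounded_linear_Blinfun_apply linear_conv_bounded_linear fun_eq_iff)
  obtain U V g g' where UV: "open U" "U \<subseteq> S" "x0 \<in> U" "open V" "f x0 \<in> V" "homeomorphism U V f g"
    and g': "\<And>y. y \<in> V \<Longrightarrow> (g has_derivative (g' y)) (at y)"
      "\<And>y. y \<in> V \<Longrightarrow> g' y = inv (blinfun_apply (f' (g y)))"
      "\<And>y. y \<in> V \<Longrightarrow> bij (blinfun_apply (f' (g y)))"
  proof (rule inverse_function_theorem[OF S _ cont x0 inv])
    show "(f has_derivative blinfun_apply (f' x)) (at x)" if "x \<in> S" for x
      using smooth_on_has_derivative[OF f that] f'[OF that] by simp
  qed blast+
  have gU: "g y \<in> U" if "y \<in> V" for y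
    using UV(6) that unfolding homeomorphism_def by blast
  have bij: "bij (frechet_derivative f (at x))" if "x \<in> U" for x
  proof -
    have "f x \<in> V" "g (f x) = x" using UV(6) that unfolding homeomorphism_def by auto
    then show ?thesis using g'(3) f' UV(2) that by (metis subsetD)
  qed
  have inv_smooth: "smooth_on U (\<lambda>x. inv (frechet_derivative f (at x)) v)" for v
    by (rule smooth_on_inverse_matrix[OF UV(1)])
      (use bij smooth_on_linear[OF f] UV(2) smooth_on_subset[OF smooth_on_derivative[OF f]] in auto)
  have "Ck_on k V g" for k
  proof (induction k)
    case 0
    then show ?case using UV(6) unfolding homeomorphism_def by simp
  next
    case (Suc k)
    show ?case
    proof (rule Ck_on_SucI[OF UV(4) g'(1)])
      fix v
      have "Ck_on k V (\<lambda>y. inv (frechet_derivative f (at (g y))) v)"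
        using inv_smooth gU by (intro Ck_on_compose[OF UV(4,1) Suc]) (auto simp: smooth_on_def)
      then show "Ck_on k V (\<lambda>y. g' y v)"
        by (rule Ck_on_cong[OF UV(4), rotated]) (use g'(2) f' gU UV(2) in \<open>simp add: subset_iff\<close>)
    qed
  qed
  then have "smooth_on V g" by (simp add: smooth_on_def)
  with UV bij that show ?thesis by blast
qed

section \<open>Splitting of Hessian metrics\<close>

lemma linear_euclidean_expansion:
  fixes L :: "'v::euclidean_space \<Rightarrow> 'b::real_vector"
  assumes "linear L"
  shows "L x = (\<Sum>b\<in>Basis. (x \<bullet> b) *\<^sub>R L b)"
proof -
  have "L x = L (\<Sum>b\<in>Basis. (x \<bullet> b) *\<^sub>R b)" by (simp only: euclidean_representation)
  also have "\<dots> = (\<Sum>b\<in>Basis. (x \<bullet> b) *\<^sub>R L b)"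
    by (simp add: linear_sum[OF assms] linear_cmul[OF assms])
  finally show ?thesis .
qed

text \<open>A product rule that asks for derivatives of g only at fixed vectors u: expanding v z in
  a basis leaves finitely many of them. It lets tensor fields be treated as curried functions, one
  argument at a time.\<close>

lemma has_derivative_linear_argument:
  fixes g :: "'a::real_normed_vector \<Rightarrow> 'v::euclidean_space \<Rightarrow> 'b::real_normed_vector"
  assumes S: "open S" "y \<in> S" and g: "\<And>z. z \<in> S \<Longrightarrow> linear (g z)"
    and g': "\<And>u. ((\<lambda>z. g z u) has_derivative (\<lambda>x. g' x u)) (at y)" "\<And>x. linear (g' x)"
    and v: "(v has_derivative v') (at y)"
  shows "((\<lambda>z. g z (v z)) has_derivative (\<lambda>x. g' x (v y) + g y (v' x))) (at y)"
proof -
  have "((\<lambda>z. \<Sum>b\<in>Basis. (v z \<bullet> b) *\<^sub>R g z b) has_derivative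
      (\<lambda>x. \<Sum>b\<in>Basis. (v y \<bullet> b) *\<^sub>R g' x b + (v' x \<bullet> b) *\<^sub>R g y b)) (at y)"
    using v g'(1) by (intro derivative_intros has_derivative_scaleR) auto
  moreover have "(\<lambda>x. \<Sum>b\<in>Basis. (v y \<bullet> b) *\<^sub>R g' x b + (v' x \<bullet> b) *\<^sub>R g y b) = (\<lambda>x. g' x (v y) + g y (v' x))"
    unfolding linear_euclidean_expansion[OF g'(2), of _ "v y"] linear_euclidean_expansion[OF g[OF S(2)], of "v' _"]
    by (simp add: sum.distrib)
  ultimately have "((\<lambda>z. \<Sum>b\<in>Basis. (v z \<bullet> b) *\<^sub>R g z b) has_derivative (\<lambda>x. g' x (v y) + g y (v' x))) (at y)"
    by simp
  then show ?thesis
    by (rule has_derivative_transform_within_open[OF _ S])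
      (rule linear_euclidean_expansion[OF g, symmetric])
qed

lemma has_derivative_constant_on:
  assumes "(f has_derivative f') (at y)" "open S" "y \<in> S" "\<And>z. z \<in> S \<Longrightarrow> f z = c"
  shows "f' x = 0"
proof -
  have "((\<lambda>z. c) has_derivative f') (at y)"
    by (rule has_derivative_transform_within_open[OF assms(1-3)]) (use assms(4) in simp)
  then have "f' = (\<lambda>x. 0)" using has_derivative_unique has_derivative_const by blast
  then show ?thesis by simp
qed

lemma has_derivative_eq_on:
  assumes "(f has_derivative f') (at y)" "(g has_derivative g') (at y)" "open S" "y \<in> S" "\<And>z. z \<in> S \<Longrightarrow> f z = g z"
  shows "f' x = g' x"
  using has_derivative_unique[OF has_derivative_transform_within_open[OF assms(1,3,4), OF assms(5)] assms(2)] by simp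

text \<open>\<open>G\<close> stands for a Hessian metric, \<open>C\<close> and \<open>Q\<close> for its first and second derivatives, and \<open>e\<close> for the
  component of the position vector field in \<open>E2\<close>.\<close>

locale hessian_splitting =
  fixes S :: "'v::euclidean_space set"
    and G :: "'v \<Rightarrow> 'v \<Rightarrow> 'v \<Rightarrow> real" and C :: "'v \<Rightarrow> 'v \<Rightarrow> 'v \<Rightarrow> 'v \<Rightarrow> real"
    and Q :: "'v \<Rightarrow> 'v \<Rightarrow> 'v \<Rightarrow> 'v \<Rightarrow> 'v \<Rightarrow> real"
    and e :: "'v \<Rightarrow> 'v" and De :: "'v \<Rightarrow> 'v \<Rightarrow> 'v" and H :: "'v \<Rightarrow> 'v \<Rightarrow> 'v \<Rightarrow> 'v"
    and E2 E3 :: "'v \<Rightarrow> 'v set" and k2 k3 :: real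
  assumes S: "open S"
    and G_deriv: "\<And>z u v. z \<in> S \<Longrightarrow> ((\<lambda>z. G z u v) has_derivative (\<lambda>x. C z x u v)) (at z)"
    and C_deriv: "\<And>z u v w. z \<in> S \<Longrightarrow> ((\<lambda>z. C z u v w) has_derivative (\<lambda>x. Q z x u v w)) (at z)"
    and G_linear: "\<And>z v. z \<in> S \<Longrightarrow> linear (\<lambda>u. G z u v)"
    and G_sym: "\<And>z u v. z \<in> S \<Longrightarrow> G z u v = G z v u"
    and G_pos: "\<And>z u. z \<in> S \<Longrightarrow> u \<noteq> 0 \<Longrightarrow> G z u u > 0"
    and C_sym: "\<And>z u v w. z \<in> S \<Longrightarrow> C z u v w = C z v u w" "\<And>z u v w. z \<in> S \<Longrightarrow> C z u v w = C z u w v"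
    and Q_sym: "\<And>z x u v w. z \<in> S \<Longrightarrow> Q z x u v w = Q z u x v w"
      "\<And>z x u v w. z \<in> S \<Longrightarrow> Q z x u v w = Q z x v u w" "\<And>z x u v w. z \<in> S \<Longrightarrow> Q z x u v w = Q z x u w v"
    and e_deriv: "\<And>z. z \<in> S \<Longrightarrow> (e has_derivative De z) (at z)"
    and De_deriv: "\<And>z u. z \<in> S \<Longrightarrow> ((\<lambda>z. De z u) has_derivative (\<lambda>x. H z x u)) (at z)"
    and H_sym: "\<And>z u v. z \<in> S \<Longrightarrow> H z u v = H z v u"
    and sub2: "\<And>z. z \<in> S \<Longrightarrow> subspace (E2 z)" and sub3: "\<And>z. z \<in> S \<Longrightarrow> subspace (E3 z)"
    and decomp: "\<And>z u. z \<in> S \<Longrightarrow> \<exists>v\<in>E2 z. \<exists>w\<in>E3 z. u = v + w"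
    and e2: "\<And>z. z \<in> S \<Longrightarrow> e z \<in> E2 z" and e3: "\<And>z. z \<in> S \<Longrightarrow> z - e z \<in> E3 z"
    and G_orth: "\<And>z v w. z \<in> S \<Longrightarrow> v \<in> E2 z \<Longrightarrow> w \<in> E3 z \<Longrightarrow> G z v w = 0"
    and C_orth: "\<And>z v w x. z \<in> S \<Longrightarrow> v \<in> E2 z \<Longrightarrow> w \<in> E3 z \<Longrightarrow> C z v w x = 0"
    and C_e2: "\<And>z v x. z \<in> S \<Longrightarrow> v \<in> E2 z \<Longrightarrow> C z (e z) v x = - 2 * G z v x"
    and C_e3: "\<And>z w x. z \<in> S \<Longrightarrow> w \<in> E3 z \<Longrightarrow> C z (z - e z) w x = - 2 * G z w x"
    and G_e2: "\<And>z. z \<in> S \<Longrightarrow> G z (e z) (e z) = k2"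
    and G_e3: "\<And>z. z \<in> S \<Longrightarrow> G z (z - e z) (z - e z) = k3"
    and section2: "\<And>z v. z \<in> S \<Longrightarrow> v \<in> E2 z \<Longrightarrow> \<exists>s. s z = v \<and> (\<forall>y\<in>S. s y \<in> E2 y \<and> s differentiable (at y))"
    and section3: "\<And>z w. z \<in> S \<Longrightarrow> w \<in> E3 z \<Longrightarrow> \<exists>s. s z = w \<and> (\<forall>y\<in>S. s y \<in> E3 y \<and> s differentiable (at y))"
begin

lemma G_linear2: "z \<in> S \<Longrightarrow> linear (G z u)"
proof -
  assume z: "z \<in> S"
  then have "(\<lambda>v. G z v u) = G z u" using G_sym by blast
  with G_linear[OF z, of u] show ?thesis by simp
qed

lemma C_linear1: "z \<in> S \<Longrightarrow> linear (\<lambda>x. C z x u v)"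
  using G_deriv has_derivative_linear by blast

lemma C_linear2: "z \<in> S \<Longrightarrow> linear (\<lambda>x. C z u x v)"
  using C_linear1[of z u v] C_sym(1)[of z] by presburger

lemma C_linear3: "z \<in> S \<Longrightarrow> linear (C z u v)"
  using C_linear2[of z u v] C_sym(2)[of z] by presburger

lemma De_linear: "z \<in> S \<Longrightarrow> linear (De z)"
  using e_deriv has_derivative_linear by blast

lemma Q_linear1: "z \<in> S \<Longrightarrow> linear (\<lambda>x. Q z x u v w)"
  using C_deriv has_derivative_linear by blast

lemma Q_linear2: "z \<in> S \<Longrightarrow> linear (\<lambda>x. Q z u x v w)"
  using Q_linear1[of z u v w] Q_sym(1)[of z] by presburger

lemma Q_linear3: "z \<in> S \<Longrightarrow> linear (\<lambda>x. Q z u v x w)"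
  using Q_linear2[of z u v w] Q_sym(2)[of z] by presburger

lemma H_linear: "z \<in> S \<Longrightarrow> linear (H z x)"
  using De_deriv[THEN has_derivative_linear, of z x] H_sym[of z] by presburger

lemmas G_simps = linear_add[OF G_linear] linear_add[OF G_linear2] linear_diff[OF G_linear] linear_diff[OF G_linear2]
  linear_cmul[OF G_linear] linear_cmul[OF G_linear2] linear_neg[OF G_linear] linear_neg[OF G_linear2]
  linear_0[OF G_linear] linear_0[OF G_linear2]

lemma G_fields:
  assumes z: "z \<in> S" and s: "(s has_derivative s') (at z)" and t: "(t has_derivative t') (at z)"
  shows "((\<lambda>z. G z (s z) (t z)) has_derivative (\<lambda>x. C z x (s z) (t z) + G z (s' x) (t z) + G z (s z) (t' x))) (at z)"
proof -
  have 1: "((\<lambda>z. G z (s z) u) has_derivative (\<lambda>x. C z x (s z) u + G z (s' x) u)) (at z)" for u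
    by (rule has_derivative_linear_argument[OF S z _ _ _ s, where g = "\<lambda>z x. G z x u" and g' = "\<lambda>x y. C z x y u"])
      (use G_linear C_linear2 G_deriv z in auto)
  show ?thesis
  proof (rule has_derivative_linear_argument[OF S z _ 1 _ t])
    show "linear (\<lambda>u. C z x (s z) u + G z (s' x) u)" for x
      by (intro linear_compose_add C_linear3 G_linear2 z)
  qed (rule G_linear2)
qed

lemma C_fields:
  assumes z: "z \<in> S" and s: "(s has_derivative s') (at z)" and t: "(t has_derivative t') (at z)"
  shows "((\<lambda>z. C z (s z) (t z) u) has_derivative (\<lambda>x. Q z x (s z) (t z) u + C z (s' x) (t z) u + C z (s z) (t' x) u)) (at z)"
proof -
  have 1: "((\<lambda>z. C z (s z) v u) has_derivative (\<lambda>x. Q z x (s z) v u + C z (s' x) v u)) (at z)" for v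
    by (rule has_derivative_linear_argument[OF S z _ _ _ s, where g = "\<lambda>z x. C z x v u" and g' = "\<lambda>x y. Q z x y v u"])
      (use C_linear1 Q_linear2 C_deriv z in auto)
  show ?thesis
  proof (rule has_derivative_linear_argument[OF S z _ 1 _ t])
    show "linear (\<lambda>v. Q z x (s z) v u + C z (s' x) v u)" for x
      by (intro linear_compose_add Q_linear3 C_linear2 z)
  qed (rule C_linear2)
qed

definition section_of :: "('v \<Rightarrow> 'v set) \<Rightarrow> ('v \<Rightarrow> 'v) \<Rightarrow> bool" where
  "section_of E s \<longleftrightarrow> (\<forall>y\<in>S. s y \<in> E y \<and> s differentiable (at y))"

abbreviation D :: "('v \<Rightarrow> 'v) \<Rightarrow> 'v \<Rightarrow> 'v \<Rightarrow> 'v" where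
  "D s z \<equiv> frechet_derivative s (at z)"

lemma section_derivative: "section_of E s \<Longrightarrow> z \<in> S \<Longrightarrow> (s has_derivative D s z) (at z)"
  unfolding section_of_def using frechet_derivative_works by blast

lemma section_in: "section_of E s \<Longrightarrow> z \<in> S \<Longrightarrow> s z \<in> E z"
  unfolding section_of_def by blast

lemma e_section: "section_of E2 e" and D_e: "z \<in> S \<Longrightarrow> D e z = De z"
  using e2 e_deriv frechet_derivative_at unfolding section_of_def differentiable_def by (blast, metis)

lemma eps_section: "section_of E3 (\<lambda>z. z - e z)" and D_eps: "z \<in> S \<Longrightarrow> D (\<lambda>z. z - e z) z = (\<lambda>x. x - De z x)"
proof -
  have *: "((\<lambda>z. z - e z) has_derivative (\<lambda>x. x - De z x)) (at z)" if "z \<in> S" for z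
    by (intro has_derivative_diff has_derivative_ident e_deriv that)
  then show "section_of E3 (\<lambda>z. z - e z)"
    using e3 unfolding section_of_def differentiable_def by blast
  show "z \<in> S \<Longrightarrow> D (\<lambda>z. z - e z) z = (\<lambda>x. x - De z x)"
    using * frechet_derivative_at by metis
qed

lemma obtain_section2:
  assumes "z \<in> S" "v \<in> E2 z" obtains s where "section_of E2 s" "s z = v"
  using section2[OF assms] unfolding section_of_def by blast

lemma obtain_section3:
  assumes "z \<in> S" "v \<in> E3 z" obtains s where "section_of E3 s" "s z = v"
  using section3[OF assms] unfolding section_of_def by blast

text \<open>Differentiate G(s, t) = 0; the term with the derivative of G vanishes by
  \<open>C_orth\<close> and the symmetry of C.\<close>

lemma G_sections:
  assumes "z \<in> S" "section_of E2 s" "section_of E3 t"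
  shows "G z (s z) (D t z x) = - G z (D s z x) (t z)"
proof -
  note st = assms(2,3)[THEN section_in]
  have "C z x (s z) (t z) + G z (D s z x) (t z) + G z (s z) (D t z x) = 0"
    by (rule has_derivative_constant_on[OF G_fields[OF assms(1) section_derivative[OF assms(2,1)] section_derivative[OF assms(3,1)]] S assms(1)])
      (use st G_orth in auto)
  moreover have "C z x (s z) (t z) = 0"
    using C_orth[OF assms(1) st[OF assms(1)], of x] C_sym[OF assms(1)] by metis
  ultimately show ?thesis by simp
qed

lemma C_sections:
  assumes "z \<in> S" "section_of E2 s" "section_of E3 t"
  shows "Q z x (s z) (t z) u + C z (D s z x) (t z) u + C z (s z) (D t z x) u = 0"
  by (rule has_derivative_constant_on[OF C_fields[OF assms(1) section_derivative[OF assms(2,1)] section_derivative[OF assms(3,1)]] S assms(1)])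
    (use assms(2,3)[THEN section_in] C_orth in auto)

text \<open>Differentiating C(s, t, u) = 0 expresses Q through the derivatives of the sections. For
  u = e one of the two remaining terms dies by orthogonality and \<open>C_e2\<close> turns the other
  into a value of G.\<close>

lemma Q_e2:
  assumes "z \<in> S" "section_of E2 s" "section_of E3 t"
  shows "Q z x (s z) (t z) (e z) = - 2 * G z (D s z x) (t z)"
proof -
  have "C z (D s z x) (t z) (e z) = 0"
    using C_orth[OF assms(1) e2[OF assms(1)] section_in[OF assms(3,1)]] C_sym[OF assms(1)] by metis
  moreover have "C z (s z) (D t z x) (e z) = - 2 * G z (s z) (D t z x)"
    using C_e2[OF assms(1) section_in[OF assms(2,1)]] C_sym[OF assms(1)] by metis
  ultimately show ?thesis
    using C_sections[OF assms, of x "e z"] G_sections[OF assms, of x] by simp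
qed

lemma Q_e3:
  assumes "z \<in> S" "section_of E2 s" "section_of E3 t"
  shows "Q z x (s z) (t z) (z - e z) = 2 * G z (D s z x) (t z)"
proof -
  have "C z (s z) (D t z x) (z - e z) = 0"
    using C_orth[OF assms(1) section_in[OF assms(2,1)] e3[OF assms(1)]] C_sym[OF assms(1)] by metis
  moreover have "C z (D s z x) (t z) (z - e z) = - 2 * G z (D s z x) (t z)"
    using C_e3[OF assms(1) section_in[OF assms(3,1)]] C_sym[OF assms(1)] G_sym[OF assms(1)] by metis
  ultimately show ?thesis
    using C_sections[OF assms, of x "z - e z"] by simp
qed

text \<open>The number Q(v, e, w, z - e) is evaluated twice: as a derivative along v of C(e, t, .) =
  0 and, by total symmetry, as a derivative along w of C(s, z - e, .) = 0.\<close>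

lemma De_antisym:
  assumes z: "z \<in> S" and v: "v \<in> E2 z" and w: "w \<in> E3 z"
  shows "G z v (De z w) = - G z (De z v) w"
proof -
  obtain s where s: "section_of E2 s" "s z = v" by (rule obtain_section2[OF z v])
  obtain t where t: "section_of E3 t" "t z = w" by (rule obtain_section3[OF z w])
  have 1: "Q z v (e z) w (z - e z) = 2 * G z (De z v) w"
    using Q_e3[OF z e_section t(1), of v] t(2) D_e[OF z] by simp
  have 2: "Q z w v (z - e z) (e z) = - 2 * G z (D s z w) (z - e z)"
    using Q_e2[OF z s(1) eps_section, of w] s(2) by simp
  have 3: "G z v (w - De z w) = - G z (D s z w) (z - e z)"
    using G_sections[OF z s(1) eps_section, of w] s(2) D_eps[OF z] by simp
  have "Q z v (e z) w (z - e z) = Q z w v (z - e z) (e z)"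
    using Q_sym[OF z] by metis
  then show ?thesis using 1 2 3 G_orth[OF z v w] G_simps[OF z] by simp
qed

text \<open>Differentiate G(e, e) = k2 and replace C(x, e, e) by - 2 G(x, e).\<close>

lemma G_De_e:
  assumes z: "z \<in> S" shows "G z (De z x) (e z) = G z x (e z)"
proof -
  have "C z x (e z) (e z) + G z (De z x) (e z) + G z (e z) (De z x) = 0"
    by (rule has_derivative_constant_on[OF G_fields[OF z e_deriv[OF z] e_deriv[OF z]] S z]) (rule G_e2)
  moreover have "C z x (e z) (e z) = - 2 * G z x (e z)"
    using C_e2[OF z e2[OF z], of x] C_sym[OF z] G_sym[OF z] by metis
  ultimately show ?thesis using G_sym[OF z, of "e z"] by simp
qed

text \<open>The axioms are symmetric in the two summands: exchanging them replaces De by I - De and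
  H by - H. Every fact about \<open>E2\<close> thereby yields one about \<open>E3\<close>.\<close>

lemma swap: "hessian_splitting S G C Q (\<lambda>z. z - e z) (\<lambda>z x. x - De z x) (\<lambda>z x u. - H z x u) E3 E2 k3 k2"
proof (rule hessian_splitting.intro)
  show "((\<lambda>z. z - e z) has_derivative (\<lambda>x. x - De z x)) (at z)" if "z \<in> S" for z
    by (intro has_derivative_diff has_derivative_ident e_deriv that)
  show "((\<lambda>z. u - De z u) has_derivative (\<lambda>x. - H z x u)) (at z)" if "z \<in> S" for z u
    using has_derivative_diff[OF has_derivative_const[of u] De_deriv[OF that, of u]] by simp
  show "G z v w = 0" if "z \<in> S" "v \<in> E3 z" "w \<in> E2 z" for z v w
    using G_orth G_sym that by metis
  show "C z v w x = 0" if "z \<in> S" "v \<in> E3 z" "w \<in> E2 z" for z v w x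
    using C_orth C_sym(1) that by metis
  show "\<exists>v\<in>E3 z. \<exists>w\<in>E2 z. u = v + w" if "z \<in> S" for z u
    using decomp[OF that, of u] by (metis add.commute)
qed (fact S G_deriv C_deriv G_linear G_sym G_pos C_sym Q_sym sub2 sub3 e3 C_e3 G_e3 section2 section3
    | simp add: H_sym e2 C_e2 G_e2)+

lemma zero_in_E2:
  assumes z: "z \<in> S" and u: "\<And>v. v \<in> E2 z \<Longrightarrow> G z v u = 0" shows "u \<in> E3 z"
proof -
  obtain v w where vw: "v \<in> E2 z" "w \<in> E3 z" "u = v + w" using decomp[OF z] by blast
  then have "G z v v = 0" using u[OF vw(1)] G_orth[OF z vw(1,2)] G_simps[OF z] by simp
  then have "v = 0" using G_pos[OF z] by force
  then show ?thesis using vw by simp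
qed

lemma orth_both_zero:
  assumes z: "z \<in> S" and "\<And>v. v \<in> E2 z \<Longrightarrow> G z v u = 0" "\<And>w. w \<in> E3 z \<Longrightarrow> G z w u = 0" shows "u = 0"
proof (rule ccontr)
  assume "u \<noteq> 0"
  moreover obtain v w where "v \<in> E2 z" "w \<in> E3 z" "u = v + w" using decomp[OF z] by blast
  ultimately show False using assms G_pos[OF z, of u] linear_add[OF G_linear[OF z], of v w u] by simp
qed

text \<open>Tested against both summands. Against E3, \<open>De_antisym\<close> and
  \<open>G_De_e\<close> suffice; against E2, symmetry of Q in its first two arguments e, v compares
  derivatives along e and along v, and the latter vanishes by the exchanged form of
  \<open>G_De_e\<close>.\<close>

lemma De_e:
  assumes z: "z \<in> S" shows "De z (e z) = e z"
proof -
  interpret swap: hessian_splitting S G C Q "\<lambda>z. z - e z" "\<lambda>z x. x - De z x" "\<lambda>z x u. - H z x u" E3 E2 k3 k2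
    by (rule swap)
  have "e z - De z (e z) = 0"
  proof (rule orth_both_zero[OF z])
    fix w assume w: "w \<in> E3 z"
    have "G z w (De z (e z)) = 0"
      using De_antisym[OF z e2[OF z] w] G_De_e[OF z, of w] G_orth[OF z e2[OF z] w] G_sym[OF z] by simp
    then show "G z w (e z - De z (e z)) = 0"
      using G_orth[OF z e2[OF z] w] G_sym[OF z] G_simps[OF z] by simp
  next
    fix v assume v: "v \<in> E2 z"
    obtain s where s: "section_of E2 s" "s z = v" by (rule obtain_section2[OF z v])
    have "Q z (e z) v (z - e z) (e z) = - 2 * G z (D s z (e z)) (z - e z)"
      using Q_e2[OF z s(1) eps_section, of "e z"] s(2) by simp
    moreover have "Q z v (e z) (z - e z) (e z) = - 2 * G z (De z v) (z - e z)"
      using Q_e2[OF z e_section eps_section, of v] D_e[OF z] by simp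
    moreover have "G z v (e z - De z (e z)) = - G z (D s z (e z)) (z - e z)"
      using G_sections[OF z s(1) eps_section, of "e z"] s(2) D_eps[OF z] by simp
    moreover have "G z (De z v) (z - e z) = 0"
      using swap.G_De_e[OF z, of v] linear_diff[OF G_linear[OF z]] by simp
    ultimately show "G z v (e z - De z (e z)) = 0"
      using Q_sym(1)[OF z, of "e z" v] by simp
  qed
  then show ?thesis by simp
qed

text \<open>By \<open>De_e\<close> the field z - e is constant to first order along e, so
  differentiating C(s, z - e, v') = 0 along e gives Q(e, v, z - e, v') = 0. Reading the same value
  as a derivative along v produces the claim.\<close>

lemma G_De_E2:
  assumes z: "z \<in> S" and v: "v \<in> E2 z" and v': "v' \<in> E2 z"
  shows "G z v' (De z v) = G z v' v"
proof -
  obtain s where s: "section_of E2 s" "s z = v" by (rule obtain_section2[OF z v])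
  obtain s' where s': "section_of E2 s'" "s' z = v'" by (rule obtain_section2[OF z v'])
  have "C z (D s z (e z)) (z - e z) v' = 0"
    using C_orth[OF z v' e3[OF z]] C_sym[OF z] by metis
  then have "Q z (e z) v (z - e z) v' = 0"
    using C_sections[OF z s(1) eps_section, of "e z" v'] D_eps[OF z] De_e[OF z] s(2) linear_0[OF C_linear2[OF z]] by simp
  moreover have "Q z v v' (z - e z) (e z) = - 2 * G z (D s' z v) (z - e z)"
    using Q_e2[OF z s'(1) eps_section, of v] s'(2) by simp
  moreover have "Q z (e z) v (z - e z) v' = Q z v v' (z - e z) (e z)"
    using Q_sym[OF z] by metis
  moreover have "G z v' (v - De z v) = - G z (D s' z v) (z - e z)"
    using G_sections[OF z s'(1) eps_section, of v] s'(2) D_eps[OF z] by simp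
  ultimately show ?thesis using G_simps[OF z] by simp
qed

lemma De_fields:
  assumes z: "z \<in> S" and s: "(s has_derivative s') (at z)"
  shows "((\<lambda>z. De z (s z)) has_derivative (\<lambda>x. H z x (s z) + De z (s' x))) (at z)"
  by (rule has_derivative_linear_argument[OF S z De_linear De_deriv[OF z] H_linear[OF z] s])

text \<open>The defect \<open>n = De(s) - s\<close> is a section of \<open>E3\<close>; symmetry of \<open>D\<^sup>2e\<close> in the directions \<open>v, e\<close>
  forces its square to vanish. This replaces the curvature argument showing that the unit field \<open>T\<close> is parallel.\<close>

lemma De_E2:
  assumes z: "z \<in> S" and v: "v \<in> E2 z"
  shows "De z v = v"
proof -
  obtain s where s: "section_of E2 s" "s z = v" by (rule obtain_section2[OF z v])
  define n where "n = (\<lambda>y. De y (s y) - s y)"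
  have n': "(n has_derivative (\<lambda>x. H y x (s y) + De y (D s y x) - D s y x)) (at y)" if "y \<in> S" for y
    unfolding n_def using section_derivative[OF s(1) that] by (intro has_derivative_diff De_fields that)
  have n: "section_of E3 n"
    unfolding section_of_def
  proof (intro ballI conjI)
    fix y assume y: "y \<in> S"
    show "n y \<in> E3 y"
      by (rule zero_in_E2[OF y]) (simp add: n_def G_simps[OF y] G_De_E2[OF y section_in[OF s(1) y]])
    show "n differentiable (at y)" using n'[OF y] differentiable_def by blast
  qed
  have Dn: "D n z x = H z x v + De z (D s z x) - D s z x" for x
    using fun_cong[OF frechet_derivative_at[OF n'[OF z]], of x] s(2) by simp
  define m where "m = n z"
  have m: "De z v = v + m" "m \<in> E3 z" using section_in[OF n z] s(2) by (simp_all add: m_def n_def)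
  obtain p q where pq: "p \<in> E2 z" "q \<in> E3 z" "D s z (e z) = p + q" using decomp[OF z] by blast
  \<comment> \<open>Derivative of the identity De(e) = e in direction v. With De v = v + m it says
    H(v, e) = - De m.\<close>
  have "H z v (e z) + De z (De z v) = De z v"
    by (rule has_derivative_eq_on[OF De_fields[OF z e_deriv[OF z]] e_deriv[OF z] S z De_e])
  then have "H z (e z) v = - De z m"
    using m(1) linear_add[OF De_linear[OF z], of v m] H_sym[OF z, of v "e z"]
    by (simp add: eq_neg_iff_add_eq_0)
  then have "D n z (e z) = - De z m + (De z p + De z q) - (p + q)"
    using Dn[of "e z"] pq(3) linear_add[OF De_linear[OF z]] by simp
  moreover have "G z v (D n z (e z)) = - G z (p + q) m"
    using G_sections[OF z s(1) n, of "e z"] s(2) pq(3) m_def by simp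
  moreover have "G z p m = 0" by (rule G_orth[OF z pq(1) m(2)])
  moreover have "G z v (De z m) = - G z m m"
    using De_antisym[OF z v m(2)] m(1) G_orth[OF z v m(2)] G_simps[OF z] by simp
  moreover have "G z v (De z q) = - G z m q" "G z v q = 0"
    using De_antisym[OF z v pq(2)] m(1) G_orth[OF z v pq(2)] G_simps[OF z] by simp_all
  moreover have "G z v (De z p) = G z v p" by (rule G_De_E2[OF z pq(1) v])
  ultimately have "G z m m = 0" using G_simps[OF z] G_sym[OF z, of q m] by simp
  then have "m = 0" using G_pos[OF z] by force
  then show ?thesis using m by simp
qed

lemma De_E3:
  assumes z: "z \<in> S" and w: "w \<in> E3 z"
  shows "De z w = 0"
proof -
  interpret swap: hessian_splitting S G C Q "\<lambda>z. z - e z" "\<lambda>z x. x - De z x" "\<lambda>z x u. - H z x u" E3 E2 k3 k2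
    by (rule swap)
  show ?thesis using swap.De_E2[OF z w] by simp
qed

lemma De_in: "z \<in> S \<Longrightarrow> De z u \<in> E2 z" "z \<in> S \<Longrightarrow> u - De z u \<in> E3 z"
  using decomp[of z u] De_E2[of z] De_E3[of z] linear_add[OF De_linear] by auto

lemma E2_iff: "z \<in> S \<Longrightarrow> u \<in> E2 z \<longleftrightarrow> De z u = u"
  using De_in De_E2 by metis

lemma E3_iff: "z \<in> S \<Longrightarrow> u \<in> E3 z \<longleftrightarrow> De z u = 0"
  using De_in(2)[of z u] De_E3 by auto

text \<open>Derivative of De(s) = s. The right-hand side lies in E3, whereas the corresponding
  expression for a section of E3 lies in E2.\<close>

lemma H_section2:
  assumes "z \<in> S" "section_of E2 s" shows "H z x (s z) = D s z x - De z (D s z x)"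
proof -
  have "H z x (s z) + De z (D s z x) = D s z x"
    by (rule has_derivative_eq_on[OF De_fields[OF assms(1) section_derivative[OF assms(2,1)]] section_derivative[OF assms(2,1)] S assms(1)])
      (use section_in[OF assms(2)] De_E2 in blast)
  then show ?thesis by (simp add: algebra_simps)
qed

lemma H_section3:
  assumes "z \<in> S" "section_of E3 s" shows "H z x (s z) = - De z (D s z x)"
proof -
  have "H z x (s z) + De z (D s z x) = 0"
    by (rule has_derivative_constant_on[OF De_fields[OF assms(1) section_derivative[OF assms(2,1)]] S assms(1)])
      (use section_in[OF assms(2)] De_E3 in blast)
  then show ?thesis by (simp add: eq_neg_iff_add_eq_0)
qed

text \<open>By symmetry the value can be computed with either argument extended to a section, so it
  lies in both E2 and E3.\<close>

lemma H_mixed: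
  assumes z: "z \<in> S" and v: "v \<in> E2 z" and w: "w \<in> E3 z"
  shows "H z v w = 0"
proof -
  obtain s where s: "section_of E2 s" "s z = v" by (rule obtain_section2[OF z v])
  obtain t where t: "section_of E3 t" "t z = w" by (rule obtain_section3[OF z w])
  have "H z w v \<in> E3 z"
    using H_section2[OF z s(1), of w] s(2) De_in(2)[OF z] by simp
  moreover have "H z v w \<in> E2 z"
    using H_section3[OF z t(1), of v] t(2) De_in(1)[OF z] subspace_neg[OF sub2[OF z]] by simp
  ultimately show ?thesis
    using H_sym[OF z, of v w] E2_iff[OF z] E3_iff[OF z] by simp
qed

text \<open>By \<open>H_mixed\<close>, sections of E3 differentiated along v at z stay in E3;
  orthogonality of the summands then keeps derivatives of sections of E2 along v in E2, where I - De
  vanishes.\<close>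

lemma H_E2:
  assumes z: "z \<in> S" and v: "v \<in> E2 z" and v': "v' \<in> E2 z"
  shows "H z v v' = 0"
proof -
  interpret swap: hessian_splitting S G C Q "\<lambda>z. z - e z" "\<lambda>z x. x - De z x" "\<lambda>z x u. - H z x u" E3 E2 k3 k2
    by (rule swap)
  obtain s where s: "section_of E2 s" "s z = v'" by (rule obtain_section2[OF z v'])
  have "D s z v \<in> E2 z"
  proof (rule swap.zero_in_E2[OF z])
    fix w assume w: "w \<in> E3 z"
    obtain t where t: "section_of E3 t" "t z = w" by (rule obtain_section3[OF z w])
    have "De z (D t z v) = 0"
      using H_section3[OF z t(1), of v] t(2) H_mixed[OF z v w] by simp
    then have "G z v' (D t z v) = 0" using E3_iff[OF z] G_orth[OF z v'] by blast
    then show "G z w (D s z v) = 0"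
      using G_sections[OF z s(1) t(1), of v] s(2) t(2) G_sym[OF z] by simp
  qed
  then show ?thesis using H_section2[OF z s(1), of v] s(2) De_E2[OF z] by simp
qed

lemma H_zero:
  assumes z: "z \<in> S" shows "H z x u = 0"
proof -
  interpret swap: hessian_splitting S G C Q "\<lambda>z. z - e z" "\<lambda>z x. x - De z x" "\<lambda>z x u. - H z x u" E3 E2 k3 k2
    by (rule swap)
  obtain v w where vw: "v \<in> E2 z" "w \<in> E3 z" "x = v + w" using decomp[OF z] by blast
  obtain v' w' where vw': "v' \<in> E2 z" "w' \<in> E3 z" "u = v' + w'" using decomp[OF z] by blast
  have "H z (v + w) y = H z v y + H z w y" for y
    using H_sym[OF z] linear_add[OF H_linear[OF z], of y v w] by metis
  then show ?thesis
    using H_E2[OF z vw(1) vw'(1)] swap.H_E2[OF z vw(2) vw'(2)] H_mixed[OF z vw(1) vw'(2)] H_mixed[OF z vw'(1) vw(2)]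
      H_sym[OF z, of w v'] vw(3) vw'(3) linear_add[OF H_linear[OF z]] by simp
qed

text \<open>De is constant because its derivative H vanishes; E2 and E3 are its fixed space and
  kernel, and e z = De z follows from De(z - e) = 0 and De(e) = e.\<close>

theorem parallel_splitting:
  assumes "convex S" "y0 \<in> S" "z \<in> S"
  shows "De z = De y0" "e z = De y0 z" "E2 z = {v. De y0 v = v}" "E3 z = {v. De y0 v = 0}"
proof -
  have De: "De z = De y0" if "z \<in> S" for z
  proof
    fix u
    have "((\<lambda>z. De z u) has_derivative (\<lambda>x. 0)) (at y)" if "y \<in> S" for y
      using De_deriv[OF that, of u] H_zero[OF that] by simp
    then show "De z u = De y0 u"
      by (intro has_derivative_zero_unique[OF assms(1) _ \<open>z \<in> S\<close> assms(2)]) (auto intro: has_derivative_at_withinI)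
  qed
  then show "De z = De y0" using assms by blast
  have "De z (z - e z) = 0" by (rule De_E3[OF assms(3) e3[OF assms(3)]])
  then show "e z = De y0 z"
    using De_e[OF assms(3)] linear_diff[OF De_linear[OF assms(3)]] De[OF assms(3)] by simp
  show "E2 z = {v. De y0 v = v}" "E3 z = {v. De y0 v = 0}"
    using E2_iff[OF assms(3)] E3_iff[OF assms(3)] De[OF assms(3)] by auto
qed

end

section \<open>Immersions in charts\<close>

abbreviation d1 :: "('a::real_normed_vector \<Rightarrow> 'b::real_normed_vector) \<Rightarrow> 'a \<Rightarrow> 'a \<Rightarrow> 'b" where
  "d1 f z \<equiv> frechet_derivative f (at z)"

lemma d1_cong:
  assumes "open S" "z \<in> S" "f differentiable (at z)" "\<And>y. y \<in> S \<Longrightarrow> f y = g y"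
  shows "d1 f z = d1 g z"
  using frechet_derivative_transform_within_open[of f z S g] assms by blast

lemma d1_compose:
  assumes "smooth_on S f" "smooth_on T g" "z \<in> S" "f z \<in> T"
  shows "d1 (\<lambda>z. g (f z)) z u = d1 g (f z) (d1 f z u)"
  using frechet_derivative_at[OF has_derivative_compose[OF smooth_on_has_derivative[OF assms(1,3)] smooth_on_has_derivative[OF assms(2,4)]]]
  by metis

locale chart_of_manifold =
  fixes M :: "('m, 'e::euclidean_space) manifold" and V x
  assumes M: "smooth_manifold M" and chart: "(V, x) \<in> atlas M"
begin

abbreviation X :: "'e \<Rightarrow> 'm" where "X \<equiv> inv_into V x"

abbreviation \<Omega> :: "'e set" where "\<Omega> \<equiv> x ` V"

lemma openin_V: "openin (mfd_top M) V" and open_Omega: "open \<Omega>"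
  and homeo: "homeomorphic_map (subtopology (mfd_top M) V) (top_of_set \<Omega>) x"
  using M chart unfolding smooth_manifold_def by auto

lemma V_subset: "V \<subseteq> carrier_mfd M"
  by (rule openin_subset[OF openin_V])

lemma inj_x: "inj_on x V"
  using homeo V_subset unfolding homeomorphic_map_def by (simp add: inf_absorb2)

lemma X_x [simp]: "p \<in> V \<Longrightarrow> X (x p) = p"
  by (rule inv_into_f_f[OF inj_x])

lemma x_X [simp]: "u \<in> \<Omega> \<Longrightarrow> x (X u) = u"
  by (rule f_inv_into_f)

lemma X_in [simp]: "u \<in> \<Omega> \<Longrightarrow> X u \<in> V"
  by (rule inv_into_into)

lemma X_carrier: "u \<in> \<Omega> \<Longrightarrow> X u \<in> carrier_mfd M"
  using V_subset by auto

lemma openness: "A \<subseteq> V \<Longrightarrow> openin (mfd_top M) A \<longleftrightarrow> open (x ` A)"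
proof -
  assume A: "A \<subseteq> V"
  then have "openin (top_of_set \<Omega>) (x ` A) \<longleftrightarrow> openin (subtopology (mfd_top M) V) A"
    using homeomorphic_map_openness[OF homeo] V_subset by (simp add: inf_absorb2)
  moreover have "openin (top_of_set \<Omega>) (x ` A) \<longleftrightarrow> open (x ` A)"
    using A open_Omega by (metis image_mono openin_open_eq)
  moreover have "openin (subtopology (mfd_top M) V) A \<longleftrightarrow> openin (mfd_top M) A"
    using A openin_V openin_open_subtopology by blast
  ultimately show ?thesis by simp
qed

lemma open_image: "openin (mfd_top M) A \<Longrightarrow> open (x ` (V \<inter> A))"
  using openness[of "V \<inter> A"] openin_V by blast

lemma x_image_X: "B \<subseteq> \<Omega> \<Longrightarrow> x ` X ` B = B"
  by (force simp: image_image)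

lemma openin_X_image: "open B \<Longrightarrow> B \<subseteq> \<Omega> \<Longrightarrow> openin (mfd_top M) (X ` B)"
  using openness[of "X ` B"] x_image_X[of B] by fastforce

lemma transition:
  assumes "(W, y) \<in> atlas M" shows "smooth_on (x ` (V \<inter> W)) (y \<circ> X)"
  using M chart assms unfolding smooth_manifold_def by blast

lemma smooth_fun_onD: "smooth_fun_on M U g \<Longrightarrow> smooth_on (x ` (V \<inter> U)) (g \<circ> X)"
  using chart unfolding smooth_fun_on_def by blast

lemma smooth_fun_onI:
  assumes U: "openin (mfd_top M) U" "U \<subseteq> V" and g: "smooth_on (x ` U) (g \<circ> X)"
  shows "smooth_fun_on M U g"
  unfolding smooth_fun_on_def
proof clarify
  fix W y assume W: "(W, y) \<in> atlas M"
  interpret W: chart_of_manifold M W y using M W by unfold_locales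
  have op: "open (y ` (W \<inter> U))" using W.open_image U(1) by blast
  have "smooth_on (y ` (W \<inter> U)) (\<lambda>u. (g \<circ> X) ((x \<circ> W.X) u))"
  proof (rule smooth_on_compose[OF g _ op])
    show "smooth_on (y ` (W \<inter> U)) (x \<circ> W.X)"
      using W.transition[OF chart] by (rule smooth_on_subset) (use U in auto)
    show "open (x ` U)" using openness U by blast
    show "(x \<circ> W.X) u \<in> x ` U" if "u \<in> y ` (W \<inter> U)" for u using that by auto
  qed
  then show "smooth_on (y ` (W \<inter> U)) (g \<circ> W.X)"
    by (rule smooth_on_cong[OF _ op]) (use U in auto)
qed

lemma chart_deriv_change:
  assumes W: "(W, y) \<in> atlas M" and U: "openin (mfd_top M) U" and g: "smooth_fun_on M U g" and p: "p \<in> U" "p \<in> V" "p \<in> W"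
  shows "chart_deriv (V, x) g p u = chart_deriv (W, y) g p (d1 (y \<circ> X) (x p) u)"
proof -
  interpret W: chart_of_manifold M W y using M W by unfold_locales
  let ?A = "x ` (V \<inter> (U \<inter> W))"
  have op: "open ?A" using open_image U W.openin_V by blast
  have tr: "smooth_on ?A (y \<circ> X)"
    using transition[OF W] by (rule smooth_on_subset) auto
  have gW: "smooth_on (y ` (W \<inter> U)) (g \<circ> W.X)" by (rule W.smooth_fun_onD[OF g])
  have gV: "smooth_on (x ` (V \<inter> U)) (g \<circ> X)" by (rule smooth_fun_onD[OF g])
  have pA: "x p \<in> ?A" using p by blast
  have "d1 (g \<circ> X) (x p) = d1 (\<lambda>u. (g \<circ> W.X) ((y \<circ> X) u)) (x p)"
    by (rule d1_cong[OF op pA smooth_on_differentiable[OF gV]]) (use p in auto)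
  moreover have "d1 (\<lambda>u. (g \<circ> W.X) ((y \<circ> X) u)) (x p) u = d1 (g \<circ> W.X) ((y \<circ> X) (x p)) (d1 (y \<circ> X) (x p) u)"
    by (rule d1_compose[OF tr gW pA]) (use p in auto)
  ultimately show ?thesis using p by (simp add: chart_deriv_def)
qed

end

locale immersed_chart = chart_of_manifold M V x
  for M :: "('m, 'e::euclidean_space) manifold" and V x +
  fixes \<phi> :: "'m \<Rightarrow> 'v::euclidean_space"
  assumes imm: "immersion M \<phi>"
begin

abbreviation f :: "'e \<Rightarrow> 'v" where "f \<equiv> \<phi> \<circ> X"

lemma smooth_phi: "smooth_fun_on M (carrier_mfd M) \<phi>"
  using imm unfolding immersion_def by blast

lemma smooth_f: "smooth_on \<Omega> f"
  using smooth_fun_onD[OF smooth_phi] V_subset by (simp add: inf_absorb1)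

lemma inj_df: "u \<in> \<Omega> \<Longrightarrow> inj (d1 f u)"
  using imm chart unfolding immersion_def chart_deriv_def by fastforce

text \<open>Shows that the description in \<open>deriv_along\<close> is well defined: under a change
  of chart the coordinate vector is transformed by the derivative of the transition map, for \<phi>
  and g alike, and injectivity of the derivative of \<phi> determines it.\<close>

lemma deriv_along_chart:
  assumes U: "openin (mfd_top M) U" and g: "smooth_fun_on M U g" and p: "p \<in> U" "p \<in> V"
  shows "deriv_along M \<phi> (chart_deriv (V, x) \<phi> p u) g p = chart_deriv (V, x) g p u"
  unfolding deriv_along_def
proof (rule the_equality)
  show "\<exists>c\<in>atlas M. p \<in> fst c \<and> (\<exists>u'. chart_deriv c \<phi> p u' = chart_deriv (V, x) \<phi> p u \<and> chart_deriv c g p u' = chart_deriv (V, x) g p u)"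
    using chart p by force
  fix d assume "\<exists>c\<in>atlas M. p \<in> fst c \<and> (\<exists>u'. chart_deriv c \<phi> p u' = chart_deriv (V, x) \<phi> p u \<and> chart_deriv c g p u' = d)"
  then obtain W y u' where W: "(W, y) \<in> atlas M" "p \<in> W"
    and u': "chart_deriv (W, y) \<phi> p u' = chart_deriv (V, x) \<phi> p u" "chart_deriv (W, y) g p u' = d" by auto
  have "chart_deriv (V, x) \<phi> p u = chart_deriv (W, y) \<phi> p (d1 (y \<circ> X) (x p) u)"
    by (rule chart_deriv_change[OF W(1) openin_topspace smooth_phi _ p(2) W(2)]) (use p V_subset in auto)
  moreover have "inj (chart_deriv (W, y) \<phi> p)"
    using imm W unfolding immersion_def by fastforce
  ultimately have "u' = d1 (y \<circ> X) (x p) u" using u'(1) by (metis injD)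
  then show "d = chart_deriv (V, x) g p u"
    using chart_deriv_change[OF W(1) U g p W(2)] u'(2) by simp
qed

lemma deriv_along_f:
  assumes U: "openin (mfd_top M) U" and g: "smooth_fun_on M U g" and u: "u \<in> \<Omega>" "X u \<in> U"
  shows "deriv_along M \<phi> (d1 f u a) g (X u) = d1 (g \<circ> X) u a"
  using deriv_along_chart[OF U g u(2) X_in[OF u(1)], of a] u by (simp add: chart_deriv_def)

lemma tangent_space_chart:
  assumes u: "u \<in> \<Omega>" shows "tangent_space M \<phi> (X u) = range (d1 f u)"
proof
  show "range (d1 f u) \<subseteq> tangent_space M \<phi> (X u)"
    using chart u unfolding tangent_space_def by (force simp: chart_deriv_def)
  show "tangent_space M \<phi> (X u) \<subseteq> range (d1 f u)"
  proof
    fix w assume "w \<in> tangent_space M \<phi> (X u)"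
    then obtain W y a where W: "(W, y) \<in> atlas M" "X u \<in> W" "w = chart_deriv (W, y) \<phi> (X u) a"
      unfolding tangent_space_def by auto
    interpret W: chart_of_manifold M W y using M W by unfold_locales
    have "w = chart_deriv (V, x) \<phi> (X u) (d1 (x \<circ> W.X) (y (X u)) a)"
      unfolding W(3) by (rule W.chart_deriv_change[OF chart openin_topspace smooth_phi]) (use u W X_carrier in auto)
    then show "w \<in> range (d1 f u)" using u by (simp add: chart_deriv_def)
  qed
qed

text \<open>Fields with a constant coordinate vector. Their brackets vanish and they span each
  tangent space, so it is enough to evaluate connections on them.\<close>

abbreviation coord_field :: "'e \<Rightarrow> 'm \<Rightarrow> 'v" where
  "coord_field a \<equiv> \<lambda>p. d1 f (x p) a"

lemma coord_field_smooth: "smooth_on \<Omega> (coord_field a \<circ> X)"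
  by (rule smooth_on_cong[OF smooth_on_derivative[OF smooth_f] open_Omega]) simp

lemma coord_field:
  assumes U: "openin (mfd_top M) U" "U \<subseteq> V" shows "vector_field_on M \<phi> U (coord_field a)"
  unfolding vector_field_on_def
proof
  show "smooth_fun_on M U (coord_field a)"
    by (rule smooth_fun_onI[OF U smooth_on_subset[OF coord_field_smooth]]) (use U in auto)
  show "\<forall>p\<in>U. coord_field a p \<in> tangent_space M \<phi> p"
  proof
    fix p assume "p \<in> U"
    then have "p \<in> V" using U by auto
    then show "coord_field a p \<in> tangent_space M \<phi> p"
      using tangent_space_chart[of "x p"] by auto
  qed
qed

lemma d1_coord_field:
  assumes "u \<in> \<Omega>" shows "d1 (coord_field b \<circ> X) u a = d1 (\<lambda>v. d1 f v b) u a"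
  by (rule fun_cong[OF d1_cong[OF open_Omega assms smooth_on_differentiable[OF coord_field_smooth assms]]]) simp

lemma deriv_along_coord_field:
  assumes u: "u \<in> \<Omega>" shows "deriv_along M \<phi> (d1 f u a) (coord_field b) (X u) = d1 (\<lambda>v. d1 f v b) u a"
  using deriv_along_f[OF openin_V _ u X_in[OF u], of "coord_field b" a] coord_field[OF openin_V, of b] d1_coord_field[OF u]
  unfolding vector_field_on_def by simp

lemma gauss_formula:
  assumes "affine_fundamental_form M \<phi> \<xi> h" and u: "u \<in> \<Omega>"
  shows "d1 (\<lambda>v. d1 f v b) u a - h (X u) (d1 f u a) (d1 f u b) *\<^sub>R \<xi> (X u) \<in> range (d1 f u)"
proof -
  have "deriv_along M \<phi> (coord_field a (X u)) (coord_field b) (X u) -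
      h (X u) (coord_field a (X u)) (coord_field b (X u)) *\<^sub>R \<xi> (X u) \<in> tangent_space M \<phi> (X u)"
    using assms(1) openin_V coord_field[OF openin_V] X_in[OF u] unfolding affine_fundamental_form_def by blast
  then show ?thesis
    using u tangent_space_chart[OF u] deriv_along_coord_field[OF u] by simp
qed

text \<open>The Levi-Civita connection enters only through these identities for coordinate fields.\<close>

lemma difference_tensor_chart:
  assumes K: "difference_tensor M \<phi> \<xi> h K"
  obtains N where
    "\<And>u a b. u \<in> \<Omega> \<Longrightarrow> N u a b \<in> range (d1 f u)"
    "\<And>u a b. u \<in> \<Omega> \<Longrightarrow> N u a b = N u b a"
    "\<And>u a b. u \<in> \<Omega> \<Longrightarrow> K (X u) (d1 f u a) (d1 f u b) =
       d1 (\<lambda>v. d1 f v b) u a - h (X u) (d1 f u a) (d1 f u b) *\<^sub>R \<xi> (X u) - N u a b"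
    "\<And>\<Omega>' u a b c. open \<Omega>' \<Longrightarrow> \<Omega>' \<subseteq> \<Omega> \<Longrightarrow> u \<in> \<Omega>' \<Longrightarrow> smooth_on \<Omega>' (\<lambda>v. h (X v) (d1 f v b) (d1 f v c)) \<Longrightarrow>
       d1 (\<lambda>v. h (X v) (d1 f v b) (d1 f v c)) u a = h (X u) (N u a b) (d1 f u c) + h (X u) (d1 f u b) (N u a c)"
proof -
  obtain nab where lc: "levi_civita M \<phi> h nab"
    and Kn: "\<forall>U Y Z. openin (mfd_top M) U \<and> vector_field_on M \<phi> U Y \<and> vector_field_on M \<phi> U Z \<longrightarrow>
      (\<forall>p\<in>U. K p (Y p) (Z p) = induced_connection M \<phi> \<xi> h Y Z p - nab Y Z p)"
    using K unfolding difference_tensor_def by (elim exE conjE)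
  have Knab: "K p (Y p) (Z p) = induced_connection M \<phi> \<xi> h Y Z p - nab Y Z p"
    if "openin (mfd_top M) U" "vector_field_on M \<phi> U Y" "vector_field_on M \<phi> U Z" "p \<in> U" for U Y Z p
    using Kn that by simp
  have ac: "affine_connection M \<phi> nab" using lc unfolding levi_civita_def by (rule conjunct1)
  \<comment> \<open>Serves as the scalar function in the instantiation of
    \<open>affine_connection\<close>, from which tangency of the covariant derivative is
    extracted.\<close>
  have zero: "smooth_fun_on M V (\<lambda>_. 0 :: real)"
    unfolding smooth_fun_on_def comp_def by (auto intro: smooth_on_const)
  have lc': "nab Y Z p - nab Z Y p = lie_bracket M \<phi> Y Z p"
    "deriv_along M \<phi> (Y p) (\<lambda>q. h q (Z q) (Z' q)) p = h p (nab Y Z p) (Z' p) + h p (Z p) (nab Y Z' p)"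
    if "openin (mfd_top M) U" "vector_field_on M \<phi> U Y" "vector_field_on M \<phi> U Z" "vector_field_on M \<phi> U Z'" "p \<in> U" for U Y Z Z' p
    using lc[unfolded levi_civita_def, THEN conjunct2, THEN spec[of _ U], THEN spec[of _ Y], THEN spec[of _ Z], THEN spec[of _ Z']] that
    by simp_all
  define N where "N u a b = nab (coord_field a) (coord_field b) (X u)" for u a b
  note cf = coord_field[OF openin_V order_refl]
  show ?thesis
  proof (rule that)
    fix u a b assume u: "u \<in> \<Omega>"
    have "vector_field_on M \<phi> V (nab (coord_field a) (coord_field b))"
      using ac[unfolded affine_connection_def, THEN spec[of _ V], THEN spec[of _ "coord_field a"], THEN spec[of _ "coord_field b"],
          THEN spec[of _ "coord_field a"], THEN spec[of _ "\<lambda>_. 0"], THEN mp, THEN conjunct1] openin_V cf zero by blast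
    then show "N u a b \<in> range (d1 f u)"
      using tangent_space_chart[OF u] X_in[OF u] unfolding N_def vector_field_on_def by blast
    have "nab (coord_field a) (coord_field b) (X u) - nab (coord_field b) (coord_field a) (X u) =
        lie_bracket M \<phi> (coord_field a) (coord_field b) (X u)"
      by (rule lc'(1)[OF openin_V cf cf cf X_in[OF u]])
    also have "\<dots> = 0"
      using u deriv_along_coord_field[OF u] second_derivative_symmetric[OF smooth_f open_Omega u]
      by (simp add: lie_bracket_def)
    finally show "N u a b = N u b a" by (simp add: N_def)
    show "K (X u) (d1 f u a) (d1 f u b) =
       d1 (\<lambda>v. d1 f v b) u a - h (X u) (d1 f u a) (d1 f u b) *\<^sub>R \<xi> (X u) - N u a b"
      using Knab[OF openin_V cf[of a] cf[of b] X_in[OF u]] u deriv_along_coord_field[OF u]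
      by (simp add: N_def induced_connection_def)
  next
    \<comment> \<open>Smoothness of \<open>h\<close> along coordinate fields is a premise on a small
      open set; it becomes available once \<open>h\<close> is expressed by the Hessian of the
      potential.\<close>
    fix \<Omega>' u a b c
    assume op: "open \<Omega>'" and sub: "\<Omega>' \<subseteq> \<Omega>" and u: "u \<in> \<Omega>'"
      and h: "smooth_on \<Omega>' (\<lambda>v. h (X v) (d1 f v b) (d1 f v c))"
    let ?U = "X ` \<Omega>'"
    have U: "openin (mfd_top M) ?U" "?U \<subseteq> V" using openin_X_image[OF op sub] sub by auto
    have uO: "u \<in> \<Omega>" using u sub by auto
    note cf' = coord_field[OF U]
    let ?g = "\<lambda>q. h q (coord_field b q) (coord_field c q)"
    have sm: "smooth_on \<Omega>' (?g \<circ> X)"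
      by (rule smooth_on_cong[OF h op]) (use sub in \<open>simp add: subset_iff\<close>)
    have g: "smooth_fun_on M ?U ?g"
      by (rule smooth_fun_onI[OF U]) (simp only: x_image_X[OF sub] sm)
    have "deriv_along M \<phi> (coord_field a (X u)) ?g (X u) =
        h (X u) (nab (coord_field a) (coord_field b) (X u)) (coord_field c (X u)) +
        h (X u) (coord_field b (X u)) (nab (coord_field a) (coord_field c) (X u))"
      by (rule lc'(2)[OF U(1) cf' cf' cf' imageI[OF u]])
    moreover have "deriv_along M \<phi> (d1 f u a) ?g (X u) = d1 (?g \<circ> X) u a"
      by (rule deriv_along_f[OF U(1) g uO]) (use u in blast)
    moreover have "d1 (?g \<circ> X) u = d1 (\<lambda>v. h (X v) (d1 f v b) (d1 f v c)) u"
      by (rule d1_cong[OF op u smooth_on_differentiable[OF sm u]]) (use sub in \<open>simp add: subset_iff\<close>)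
    ultimately show "d1 (\<lambda>v. h (X v) (d1 f v b) (d1 f v c)) u a = h (X u) (N u a b) (d1 f u c) + h (X u) (d1 f u b) (N u a c)"
      using uO by (simp add: N_def)
  qed
qed

end

section \<open>Iterated directional derivatives\<close>

abbreviation d2 :: "('a::real_normed_vector \<Rightarrow> 'b::real_normed_vector) \<Rightarrow> 'a \<Rightarrow> 'a \<Rightarrow> 'a \<Rightarrow> 'b" where
  "d2 f z u v \<equiv> d1 (\<lambda>z. d1 f z u) z v"

text \<open>The last vector is always the direction of the outermost derivative. A symmetry lemma
  therefore either exchanges the two outermost directions or is a differentiated symmetry of lower
  order.\<close>

abbreviation d3 :: "('a::real_normed_vector \<Rightarrow> 'b::real_normed_vector) \<Rightarrow> 'a \<Rightarrow> 'a \<Rightarrow> 'a \<Rightarrow> 'a \<Rightarrow> 'b" where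
  "d3 f z u v w \<equiv> d1 (\<lambda>z. d2 f z u v) z w"

abbreviation d4 :: "('a::real_normed_vector \<Rightarrow> 'b::real_normed_vector) \<Rightarrow> 'a \<Rightarrow> 'a \<Rightarrow> 'a \<Rightarrow> 'a \<Rightarrow> 'a \<Rightarrow> 'b" where
  "d4 f z u v w x \<equiv> d1 (\<lambda>z. d3 f z u v w) z x"

locale smooth_function =
  fixes S :: "'a::euclidean_space set" and F :: "'a \<Rightarrow> 'b::euclidean_space"
  assumes open_S: "open S" and smooth_F: "smooth_on S F"
begin

lemmas smooth_d1 = smooth_on_derivative[OF smooth_F]
lemmas smooth_d2 = smooth_on_derivative[OF smooth_d1]
lemmas smooth_d3 = smooth_on_derivative[OF smooth_d2]

lemmas d1_deriv = smooth_on_has_derivative[OF smooth_F]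
lemmas d2_deriv = smooth_on_has_derivative[OF smooth_d1]
lemmas d3_deriv = smooth_on_has_derivative[OF smooth_d2]
lemmas d4_deriv = smooth_on_has_derivative[OF smooth_d3]

lemma d2_sym: "z \<in> S \<Longrightarrow> d2 F z u v = d2 F z v u"
  by (rule second_derivative_symmetric[OF smooth_F open_S])

lemma d3_sym23: "z \<in> S \<Longrightarrow> d3 F z u v w = d3 F z u w v"
  by (rule second_derivative_symmetric[OF smooth_d1 open_S])

lemma d3_sym12: "z \<in> S \<Longrightarrow> d3 F z u v w = d3 F z v u w"
  by (rule fun_cong[OF d1_cong[OF open_S _ smooth_on_differentiable[OF smooth_d2]]]) (auto intro: d2_sym)

lemma d4_sym34: "z \<in> S \<Longrightarrow> d4 F z u v w x = d4 F z u v x w"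
  by (rule second_derivative_symmetric[OF smooth_d2 open_S])

lemma d4_sym12: "z \<in> S \<Longrightarrow> d4 F z u v w x = d4 F z v u w x"
  by (rule fun_cong[OF d1_cong[OF open_S _ smooth_on_differentiable[OF smooth_d3]]]) (auto intro: d3_sym12)

lemma d4_sym23: "z \<in> S \<Longrightarrow> d4 F z u v w x = d4 F z u w v x"
  by (rule fun_cong[OF d1_cong[OF open_S _ smooth_on_differentiable[OF smooth_d3]]]) (auto intro: d3_sym23)

lemma d1_linear: "z \<in> S \<Longrightarrow> linear (d1 F z)"
  by (rule smooth_on_linear[OF smooth_F])

lemma d2_linear: "z \<in> S \<Longrightarrow> linear (d2 F z u)"
  by (rule smooth_on_linear[OF smooth_d1])

lemma d2_linear1: "z \<in> S \<Longrightarrow> linear (\<lambda>u. d2 F z u v)"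
  using d2_linear[of z v] d2_sym[of z v] by simp

lemma d3_linear: "z \<in> S \<Longrightarrow> linear (d3 F z u v)"
  by (rule smooth_on_linear[OF smooth_d2])

lemma d3_linear2: "z \<in> S \<Longrightarrow> linear (\<lambda>v. d3 F z u v w)"
  using d3_linear[of z u w] d3_sym23[of z u w] by simp

lemma d3_linear1: "z \<in> S \<Longrightarrow> linear (\<lambda>u. d3 F z u v w)"
  using d3_linear2[of z v w] d3_sym12[of z v] by simp

end

lemma smooth_on_linear_argument:
  fixes g :: "'a::real_normed_vector \<Rightarrow> 'v::euclidean_space \<Rightarrow> 'b::real_normed_vector"
  assumes "open S" "\<And>z. z \<in> S \<Longrightarrow> linear (g z)" "\<And>u. smooth_on S (\<lambda>z. g z u)" "smooth_on S v"
  shows "smooth_on S (\<lambda>z. g z (v z))"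
proof (rule smooth_on_cong[OF _ assms(1)])
  show "smooth_on S (\<lambda>z. \<Sum>b\<in>Basis. (v z \<bullet> b) *\<^sub>R g z b)"
    by (intro smooth_intros assms)
qed (rule linear_euclidean_expansion[OF assms(2), symmetric])

section \<open>The cone over a centroaffine hypersurface\<close>

text \<open>The index \<open>None\<close> holds the distinguished coordinate: the radius in cone
  coordinates (r, u), and later the homogenising 1 in front of an affine parameter p.\<close>

definition vcons :: "real \<Rightarrow> real^'n \<Rightarrow> real^('n::finite option)" where
  "vcons r u = (\<chi> a. case a of None \<Rightarrow> r | Some i \<Rightarrow> u $ i)"

definition vtl :: "real^('n::finite option) \<Rightarrow> real^'n" where
  "vtl z = (\<chi> i. z $ Some i)"

lemma vcons_simps [simp]: "vcons r u $ None = r" "vcons r u $ Some i = u $ i" "vtl (vcons r u) = u"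
  by (simp_all add: vcons_def vtl_def vec_eq_iff)

lemma vcons_vtl [simp]: "vcons (z $ None) (vtl z) = z"
  by (simp add: vcons_def vtl_def vec_eq_iff split: option.split)

lemma linear_vtl: "linear vtl"
  by (rule linearI) (simp_all add: vtl_def vec_eq_iff)

lemma smooth_vtl [smooth_intros]: "open S \<Longrightarrow> smooth_on S f \<Longrightarrow> smooth_on S (\<lambda>z. vtl (f z))"
  by (rule smooth_on_linear_compose[OF linear_vtl])

lemma smooth_vcons [smooth_intros]:
  fixes f :: "'a::real_normed_vector \<Rightarrow> real" and g :: "'a \<Rightarrow> real^'n"
  assumes "open S" "smooth_on S f" "smooth_on S g" shows "smooth_on S (\<lambda>z. vcons (f z) (g z))"
  unfolding vcons_def
proof (rule smooth_on_vec_lambda[OF assms(1)])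
  show "smooth_on S (\<lambda>z. case a of None \<Rightarrow> f z | Some i \<Rightarrow> g z $ i)" for a
    using assms by (cases a) (auto intro: smooth_intros)
qed

text \<open>An affine hypersphere with its center moved to the origin: the affine normal is - lam f,
  so the normal part of the Gauss formula is - lam h f.\<close>

locale centroaffine =
  fixes \<Omega> :: "(real^'n) set" and f :: "real^'n \<Rightarrow> real^('n::finite option)"
    and hh :: "real^'n \<Rightarrow> real^('n option) \<Rightarrow> real^('n option) \<Rightarrow> real" and lam :: real
  assumes open_Omega: "open \<Omega>" and smooth_f: "smooth_on \<Omega> f"
    and inj_df: "\<And>u. u \<in> \<Omega> \<Longrightarrow> inj (d1 f u)"
    and transversal: "\<And>u. u \<in> \<Omega> \<Longrightarrow> f u \<notin> range (d1 f u)"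
    and gauss: "\<And>u a b. u \<in> \<Omega> \<Longrightarrow> d2 f u b a + (lam * hh u (d1 f u a) (d1 f u b)) *\<^sub>R f u \<in> range (d1 f u)"
    and lam: "lam < 0"
    and hh_pos: "\<And>u X. u \<in> \<Omega> \<Longrightarrow> X \<in> range (d1 f u) \<Longrightarrow> X \<noteq> 0 \<Longrightarrow> hh u X X > 0"
begin

text \<open>The map (r, u) to r f(u) has an invertible derivative at (1, u0) by transversality, so
  it has smooth local inverse coordinates. The inverse function theorem gives no control over the
  shape of Y; the last two conclusions say that Y contains a piece of the homothetic leaf and of the
  ray through each of its points, which is what differentiating along them requires.\<close>

lemma cone_coordinates:
  assumes u0: "u0 \<in> \<Omega>"
  obtains Y r w \<Omega>1 where "open Y" "f u0 \<in> Y" "smooth_on Y r" "smooth_on Y w"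
    "\<And>y. y \<in> Y \<Longrightarrow> r y > 0 \<and> w y \<in> \<Omega> \<and> y = r y *\<^sub>R f (w y)"
    "open \<Omega>1" "u0 \<in> \<Omega>1" "\<Omega>1 \<subseteq> \<Omega>" "\<And>u. u \<in> \<Omega>1 \<Longrightarrow> f u \<in> Y \<and> r (f u) = 1 \<and> w (f u) = u"
    "\<And>y. y \<in> Y \<Longrightarrow> \<exists>A. open A \<and> w y \<in> A \<and> A \<subseteq> \<Omega> \<and>
      (\<forall>v\<in>A. r y *\<^sub>R f v \<in> Y \<and> r (r y *\<^sub>R f v) = r y \<and> w (r y *\<^sub>R f v) = v)"
    "\<And>y. y \<in> Y \<Longrightarrow> \<exists>A. open A \<and> 1 \<in> A \<and> (\<forall>t\<in>A. t *\<^sub>R y \<in> Y \<and> r (t *\<^sub>R y) = t * r y)"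
proof -
  \<comment> \<open>The pair (r, u) is packed into one vector, so that source and target of the
    inverse function theorem have the same type.\<close>
  define S where "S = {z :: real^('n option). z $ None > 0 \<and> vtl z \<in> \<Omega>}"
  define \<Psi> where "\<Psi> z = (z $ None) *\<^sub>R f (vtl z)" for z
  have cont_vtl: "continuous_on UNIV (vtl :: real^('n option) \<Rightarrow> real^'n)"
    by (rule linear_continuous_on[OF linear_vtl[unfolded linear_conv_bounded_linear]])
  have "open ({z :: real^('n option). 0 < z $ None} \<inter> vtl -` \<Omega>)"
    by (intro open_Int open_vimage[OF open_Omega cont_vtl] open_Collect_less continuous_intros)
  then have S: "open S" by (simp add: S_def vimage_def Collect_conj_eq)
  have fv: "smooth_on S (\<lambda>z. f (vtl z))"
    by (rule smooth_on_compose[OF smooth_f smooth_vtl[OF S smooth_on_id] S open_Omega]) (simp add: S_def)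
  have \<Psi>: "smooth_on S \<Psi>"
    unfolding \<Psi>_def by (intro smooth_intros S fv)
  have z0: "vcons 1 u0 \<in> S" using u0 by (simp add: S_def)
  have inj: "inj (d1 \<Psi> (vcons 1 u0))"
  proof -
    have "((\<lambda>z. f (vtl z)) has_derivative (\<lambda>\<zeta>. d1 f u0 (vtl \<zeta>))) (at (vcons 1 u0))"
      by (rule has_derivative_compose[where f = vtl])
        (use linear_vtl smooth_on_has_derivative[OF smooth_f u0] in \<open>auto simp: linear_conv_bounded_linear intro: bounded_linear_imp_has_derivative\<close>)
    then have "(\<Psi> has_derivative (\<lambda>\<zeta>. 1 *\<^sub>R d1 f u0 (vtl \<zeta>) + (\<zeta> $ None) *\<^sub>R f u0)) (at (vcons 1 u0))"
      unfolding \<Psi>_def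
      using has_derivative_scaleR[OF bounded_linear_imp_has_derivative[OF bounded_linear_vec_nth[of None]], of "\<lambda>z. f (vtl z)" _ "vcons 1 u0" UNIV] by simp
    then have d: "d1 \<Psi> (vcons 1 u0) = (\<lambda>\<zeta>. d1 f u0 (vtl \<zeta>) + (\<zeta> $ None) *\<^sub>R f u0)"
      using frechet_derivative_at by fastforce
    have lin: "linear (d1 f u0)" by (rule smooth_on_linear[OF smooth_f u0])
    have "\<zeta> = 0" if "d1 f u0 (vtl \<zeta>) + (\<zeta> $ None) *\<^sub>R f u0 = 0" for \<zeta>
    proof -
      have None: "\<zeta> $ None = 0"
      proof (rule ccontr)
        assume nz: "\<zeta> $ None \<noteq> 0"
        have "inverse (\<zeta> $ None) *\<^sub>R ((\<zeta> $ None) *\<^sub>R f u0) = inverse (\<zeta> $ None) *\<^sub>R (- d1 f u0 (vtl \<zeta>))"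
          using that by (metis add.commute add_eq_0_iff)
        then have "f u0 = d1 f u0 ((- inverse (\<zeta> $ None)) *\<^sub>R vtl \<zeta>)"
          using nz unfolding linear_cmul[OF lin] by simp
        then show False using transversal[OF u0] by blast
      qed
      then have "vtl \<zeta> = 0" using that inj_df[OF u0] linear_injective_0[OF lin] by auto
      then have "\<zeta> = vcons 0 0" using None vcons_vtl[of \<zeta>] by simp
      then show ?thesis by (simp add: vec_eq_iff vcons_def split: option.split)
    qed
    then show ?thesis
      unfolding d using linear_injective_0[OF smooth_on_linear[OF \<Psi> z0, unfolded d]] by blast
  qed
  obtain U Y g where UY: "open U" "U \<subseteq> S" "vcons 1 u0 \<in> U" "open Y" "\<Psi> (vcons 1 u0) \<in> Y"
    "homeomorphism U Y \<Psi> g" "smooth_on Y g"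
    by (rule smooth_inverse_function[OF S \<Psi> z0 inj])
  have g: "g y \<in> U" "\<Psi> (g y) = y" if "y \<in> Y" for y
    using UY(6) that unfolding homeomorphism_def by blast+
  have \<Psi>g: "\<Psi> z \<in> Y" "g (\<Psi> z) = z" if "z \<in> U" for z
    using UY(6) that unfolding homeomorphism_def by blast+
  define r where "r y = g y $ None" for y
  define w where "w y = vtl (g y)" for y
  have "continuous_on UNIV (vcons s :: real^'n \<Rightarrow> real^('n option))" for s
    by (rule smooth_on_continuous) (intro smooth_intros open_UNIV)
  then have open_cons: "open (vcons s -` U)" for s :: real
    using open_vimage[OF UY(1)] by blast
  have "continuous_on UNIV (\<lambda>t::real. vcons (t * s) u)" for s and u :: "real^'n"
    by (rule smooth_on_continuous) (intro smooth_intros open_UNIV)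
  then have open_cons2: "open ((\<lambda>t::real. vcons (t * s) u) -` U)" for s :: real and u
    using open_vimage[OF UY(1)] by blast
  have U_vcons: "vcons s v \<in> U \<Longrightarrow> s *\<^sub>R f v \<in> Y \<and> r (s *\<^sub>R f v) = s \<and> w (s *\<^sub>R f v) = v \<and> v \<in> \<Omega>" for s v
    using \<Psi>g[of "vcons s v"] UY(2) by (auto simp: \<Psi>_def r_def w_def S_def)
  have gy: "vcons (r y) (w y) \<in> U" "y = r y *\<^sub>R f (w y)" "r y > 0" "w y \<in> \<Omega>" if "y \<in> Y" for y
    using g[OF that] UY(2) by (auto simp: r_def w_def \<Psi>_def S_def)
  show ?thesis
  proof (rule that[of Y r w "vcons 1 -` U"])
    show "smooth_on Y r" "smooth_on Y w"
      unfolding r_def w_def by (intro smooth_intros UY)+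
    show "f u0 \<in> Y" using UY(5) by (simp add: \<Psi>_def)
    show "\<exists>A. open A \<and> w y \<in> A \<and> A \<subseteq> \<Omega> \<and>
      (\<forall>v\<in>A. r y *\<^sub>R f v \<in> Y \<and> r (r y *\<^sub>R f v) = r y \<and> w (r y *\<^sub>R f v) = v)" if "y \<in> Y" for y
      by (rule exI[of _ "vcons (r y) -` U"]) (use gy[OF that] U_vcons open_cons in auto)
    show "\<exists>A. open A \<and> 1 \<in> A \<and> (\<forall>t\<in>A. t *\<^sub>R y \<in> Y \<and> r (t *\<^sub>R y) = t * r y)" if "y \<in> Y" for y
    proof (intro exI[of _ "(\<lambda>t. vcons (t * r y) (w y)) -` U"] conjI ballI open_cons2)
      show "1 \<in> (\<lambda>t. vcons (t * r y) (w y)) -` U" using gy[OF that] by simp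
      fix t assume "t \<in> (\<lambda>t. vcons (t * r y) (w y)) -` U"
      moreover have "(t * r y) *\<^sub>R f (w y) = t *\<^sub>R y"
        using gy(2)[OF that] by (metis scaleR_scaleR)
      ultimately show "t *\<^sub>R y \<in> Y" "r (t *\<^sub>R y) = t * r y" using U_vcons[of "t * r y" "w y"] by auto
    qed
  qed (use UY gy U_vcons[of 1] open_cons in auto)
qed

end

section \<open>The logarithmic potential of the cone\<close>

locale cone_potential = centroaffine \<Omega> f hh lam
  for \<Omega> and f :: "real^'n \<Rightarrow> real^('n::finite option)" and hh lam +
  fixes Y :: "(real^('n option)) set" and r :: "real^('n option) \<Rightarrow> real" and w :: "real^('n option) \<Rightarrow> real^'n"
  assumes open_Y: "open Y" and smooth_r: "smooth_on Y r" and smooth_w: "smooth_on Y w"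
    and rw: "\<And>y. y \<in> Y \<Longrightarrow> r y > 0" "\<And>y. y \<in> Y \<Longrightarrow> w y \<in> \<Omega>" "\<And>y. y \<in> Y \<Longrightarrow> y = r y *\<^sub>R f (w y)"
    and leaf: "\<And>y. y \<in> Y \<Longrightarrow> \<exists>A. open A \<and> w y \<in> A \<and> A \<subseteq> \<Omega> \<and> (\<forall>v\<in>A. r y *\<^sub>R f v \<in> Y \<and> r (r y *\<^sub>R f v) = r y \<and> w (r y *\<^sub>R f v) = v)"
    and ray: "\<And>y. y \<in> Y \<Longrightarrow> \<exists>A. open A \<and> 1 \<in> A \<and> (\<forall>t\<in>A. t *\<^sub>R y \<in> Y \<and> r (t *\<^sub>R y) = t * r y)"
begin

text \<open>The logarithm makes the Hessian definite in the radial direction as well, where the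
  degree one function r is linear.\<close>

definition F :: "real^('n option) \<Rightarrow> real" where "F y = ln (r y)"

lemma smooth_FY: "smooth_on Y F"
  unfolding F_def by (intro smooth_intros open_Y smooth_r rw)

sublocale smooth_function Y F
  by unfold_locales (rule open_Y smooth_FY)+

text \<open>Euler's relation for F(t y) = ln t + F(y).\<close>

lemma d1_ray:
  assumes y: "y \<in> Y" shows "d1 F y y = 1"
proof -
  obtain A where A: "open A" "1 \<in> A" "\<And>t. t \<in> A \<Longrightarrow> t *\<^sub>R y \<in> Y \<and> r (t *\<^sub>R y) = t * r y"
    using ray[OF y] by blast
  have "((\<lambda>t. F (0 + t *\<^sub>R y)) has_vector_derivative d1 F (0 + 1 *\<^sub>R y) y) (at 1)"
    by (rule derivative_along_line[OF smooth_FY]) (use y in simp)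
  then have 1: "((\<lambda>t. F (t *\<^sub>R y)) has_real_derivative d1 F y y) (at 1)"
    by (simp add: has_real_derivative_iff_has_vector_derivative)
  have pos: "t > 0" if "t \<in> A" for t
    using A(3)[OF that] rw(1)[of "t *\<^sub>R y"] rw(1)[OF y] by (simp add: zero_less_mult_iff)
  have "((\<lambda>t. ln t + F y) has_real_derivative 1) (at 1)"
    by (auto intro!: derivative_eq_intros)
  moreover have "((\<lambda>t. ln t + F y) has_real_derivative d1 F y y) (at 1)"
  proof (rule has_field_derivative_transform_within_open[OF 1 A(1,2)])
    show "F (t *\<^sub>R y) = ln t + F y" if "t \<in> A" for t
      using A(3)[OF that] pos[OF that] rw(1)[OF y] by (simp add: F_def ln_mult)
  qed
  ultimately show ?thesis by (rule DERIV_unique[THEN sym])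
qed

lemma d1_f:
  assumes y: "y \<in> Y" shows "d1 F y (f (w y)) = 1 / r y"
proof -
  have "d1 F y (r y *\<^sub>R f (w y)) = 1" using d1_ray[OF y] rw(3)[OF y] by simp
  then show ?thesis using rw(1)[OF y] linear_cmul[OF d1_linear[OF y]] by (simp add: field_simps)
qed

lemma d1_tangent:
  assumes y: "y \<in> Y" shows "d1 F y (d1 f (w y) a) = 0"
proof -
  obtain A where A: "open A" "w y \<in> A" "A \<subseteq> \<Omega>" "\<And>v. v \<in> A \<Longrightarrow> r y *\<^sub>R f v \<in> Y \<and> r (r y *\<^sub>R f v) = r y"
    using leaf[OF y] by blast
  have "((\<lambda>v. r y *\<^sub>R f v) has_derivative (\<lambda>a. r y *\<^sub>R d1 f (w y) a)) (at (w y))"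
    by (intro has_derivative_scaleR_right smooth_on_has_derivative[OF smooth_f rw(2)[OF y]])
  moreover have "(F has_derivative d1 F y) (at (r y *\<^sub>R f (w y)))"
    using d1_deriv[OF y] rw(3)[OF y] by simp
  ultimately have "((\<lambda>v. F (r y *\<^sub>R f v)) has_derivative (\<lambda>a. d1 F y (r y *\<^sub>R d1 f (w y) a))) (at (w y))"
    using has_derivative_compose by blast
  then have "d1 F y (r y *\<^sub>R d1 f (w y) a) = 0"
    by (rule has_derivative_constant_on[OF _ A(1,2)]) (use A(4) in \<open>simp add: F_def\<close>)
  then show ?thesis using rw(1)[OF y] linear_cmul[OF d1_linear[OF y]] by simp
qed

lemma d2_ray:
  assumes y: "y \<in> Y" shows "d2 F y y v = - d1 F y v" "d2 F y v y = - d1 F y v"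
proof -
  have "((\<lambda>z. d1 F z z) has_derivative (\<lambda>x. d2 F y y x + d1 F y x)) (at y)"
    by (rule has_derivative_linear_argument[OF open_Y y d1_linear d2_deriv[OF y] d2_linear1[OF y] has_derivative_ident])
  then have "d2 F y y v + d1 F y v = 0"
    by (rule has_derivative_constant_on[OF _ open_Y y]) (rule d1_ray)
  then show "d2 F y y v = - d1 F y v" by simp
  then show "d2 F y v y = - d1 F y v" using d2_sym[OF y] by simp
qed

text \<open>Euler's relation differentiated twice: the Hessian is homogeneous of degree - 2.\<close>

lemma d3_ray:
  assumes y: "y \<in> Y" shows "d3 F y u v y = - 2 * d2 F y u v"
proof -
  have "((\<lambda>z. d2 F z u z) has_derivative (\<lambda>x. d3 F y u y x + d2 F y u x)) (at y)"
    by (rule has_derivative_linear_argument[OF open_Y y d2_linear d3_deriv[OF y] d3_linear2[OF y] has_derivative_ident])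
  moreover have "((\<lambda>z. - d1 F z u) has_derivative (\<lambda>x. - d2 F y u x)) (at y)"
    by (intro has_derivative_minus d2_deriv[OF y])
  ultimately have "d3 F y u y v + d2 F y u v = - d2 F y u v"
    by (rule has_derivative_eq_on[OF _ _ open_Y y]) (rule d2_ray)
  then show ?thesis using d3_sym23[OF y, of u y v] by simp
qed

lemma leaf_derivative:
  assumes y: "y \<in> Y" shows "((\<lambda>v. r y *\<^sub>R f v) has_derivative (\<lambda>a. r y *\<^sub>R d1 f (w y) a)) (at (w y))"
  by (intro has_derivative_scaleR_right smooth_on_has_derivative[OF smooth_f rw(2)[OF y]])

lemma d2_f_deriv:
  assumes u: "u \<in> \<Omega>" shows "((\<lambda>v. d1 f v b) has_derivative (\<lambda>a. d2 f u b a)) (at u)"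
  by (rule smooth_on_has_derivative[OF smooth_on_derivative[OF smooth_f] u])

text \<open>Differentiate dF(tangent) = 0 along the leaf r = const. Up to tangent vectors the second
  derivative of f is - lam h f by the Gauss formula, and dF(f) = 1 / r.\<close>

lemma d2_tangent:
  assumes y: "y \<in> Y"
  shows "d2 F y (d1 f (w y) a) (d1 f (w y) b) = lam / (r y)\<^sup>2 * hh (w y) (d1 f (w y) a) (d1 f (w y) b)"
proof -
  obtain A where A: "open A" "w y \<in> A" "A \<subseteq> \<Omega>" "\<And>v. v \<in> A \<Longrightarrow> r y *\<^sub>R f v \<in> Y \<and> w (r y *\<^sub>R f v) = v"
    using leaf[OF y] by blast
  have yA: "r y *\<^sub>R f (w y) \<in> Y" using A by blast
  have ry: "r y *\<^sub>R f (w y) = y" using rw(3)[OF y] by simp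
  have "((\<lambda>v. d1 F (r y *\<^sub>R f v) (d1 f v b)) has_derivative
      (\<lambda>a. d2 F (r y *\<^sub>R f (w y)) (d1 f (w y) b) (r y *\<^sub>R d1 f (w y) a) + d1 F (r y *\<^sub>R f (w y)) (d2 f (w y) b a))) (at (w y))"
  proof (rule has_derivative_linear_argument[OF A(1,2), where g = "\<lambda>v. d1 F (r y *\<^sub>R f v)" and g' = "\<lambda>a u. d2 F (r y *\<^sub>R f (w y)) u (r y *\<^sub>R d1 f (w y) a)"])
    show "((\<lambda>v. d1 F (r y *\<^sub>R f v) u) has_derivative (\<lambda>a. d2 F (r y *\<^sub>R f (w y)) u (r y *\<^sub>R d1 f (w y) a))) (at (w y))" for u
      by (rule has_derivative_compose[OF leaf_derivative[OF y] d2_deriv[OF yA]])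
  qed (use A d1_linear d2_linear1 yA d2_f_deriv in auto)
  then have "d2 F (r y *\<^sub>R f (w y)) (d1 f (w y) b) (r y *\<^sub>R d1 f (w y) a) + d1 F (r y *\<^sub>R f (w y)) (d2 f (w y) b a) = 0"
  proof (rule has_derivative_constant_on[OF _ A(1,2)])
    show "d1 F (r y *\<^sub>R f v) (d1 f v b) = 0" if "v \<in> A" for v
      using A(4)[OF that] d1_tangent[of "r y *\<^sub>R f v" b] by simp
  qed
  then have 1: "r y * d2 F y (d1 f (w y) b) (d1 f (w y) a) + d1 F y (d2 f (w y) b a) = 0"
    unfolding ry using linear_cmul[OF d2_linear[OF y]] by simp
  obtain c where "d2 f (w y) b a + (lam * hh (w y) (d1 f (w y) a) (d1 f (w y) b)) *\<^sub>R f (w y) = d1 f (w y) c"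
    using gauss[OF rw(2)[OF y], of b a] by blast
  then have "d1 F y (d2 f (w y) b a + (lam * hh (w y) (d1 f (w y) a) (d1 f (w y) b)) *\<^sub>R f (w y)) = 0"
    using d1_tangent[OF y] by simp
  then have "d1 F y (d2 f (w y) b a) + (lam * hh (w y) (d1 f (w y) a) (d1 f (w y) b)) / r y = 0"
    using linear_add[OF d1_linear[OF y]] linear_cmul[OF d1_linear[OF y]] d1_f[OF y] by simp
  then have "r y * d2 F y (d1 f (w y) b) (d1 f (w y) a) = (lam * hh (w y) (d1 f (w y) a) (d1 f (w y) b)) / r y"
    using 1 by linarith
  then show ?thesis using rw(1)[OF y] d2_sym[OF y, of "d1 f (w y) b"] by (simp add: field_simps power2_eq_square)
qed

text \<open>Obtained by differentiating y = r f(w).\<close>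

lemma decompose:
  assumes y: "y \<in> Y"
  obtains \<alpha> a where "v = \<alpha> *\<^sub>R f (w y) + d1 f (w y) a"
proof -
  have "((\<lambda>z. f (w z)) has_derivative (\<lambda>x. d1 f (w y) (d1 w y x))) (at y)"
    by (rule has_derivative_compose[OF smooth_on_has_derivative[OF smooth_w y] smooth_on_has_derivative[OF smooth_f rw(2)[OF y]]])
  then have "((\<lambda>z. r z *\<^sub>R f (w z)) has_derivative (\<lambda>x. r y *\<^sub>R d1 f (w y) (d1 w y x) + d1 r y x *\<^sub>R f (w y))) (at y)"
    by (rule has_derivative_scaleR[OF smooth_on_has_derivative[OF smooth_r y]])
  from has_derivative_eq_on[OF this has_derivative_ident open_Y y rw(3)[symmetric], of v]
  have "v = d1 r y v *\<^sub>R f (w y) + r y *\<^sub>R d1 f (w y) (d1 w y v)" by (simp add: add.commute)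
  also have "r y *\<^sub>R d1 f (w y) (d1 w y v) = d1 f (w y) (r y *\<^sub>R d1 w y v)"
    using linear_cmul[OF smooth_on_linear[OF smooth_f rw(2)[OF y]]] by simp
  finally show ?thesis by (rule that)
qed

lemma d2_f_tangent:
  assumes y: "y \<in> Y"
  shows "d2 F y (f (w y)) v = - d1 F y v / r y"
proof -
  have "d2 F y (r y *\<^sub>R f (w y)) v = - d1 F y v"
    using d2_ray(1)[OF y] rw(3)[OF y] by simp
  then show ?thesis using rw(1)[OF y] linear_cmul[OF d2_linear1[OF y]] by (simp add: field_simps)
qed

text \<open>The radial and tangential directions are orthogonal for the Hessian; it is - 1 /
  \<open>(r y)\<^sup>2\<close> on f, and on tangent vectors a negative multiple of h because lam <
  0.\<close>

lemma d2_negative: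
  assumes y: "y \<in> Y" and v: "v \<noteq> 0" shows "d2 F y v v < 0"
proof -
  obtain \<alpha> a where va: "v = \<alpha> *\<^sub>R f (w y) + d1 f (w y) a" by (rule decompose[OF y])
  let ?X = "d1 f (w y) a"
  have ff: "d2 F y (f (w y)) (f (w y)) = - 1 / (r y)\<^sup>2"
    using d2_f_tangent[OF y] d1_f[OF y] by (simp add: power2_eq_square)
  have fX: "d2 F y (f (w y)) ?X = 0" "d2 F y ?X (f (w y)) = 0"
    using d2_f_tangent[OF y] d1_tangent[OF y] d2_sym[OF y, of ?X] by simp_all
  have eq: "d2 F y v v = - \<alpha>\<^sup>2 / (r y)\<^sup>2 + lam / (r y)\<^sup>2 * hh (w y) ?X ?X"
    unfolding va using fX ff d2_tangent[OF y, of a a]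
    by (simp add: linear_add[OF d2_linear[OF y]] linear_add[OF d2_linear1[OF y]] linear_cmul[OF d2_linear[OF y]] linear_cmul[OF d2_linear1[OF y]] power2_eq_square)
  show ?thesis
  proof (cases "?X = 0")
    case True
    then have "\<alpha> \<noteq> 0" using v va by auto
    have "d2 F y v v = - \<alpha>\<^sup>2 / (r y)\<^sup>2 + d2 F y ?X ?X"
      using eq d2_tangent[OF y, of a a] by simp
    also have "d2 F y ?X ?X = 0" using True linear_0[OF d2_linear[OF y]] by simp
    finally show ?thesis using \<open>\<alpha> \<noteq> 0\<close> rw(1)[OF y] by simp
  next
    case False
    then have "hh (w y) ?X ?X > 0" using hh_pos[OF rw(2)[OF y]] by blast
    then have "lam / (r y)\<^sup>2 * hh (w y) ?X ?X < 0"
      using lam rw(1)[OF y] by (simp add: mult_neg_pos divide_neg_pos)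
    moreover have "- \<alpha>\<^sup>2 / (r y)\<^sup>2 \<le> 0" by simp
    ultimately show ?thesis unfolding eq by linarith
  qed
qed

end

lemma span_family:
  fixes E :: "nat \<Rightarrow> 'a::real_vector"
  assumes "v \<in> span {E i |i. i < m}" obtains c where "v = (\<Sum>i<m. c i *\<^sub>R E i)"
proof -
  let ?S = "range (\<lambda>c. \<Sum>i<m. c i *\<^sub>R E i)"
  have "subspace ?S"
    unfolding subspace_def
  proof (intro conjI ballI allI)
    show "0 \<in> ?S" by (rule range_eqI[of _ _ "\<lambda>_. 0"]) simp
  next
    fix x y assume "x \<in> ?S" "y \<in> ?S"
    then obtain c d where "x = (\<Sum>i<m. c i *\<^sub>R E i)" "y = (\<Sum>i<m. d i *\<^sub>R E i)" by blast
    then show "x + y \<in> ?S"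
      by (intro range_eqI[of _ _ "\<lambda>i. c i + d i"]) (simp add: scaleR_left_distrib sum.distrib)
  next
    fix k x assume "x \<in> ?S"
    then obtain c where "x = (\<Sum>i<m. c i *\<^sub>R E i)" by blast
    then show "k *\<^sub>R x \<in> ?S"
      by (intro range_eqI[of _ _ "\<lambda>i. k * c i"]) (simp add: scaleR_sum_right)
  qed
  moreover have "{E i |i. i < m} \<subseteq> ?S"
  proof clarify
    fix i assume "i < m"
    have "(\<Sum>j<m. (if j = i then 1 else 0) *\<^sub>R E j) = (\<Sum>j<m. if j = i then E j else 0)"
      by (rule sum.cong) auto
    then show "E i \<in> ?S" using \<open>i < m\<close> by (intro range_eqI[of _ _ "\<lambda>j. if j = i then 1 else 0"]) (simp add: sum.delta)
  qed
  ultimately have "span {E i |i. i < m} \<subseteq> ?S" by (rule span_minimal[rotated])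
  then show ?thesis using assms that by blast
qed

text \<open>Integration of the splitting takes place on a convex set, whereas the axioms are
  established on the domain Y of the cone coordinates.\<close>

lemma (in hessian_splitting) restrict:
  assumes "open S'" "S' \<subseteq> S"
  shows "hessian_splitting S' G C Q e De H E2 E3 k2 k3"
proof (rule hessian_splitting.intro)
  have S: "z \<in> S' \<Longrightarrow> z \<in> S" for z using assms(2) by blast
  show "\<exists>s. s z = v \<and> (\<forall>y\<in>S'. s y \<in> E2 y \<and> s differentiable (at y))" if "z \<in> S'" "v \<in> E2 z" for z v
    using section2[OF S[OF that(1)] that(2)] S by blast
  show "\<exists>s. s z = v \<and> (\<forall>y\<in>S'. s y \<in> E3 y \<and> s differentiable (at y))" if "z \<in> S'" "v \<in> E3 z" for z v
    using section3[OF S[OF that(1)] that(2)] S by blast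
qed (fact assms(1) G_deriv[OF subsetD[OF assms(2)]] C_deriv[OF subsetD[OF assms(2)]] G_linear[OF subsetD[OF assms(2)]] G_sym[OF subsetD[OF assms(2)]] G_pos[OF subsetD[OF assms(2)]] C_sym(1)[OF subsetD[OF assms(2)]] C_sym(2)[OF subsetD[OF assms(2)]] Q_sym(1)[OF subsetD[OF assms(2)]] Q_sym(2)[OF subsetD[OF assms(2)]] Q_sym(3)[OF subsetD[OF assms(2)]] e_deriv[OF subsetD[OF assms(2)]] De_deriv[OF subsetD[OF assms(2)]] H_sym[OF subsetD[OF assms(2)]] sub2[OF subsetD[OF assms(2)]] sub3[OF subsetD[OF assms(2)]] decomp[OF subsetD[OF assms(2)]] e2[OF subsetD[OF assms(2)]] e3[OF subsetD[OF assms(2)]] G_orth[OF subsetD[OF assms(2)]] C_orth[OF subsetD[OF assms(2)]] C_e2[OF subsetD[OF assms(2)]] C_e3[OF subsetD[OF assms(2)]] G_e2[OF subsetD[OF assms(2)]] G_e3[OF subsetD[OF assms(2)]])+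

section \<open>The difference tensor and the distributions on the cone\<close>

locale calabi_chart = cone_potential \<Omega> f hh lam Y r w
  for \<Omega> and f :: "real^'n \<Rightarrow> real^('n::finite option)" and hh lam Y r w +
  fixes K :: "real^'n \<Rightarrow> real^('n option) \<Rightarrow> real^('n option) \<Rightarrow> real^('n option)"
    and N :: "real^'n \<Rightarrow> real^'n \<Rightarrow> real^'n \<Rightarrow> real^('n option)"
    and T :: "real^'n \<Rightarrow> real^('n option)" and D2 D3 :: "real^'n \<Rightarrow> (real^('n option)) set"
    and E2 E3 :: "nat \<Rightarrow> real^'n \<Rightarrow> real^('n option)" and m2 m3 :: nat and lam2 lam3 :: real
  assumes N_range: "\<And>u a b. u \<in> \<Omega> \<Longrightarrow> N u a b \<in> range (d1 f u)"
    and N_sym: "\<And>u a b. u \<in> \<Omega> \<Longrightarrow> N u a b = N u b a"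
    and K_eq: "\<And>u a b. u \<in> \<Omega> \<Longrightarrow> K u (d1 f u a) (d1 f u b) =
      d2 f u b a + (lam * hh u (d1 f u a) (d1 f u b)) *\<^sub>R f u - N u a b"
    and N_metric: "\<And>A u a b c. open A \<Longrightarrow> A \<subseteq> \<Omega> \<Longrightarrow> u \<in> A \<Longrightarrow> smooth_on A (\<lambda>v. hh v (d1 f v b) (d1 f v c)) \<Longrightarrow>
       d1 (\<lambda>v. hh v (d1 f v b) (d1 f v c)) u a = hh u (N u a b) (d1 f u c) + hh u (d1 f u b) (N u a c)"
    and T: "smooth_on \<Omega> T" "\<And>u. u \<in> \<Omega> \<Longrightarrow> T u \<in> range (d1 f u)" "\<And>u. u \<in> \<Omega> \<Longrightarrow> hh u (T u) (T u) = 1"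
    and D2: "\<And>i. i < m2 \<Longrightarrow> smooth_on \<Omega> (E2 i)" "\<And>u. u \<in> \<Omega> \<Longrightarrow> D2 u = span {E2 i u |i. i < m2}" "\<And>u. u \<in> \<Omega> \<Longrightarrow> D2 u \<subseteq> range (d1 f u)"
    and D3: "\<And>i. i < m3 \<Longrightarrow> smooth_on \<Omega> (E3 i)" "\<And>u. u \<in> \<Omega> \<Longrightarrow> D3 u = span {E3 i u |i. i < m3}" "\<And>u. u \<in> \<Omega> \<Longrightarrow> D3 u \<subseteq> range (d1 f u)"
    and tangent_decomp: "\<And>y X. y \<in> Y \<Longrightarrow> X \<in> range (d1 f (w y)) \<Longrightarrow> \<exists>\<alpha>. \<exists>v\<in>D2 (w y). \<exists>v'\<in>D3 (w y). X = \<alpha> *\<^sub>R T (w y) + v + v'"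
    and orth: "\<And>u v. u \<in> \<Omega> \<Longrightarrow> v \<in> D2 u \<Longrightarrow> hh u (T u) v = 0" "\<And>u w. u \<in> \<Omega> \<Longrightarrow> w \<in> D3 u \<Longrightarrow> hh u (T u) w = 0"
      "\<And>u v w. u \<in> \<Omega> \<Longrightarrow> v \<in> D2 u \<Longrightarrow> w \<in> D3 u \<Longrightarrow> hh u v w = 0"
    and K_T: "\<And>u. u \<in> \<Omega> \<Longrightarrow> K u (T u) (T u) = (lam2 + lam3) *\<^sub>R T u" "\<And>u v. u \<in> \<Omega> \<Longrightarrow> v \<in> D2 u \<Longrightarrow> K u (T u) v = lam2 *\<^sub>R v"
      "\<And>u w. u \<in> \<Omega> \<Longrightarrow> w \<in> D3 u \<Longrightarrow> K u (T u) w = lam3 *\<^sub>R w" "\<And>u v w. u \<in> \<Omega> \<Longrightarrow> v \<in> D2 u \<Longrightarrow> w \<in> D3 u \<Longrightarrow> K u v w = 0"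
    and lam23: "lam = lam2 * lam3"
begin

text \<open>All three ingredients are symmetric: the second derivative of f, the torsion-free N, and
  h, whose symmetry is inherited from the Hessian of F.\<close>

lemma K_commute:
  assumes y: "y \<in> Y" shows "K (w y) (d1 f (w y) a) (d1 f (w y) b) = K (w y) (d1 f (w y) b) (d1 f (w y) a)"
proof -
  have "hh (w y) (d1 f (w y) a) (d1 f (w y) b) = hh (w y) (d1 f (w y) b) (d1 f (w y) a)"
    using d2_tangent[OF y, of a b] d2_tangent[OF y, of b a] d2_sym[OF y] lam rw(1)[OF y] by simp
  then show ?thesis
    using K_eq[OF rw(2)[OF y]] N_sym[OF rw(2)[OF y], of a b] second_derivative_symmetric[OF smooth_f open_Omega rw(2)[OF y], of a b] by simp
qed

text \<open>The formula expressing the induced covariant derivative of h by K, with h replaced by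
  the Hessian of F. Differentiating along the leaf produces second derivatives of f; metric
  compatibility cancels their Levi-Civita parts and leaves the K terms.\<close>

lemma d3_K_sum:
  fixes a b c :: "real^'n"
  assumes y: "y \<in> Y"
  defines "X \<equiv> d1 f (w y)"
  shows "r y * d3 F y (X b) (X c) (X a) + d2 F y (K (w y) (X a) (X b)) (X c) + d2 F y (K (w y) (X a) (X c)) (X b) = 0"
proof -
  let ?u = "w y"
  obtain A where A: "open A" "w y \<in> A" "A \<subseteq> \<Omega>"
    "\<And>v. v \<in> A \<Longrightarrow> r y *\<^sub>R f v \<in> Y \<and> r (r y *\<^sub>R f v) = r y \<and> w (r y *\<^sub>R f v) = v"
    using leaf[OF y] by blast
  have ry: "r y *\<^sub>R f ?u = y" using rw(3)[OF y] by simp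
  have AY: "r y *\<^sub>R f v \<in> Y" if "v \<in> A" for v using A(4)[OF that] by simp
  have smf: "smooth_on A (\<lambda>v. d1 f v b)" for b
    by (rule smooth_on_subset[OF smooth_on_derivative[OF smooth_f] A(3)])
  have sm\<psi>: "smooth_on A (\<lambda>v. r y *\<^sub>R f v)"
    by (intro smooth_intros A smooth_on_subset[OF smooth_f A(3)])
  define q where "q v = d2 F (r y *\<^sub>R f v) (d1 f v b) (d1 f v c)" for v
  have dq: "(q has_derivative (\<lambda>a. d3 F y (X b) (X c) (r y *\<^sub>R X a) + d2 F y (d2 f ?u b a) (X c) + d2 F y (X b) (d2 f ?u c a))) (at ?u)"
  proof -
    have 1: "((\<lambda>v. d2 F (r y *\<^sub>R f v) (d1 f v b) z) has_derivative
        (\<lambda>a. d3 F y (X b) z (r y *\<^sub>R X a) + d2 F y (d2 f ?u b a) z)) (at ?u)" for z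
    proof -
      have "((\<lambda>v. d2 F (r y *\<^sub>R f v) (d1 f v b) z) has_derivative
        (\<lambda>a. d3 F (r y *\<^sub>R f ?u) (d1 f ?u b) z (r y *\<^sub>R d1 f ?u a) + d2 F (r y *\<^sub>R f ?u) (d2 f ?u b a) z)) (at ?u)"
      proof (rule has_derivative_linear_argument[OF A(1,2), where g = "\<lambda>v x. d2 F (r y *\<^sub>R f v) x z"
            and g' = "\<lambda>a x. d3 F (r y *\<^sub>R f ?u) x z (r y *\<^sub>R d1 f ?u a)"])
        show "((\<lambda>v. d2 F (r y *\<^sub>R f v) x z) has_derivative (\<lambda>a. d3 F (r y *\<^sub>R f ?u) x z (r y *\<^sub>R d1 f ?u a))) (at ?u)" for x
          by (rule has_derivative_compose[OF leaf_derivative[OF y] d3_deriv[OF AY[OF A(2)]]])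
        show "linear (\<lambda>x. d2 F (r y *\<^sub>R f v) x z)" if "v \<in> A" for v by (rule d2_linear1[OF AY[OF that]])
        show "linear (\<lambda>x. d3 F (r y *\<^sub>R f ?u) x z (r y *\<^sub>R d1 f ?u a))" for a by (rule d3_linear1[OF AY[OF A(2)]])
        show "((\<lambda>v. d1 f v b) has_derivative d2 f ?u b) (at ?u)" by (rule d2_f_deriv[OF rw(2)[OF y]])
      qed
      then show ?thesis unfolding ry X_def .
    qed
    show ?thesis unfolding q_def
    proof (rule has_derivative_linear_argument[OF A(1,2), where g = "\<lambda>v. d2 F (r y *\<^sub>R f v) (d1 f v b)" and v = "\<lambda>v. d1 f v c"
          and g' = "\<lambda>a z. d3 F y (X b) z (r y *\<^sub>R X a) + d2 F y (d2 f ?u b a) z" and v' = "d2 f ?u c", unfolded ry, folded X_def])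
      show "linear (\<lambda>z. d3 F y (X b) z (r y *\<^sub>R X a) + d2 F y (d2 f ?u b a) z)" for a
        by (intro linear_compose_add d3_linear2 d2_linear y)
      show "((\<lambda>v. d1 f v c) has_derivative d2 f ?u c) (at ?u)" by (rule d2_f_deriv[OF rw(2)[OF y]])
    qed (use 1 d2_linear AY in auto)
  qed
  have smq: "smooth_on A q"
    unfolding q_def
  proof (rule smooth_on_linear_argument[OF A(1) _ _ smf])
    show "linear (d2 F (r y *\<^sub>R f v) (d1 f v b))" if "v \<in> A" for v by (rule d2_linear[OF AY[OF that]])
    show "smooth_on A (\<lambda>v. d2 F (r y *\<^sub>R f v) (d1 f v b) z)" for z
    proof (rule smooth_on_linear_argument[OF A(1) _ _ smf])
      show "linear (\<lambda>x. d2 F (r y *\<^sub>R f v) x z)" if "v \<in> A" for v by (rule d2_linear1[OF AY[OF that]])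
      show "smooth_on A (\<lambda>v. d2 F (r y *\<^sub>R f v) x z)" for x
        by (rule smooth_on_compose[OF smooth_d2 sm\<psi> A(1) open_Y AY])
    qed
  qed
  let ?k = "(r y)\<^sup>2 / lam"
  \<comment> \<open>Expresses h by the Hessian of F, which supplies the smoothness premise of
    \<open>N_metric\<close>.\<close>
  have hq: "?k * q v = hh v (d1 f v b) (d1 f v c)" if "v \<in> A" for v
    using d2_tangent[OF AY[OF that], of b c] A(4)[OF that] lam rw(1)[OF y] unfolding q_def by (simp add: field_simps)
  have smh: "smooth_on A (\<lambda>v. hh v (d1 f v b) (d1 f v c))"
    by (rule smooth_on_cong[OF _ A(1) hq]) (intro smooth_intros A smq)
  have "hh ?u (N ?u a b) (X c) + hh ?u (X b) (N ?u a c) =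
      ?k * (d3 F y (X b) (X c) (r y *\<^sub>R X a) + d2 F y (d2 f ?u b a) (X c) + d2 F y (X b) (d2 f ?u c a))"
    unfolding N_metric[OF A(1,3,2) smh, symmetric] X_def
  proof (rule has_derivative_eq_on[OF smooth_on_has_derivative[OF smh A(2)] _ A(1,2) hq[symmetric]])
    show "((\<lambda>v. ?k * q v) has_derivative (\<lambda>a. ?k * (d3 F y (d1 f ?u b) (d1 f ?u c) (r y *\<^sub>R d1 f ?u a) + d2 F y (d2 f ?u b a) (d1 f ?u c) + d2 F y (d1 f ?u b) (d2 f ?u c a)))) (at ?u)"
      using has_derivative_mult_right[OF dq, of ?k] unfolding X_def .
  qed
  moreover obtain n1 n2 where n: "N ?u a b = X n1" "N ?u a c = X n2"
    using N_range[OF rw(2)[OF y]] unfolding X_def by blast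
  moreover have "hh ?u (X n1) (X c) = ?k * d2 F y (X n1) (X c)" "hh ?u (X b) (X n2) = ?k * d2 F y (X b) (X n2)"
    using d2_tangent[OF y, of n1 c] d2_tangent[OF y, of b n2] lam rw(1)[OF y] unfolding X_def by (simp_all add: field_simps)
  ultimately have "?k * (d2 F y (X n1) (X c) + d2 F y (X b) (X n2)) =
      ?k * (d3 F y (X b) (X c) (r y *\<^sub>R X a) + d2 F y (d2 f ?u b a) (X c) + d2 F y (X b) (d2 f ?u c a))"
    by (simp add: distrib_left)
  then have eq: "d2 F y (X n1) (X c) + d2 F y (X b) (X n2) =
      d3 F y (X b) (X c) (r y *\<^sub>R X a) + d2 F y (d2 f ?u b a) (X c) + d2 F y (X b) (d2 f ?u c a)"
    using lam rw(1)[OF y] by simp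
  \<comment> \<open>\<open>K_eq\<close> solved for the second derivative; its component along f then
    drops out, f being orthogonal to tangent vectors.\<close>
  have D2f: "d2 f ?u b' a = K ?u (X a) (X b') + N ?u a b' - (lam * hh ?u (X a) (X b')) *\<^sub>R f ?u" for b'
    using K_eq[OF rw(2)[OF y], of a b'] unfolding X_def by simp
  have fX: "d2 F y (f ?u) (X b) = 0" for b
    using d2_f_tangent[OF y] d1_tangent[OF y] by (simp add: X_def)
  have "d2 F y (d2 f ?u b a) (X c) = d2 F y (K ?u (X a) (X b)) (X c) + d2 F y (X n1) (X c)"
    unfolding D2f n by (simp add: linear_add[OF d2_linear1[OF y]] linear_diff[OF d2_linear1[OF y]] linear_cmul[OF d2_linear1[OF y]] fX)
  moreover have "d2 F y (d2 f ?u c a) (X b) = d2 F y (K ?u (X a) (X c)) (X b) + d2 F y (X n2) (X b)"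
    unfolding D2f n by (simp add: linear_add[OF d2_linear1[OF y]] linear_diff[OF d2_linear1[OF y]] linear_cmul[OF d2_linear1[OF y]] fX)
  ultimately show ?thesis
    using eq d2_sym[OF y, of "X b"] linear_cmul[OF d3_linear[OF y]] by simp
qed

text \<open>Total symmetry of the third derivative, applied to two permutations of
  \<open>d3_K_sum\<close>, shows that the trilinear form k is totally symmetric. Its two K terms
  then coincide, whence the factor 2.\<close>

lemma d3_K:
  assumes y: "y \<in> Y" and X: "X \<in> range (d1 f (w y))" "X' \<in> range (d1 f (w y))" "X'' \<in> range (d1 f (w y))"
  shows "d3 F y X X' X'' = - (2 / r y) * d2 F y (K (w y) X X') X''"
proof -
  obtain a b c where abc: "X = d1 f (w y) a" "X' = d1 f (w y) b" "X'' = d1 f (w y) c" using X by blast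
  define k where "k a b c = d2 F y (K (w y) (d1 f (w y) a) (d1 f (w y) b)) (d1 f (w y) c)" for a b c
  have k_sym: "k a b c = k b a c" for a b c unfolding k_def using K_commute[OF y] by simp
  have sum: "r y * d3 F y (d1 f (w y) b) (d1 f (w y) c) (d1 f (w y) a) + k a b c + k a c b = 0" for a b c
    unfolding k_def by (rule d3_K_sum[OF y])
  have "k a c b = k b c a" for a b c
  proof -
    have "d3 F y (d1 f (w y) b) (d1 f (w y) c) (d1 f (w y) a) = d3 F y (d1 f (w y) a) (d1 f (w y) c) (d1 f (w y) b)"
      using d3_sym12[OF y] d3_sym23[OF y] by metis
    then show ?thesis using sum[of b c a] sum[of a c b] k_sym[of a b c] by simp
  qed
  then have "k c b a = k a b c" "k c a b = k a b c" using k_sym by metis+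
  then have "r y * d3 F y X X' X'' = - 2 * k a b c"
    using sum[of a b c] unfolding abc by simp
  then show ?thesis using rw(1)[OF y] unfolding k_def abc by (simp add: field_simps)
qed

definition kap :: real where "kap = lam2 - lam3"

text \<open>If lam2 = lam3, then lam would be a square, contrary to lam < 0.\<close>

lemma kap_nz: "kap \<noteq> 0"
  using lam23 lam not_square_less_zero[of lam2] by (auto simp: kap_def)

text \<open>In units of - 2 / r, contracting the third derivative with T multiplies the Hessian by
  lam2 on D2 and by lam3 on D3, while contracting with f multiplies it by 1. This combination
  therefore acts as - 2 on D2 and as 0 on D3.\<close>

definition e :: "real^('n option) \<Rightarrow> real^('n option)" where
  "e y = (r y / kap) *\<^sub>R (T (w y) - lam3 *\<^sub>R f (w y))"

text \<open>The position vector is shared out between the two summands, so each is one dimension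
  larger than the distribution it contains.\<close>

definition B2 :: "real^('n option) \<Rightarrow> (real^('n option)) set" where
  "B2 y = {\<alpha> *\<^sub>R e y + v |\<alpha> v. v \<in> D2 (w y)}"

definition B3 :: "real^('n option) \<Rightarrow> (real^('n option)) set" where
  "B3 y = {\<alpha> *\<^sub>R (y - e y) + v |\<alpha> v. v \<in> D3 (w y)}"

lemma smooth_e: "smooth_on Y e"
proof -
  have "smooth_on Y (\<lambda>y. T (w y))"
    by (rule smooth_on_compose[OF T(1) smooth_w open_Y open_Omega rw(2)])
  moreover have "smooth_on Y (\<lambda>y. f (w y))"
    by (rule smooth_on_compose[OF smooth_f smooth_w open_Y open_Omega rw(2)])
  moreover have "smooth_on Y (\<lambda>y. r y / kap)"
    by (intro smooth_intros open_Y smooth_r) (rule kap_nz)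
  ultimately show ?thesis unfolding e_def[abs_def]
    by (intro smooth_on_scaleR smooth_on_diff smooth_on_const open_Y)
qed

sublocale e: smooth_function Y e
  by unfold_locales (rule open_Y smooth_e)+

section \<open>Second and third derivatives of the potential at a point\<close>

context
  fixes y assumes y: "y \<in> Y"
begin

lemmas lin = linear_add[OF d2_linear[OF y]] linear_add[OF d2_linear1[OF y]] linear_diff[OF d2_linear[OF y]] linear_diff[OF d2_linear1[OF y]]
  linear_cmul[OF d2_linear[OF y]] linear_cmul[OF d2_linear1[OF y]] linear_neg[OF d2_linear[OF y]] linear_neg[OF d2_linear1[OF y]]

lemmas lin3 = linear_add[OF d3_linear[OF y]] linear_add[OF d3_linear1[OF y]] linear_add[OF d3_linear2[OF y]]
  linear_diff[OF d3_linear[OF y]] linear_diff[OF d3_linear1[OF y]] linear_diff[OF d3_linear2[OF y]]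
  linear_cmul[OF d3_linear[OF y]] linear_cmul[OF d3_linear1[OF y]] linear_cmul[OF d3_linear2[OF y]]

lemma y_pos: "r y > 0" by (rule rw(1)[OF y])

lemma y_eq: "y = r y *\<^sub>R f (w y)" by (rule rw(3)[OF y])

lemma eps_eq: "y - e y = (r y / kap) *\<^sub>R (lam2 *\<^sub>R f (w y) - T (w y))"
proof -
  have "r y = (r y / kap) * (lam2 - lam3)" using kap_nz by (simp add: kap_def)
  then have "y = ((r y / kap) * (lam2 - lam3)) *\<^sub>R f (w y)" using y_eq by metis
  then have "y - e y = ((r y / kap) * (lam2 - lam3)) *\<^sub>R f (w y) - e y" by (rule arg_cong)
  also have "\<dots> = (r y / kap) *\<^sub>R ((lam2 - lam3) *\<^sub>R f (w y) - (T (w y) - lam3 *\<^sub>R f (w y)))"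
    unfolding e_def by (simp only: scaleR_diff_right scaleR_scaleR)
  also have "\<dots> = (r y / kap) *\<^sub>R (lam2 *\<^sub>R f (w y) - T (w y))"
    by (simp add: scaleR_diff_left)
  finally show ?thesis .
qed

lemma d2_ff: "d2 F y (f (w y)) (f (w y)) = - 1 / (r y)\<^sup>2"
  using d2_f_tangent[OF y] d1_f[OF y] by (simp add: power2_eq_square)

lemma d2_fX: "X \<in> range (d1 f (w y)) \<Longrightarrow> d2 F y (f (w y)) X = 0" "X \<in> range (d1 f (w y)) \<Longrightarrow> d2 F y X (f (w y)) = 0"
  using d2_f_tangent[OF y] d1_tangent[OF y] d2_sym[OF y, of X] by auto

lemma d2_XX: "X \<in> range (d1 f (w y)) \<Longrightarrow> X' \<in> range (d1 f (w y)) \<Longrightarrow> d2 F y X X' = lam / (r y)\<^sup>2 * hh (w y) X X'"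
  using d2_tangent[OF y] by auto

lemma tangent: "T (w y) \<in> range (d1 f (w y))" "v \<in> D2 (w y) \<Longrightarrow> v \<in> range (d1 f (w y))" "v' \<in> D3 (w y) \<Longrightarrow> v' \<in> range (d1 f (w y))"
  using T(2) D2(3) D3(3) rw(2)[OF y] by blast+

lemma d2_TT: "d2 F y (T (w y)) (T (w y)) = lam / (r y)\<^sup>2"
  using d2_XX[OF tangent(1) tangent(1)] T(3)[OF rw(2)[OF y]] by simp

lemma d2_TV: "v \<in> D2 (w y) \<Longrightarrow> d2 F y (T (w y)) v = 0" "v \<in> D2 (w y) \<Longrightarrow> d2 F y v (T (w y)) = 0"
  using d2_XX[OF tangent(1) tangent(2)] orth(1)[OF rw(2)[OF y]] d2_sym[OF y, of v] by simp_all

lemma d2_TW: "v \<in> D3 (w y) \<Longrightarrow> d2 F y (T (w y)) v = 0" "v \<in> D3 (w y) \<Longrightarrow> d2 F y v (T (w y)) = 0"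
  using d2_XX[OF tangent(1) tangent(3)] orth(2)[OF rw(2)[OF y]] d2_sym[OF y, of v] by simp_all

lemma d2_VW: "v \<in> D2 (w y) \<Longrightarrow> v' \<in> D3 (w y) \<Longrightarrow> d2 F y v v' = 0"
  using d2_XX[OF tangent(2) tangent(3)] orth(3)[OF rw(2)[OF y]] by simp

lemma d3_f: "d3 F y u v (f (w y)) = - (2 / r y) * d2 F y u v" "d3 F y u (f (w y)) v = - (2 / r y) * d2 F y u v"
  "d3 F y (f (w y)) u v = - (2 / r y) * d2 F y u v"
proof -
  have "d3 F y u v (r y *\<^sub>R f (w y)) = - 2 * d2 F y u v"
    using d3_ray[OF y] y_eq by metis
  then show 1: "d3 F y u v (f (w y)) = - (2 / r y) * d2 F y u v"
    using y_pos by (simp add: lin3 field_simps)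
  then show "d3 F y u (f (w y)) v = - (2 / r y) * d2 F y u v" using d3_sym23[OF y] by simp
  then show "d3 F y (f (w y)) u v = - (2 / r y) * d2 F y u v" using d3_sym12[OF y] by simp
qed

text \<open>Identities linear in x need checking only on f, where homogeneity applies, and on
  tangent vectors, where \<open>d3_K\<close> applies.\<close>

lemma vector_cases:
  assumes "\<And>u v. P u \<Longrightarrow> P v \<Longrightarrow> P (u + v)" "\<And>c. P (c *\<^sub>R f (w y))" "\<And>X. X \<in> range (d1 f (w y)) \<Longrightarrow> P X"
  shows "P x"
  by (rule decompose[OF y, of x]) (use assms in auto)

text \<open>K(T, T) accounts only for tangential x; the term - lam f supplies the value at x = f,
  namely - 2 / r times the Hessian on (T, T).\<close>

lemma d3_TT: "d3 F y (T (w y)) (T (w y)) x = - (2 / r y) * d2 F y ((lam2 + lam3) *\<^sub>R T (w y) - lam *\<^sub>R f (w y)) x"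
proof (rule vector_cases[where x = x])
  show "d3 F y (T (w y)) (T (w y)) X = - (2 / r y) * d2 F y ((lam2 + lam3) *\<^sub>R T (w y) - lam *\<^sub>R f (w y)) X"
    if "X \<in> range (d1 f (w y))" for X
    using d3_K[OF y tangent(1) tangent(1) that] K_T(1)[OF rw(2)[OF y]] d2_fX[OF that] by (simp add: lin)
qed (use y_pos in \<open>auto simp: lin lin3 d3_f d2_TT d2_ff d2_fX[OF tangent(1)] algebra_simps\<close>)

lemma d3_TV: assumes v: "v \<in> D2 (w y)" shows "d3 F y (T (w y)) v x = - (2 / r y) * (lam2 * d2 F y v x)"
proof (rule vector_cases[where x = x])
  show "d3 F y (T (w y)) v X = - (2 / r y) * (lam2 * d2 F y v X)" if "X \<in> range (d1 f (w y))" for X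
    using d3_K[OF y tangent(1) tangent(2)[OF v] that] K_T(2)[OF rw(2)[OF y] v] by (simp add: lin)
qed (auto simp: lin lin3 d3_f d2_TV[OF v] d2_fX[OF tangent(2)[OF v]] algebra_simps)

lemma d3_TW: assumes v: "v \<in> D3 (w y)" shows "d3 F y (T (w y)) v x = - (2 / r y) * (lam3 * d2 F y v x)"
proof (rule vector_cases[where x = x])
  show "d3 F y (T (w y)) v X = - (2 / r y) * (lam3 * d2 F y v X)" if "X \<in> range (d1 f (w y))" for X
    using d3_K[OF y tangent(1) tangent(3)[OF v] that] K_T(3)[OF rw(2)[OF y] v] by (simp add: lin)
qed (auto simp: lin lin3 d3_f d2_TW[OF v] d2_fX[OF tangent(3)[OF v]] algebra_simps)

lemma d3_VW: assumes v: "v \<in> D2 (w y)" "v' \<in> D3 (w y)" shows "d3 F y v v' x = 0"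
proof (rule vector_cases[where x = x])
  show "d3 F y v v' X = 0" if "X \<in> range (d1 f (w y))" for X
    using d3_K[OF y tangent(2)[OF v(1)] tangent(3)[OF v(2)] that] K_T(4)[OF rw(2)[OF y] v] linear_0[OF d2_linear1[OF y]] by simp
qed (auto simp: lin3 d3_f d2_VW[OF v])

lemma d3_eps: "d3 F y (y - e y) u x = - 2 * d2 F y u x - d3 F y (e y) u x"
proof -
  have "d3 F y y u x = - 2 * d2 F y u x"
    using d3_ray[OF y, of u x] d3_sym12[OF y] d3_sym23[OF y] by metis
  then show ?thesis by (simp add: lin3)
qed

lemma d3_ee: "d3 F y (e y) (e y) x = - 2 * d2 F y (e y) x"
proof -
  define c where "c = - (2 / r y)"
  define q where "q = r y / kap"
  define t where "t = d2 F y (T (w y)) x"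
  define g where "g = d2 F y (f (w y)) x"
  have qc: "q * (c * (lam2 - lam3)) = - 2"
    using y_pos kap_nz by (simp add: q_def c_def kap_def[symmetric])
  have TT: "d3 F y (T (w y)) (T (w y)) x = c * ((lam2 + lam3) * t - lam2 * lam3 * g)"
    unfolding d3_TT c_def t_def g_def by (simp add: lin lam23)
  have "d3 F y (e y) (e y) x = q * (q * (d3 F y (T (w y)) (T (w y)) x - lam3 * d3 F y (T (w y)) (f (w y)) x
      - lam3 * d3 F y (f (w y)) (T (w y)) x + lam3 * (lam3 * d3 F y (f (w y)) (f (w y)) x)))"
    unfolding e_def q_def[symmetric] by (simp add: lin3 algebra_simps)
  also have "\<dots> = q * (q * (c * ((lam2 + lam3) * t - lam2 * lam3 * g) - lam3 * (c * t) - lam3 * (c * t) + lam3 * (lam3 * (c * g))))"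
    unfolding TT d3_f c_def[symmetric] t_def g_def ..
  \<comment> \<open>The relations lam1 = lam2 + lam3 and lam = lam2 lam3 make the bracket factor as
    (lam2 - lam3) (t - lam3 g).\<close>
  also have "\<dots> = q * (c * (lam2 - lam3)) * (q * (t - lam3 * g))" by algebra
  also have "\<dots> = - 2 * d2 F y (e y) x"
    unfolding qc e_def q_def[symmetric] by (simp add: lin t_def g_def)
  finally show ?thesis .
qed

lemma d3_eV: assumes v: "v \<in> D2 (w y)" shows "d3 F y (e y) v x = - 2 * d2 F y v x"
proof -
  have "d3 F y (e y) v x = (r y / kap) * (- (2 / r y)) * (kap * d2 F y v x)"
  proof -
    define c where "c = - (2 / r y)"
    define q where "q = r y / kap"
    have "d3 F y (e y) v x = q * (c * (lam2 * d2 F y v x) - lam3 * (c * d2 F y v x))"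
      unfolding e_def q_def[symmetric] lin3 d3_f d3_TV[OF v] c_def[symmetric] by simp
    also have "\<dots> = q * c * (kap * d2 F y v x)" unfolding kap_def by algebra
    finally show ?thesis unfolding q_def c_def .
  qed
  then show ?thesis using kap_nz y_pos by simp
qed

lemma d3_eW: assumes v: "v \<in> D3 (w y)" shows "d3 F y (e y) v x = 0"
  unfolding e_def by (simp add: lin3 d3_f d3_TW[OF v] lin)

lemma d2_ee: "d2 F y (e y) (e y) = - ((lam3\<^sup>2 - lam) / kap\<^sup>2)"
  unfolding e_def using y_pos kap_nz
  by (simp add: lin d2_TT d2_ff d2_fX[OF tangent(1)]) (simp add: field_simps power2_eq_square)

text \<open>The value is a multiple of lam2 lam3 - lam, so orthogonality of the two position
  components is exactly the second relation between the eigenvalues.\<close>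

lemma d2_e_eps: "d2 F y (e y) (y - e y) = 0"
proof -
  define q where "q = r y / kap"
  have "d2 F y (e y) (y - e y) = q * (q * (- (lam / (r y)\<^sup>2) + lam2 * lam3 / (r y)\<^sup>2))"
    unfolding eps_eq unfolding e_def q_def[symmetric] by (simp add: lin d2_TT d2_ff d2_fX[OF tangent(1)] algebra_simps)
  then show ?thesis using lam23 by simp
qed

lemma d2_eps_eps: "d2 F y (y - e y) (y - e y) = - ((lam2\<^sup>2 - lam) / kap\<^sup>2)"
  unfolding eps_eq using y_pos kap_nz
  by (simp add: lin d2_TT d2_ff d2_fX[OF tangent(1)]) (simp add: field_simps power2_eq_square)

lemma d2_eV: "v \<in> D2 (w y) \<Longrightarrow> d2 F y (e y) v = 0" "v \<in> D3 (w y) \<Longrightarrow> d2 F y (e y) v = 0"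
  "v \<in> D2 (w y) \<Longrightarrow> d2 F y v (y - e y) = 0"
  unfolding eps_eq unfolding e_def by (simp_all add: lin d2_TV d2_TW d2_fX tangent)

lemma d3_e_eps: "d3 F y (e y) (y - e y) x = 0"
  using d3_eps[of "e y" x] d3_ee[of x] d3_sym12[OF y] by simp

lemma d3_V_eps: "v \<in> D2 (w y) \<Longrightarrow> d3 F y v (y - e y) x = 0"
  using d3_eps[of v x] d3_eV[of v x] d3_sym12[OF y] by simp

lemma d3_eps_W: "v \<in> D3 (w y) \<Longrightarrow> d3 F y (y - e y) v x = - 2 * d2 F y v x"
  using d3_eps[of v x] d3_eW[of v x] by simp

lemma d3_eps_eps: "d3 F y (y - e y) (y - e y) x = - 2 * d2 F y (y - e y) x"
  using d3_eps[of "y - e y" x] d3_e_eps[of x] by simp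

lemmas lin_add = linear_add[OF d2_linear[OF y]] linear_add[OF d2_linear1[OF y]]
  linear_cmul[OF d2_linear[OF y]] linear_cmul[OF d2_linear1[OF y]]
  linear_add[OF d3_linear1[OF y]] linear_add[OF d3_linear2[OF y]] linear_cmul[OF d3_linear1[OF y]] linear_cmul[OF d3_linear2[OF y]]

lemma subspaces: "subspace (D2 (w y))" "subspace (D3 (w y))"
  using D2(2)[OF rw(2)[OF y]] D3(2)[OF rw(2)[OF y]] by (simp_all add: subspace_span)

end

lemma subspace_line_plus:
  assumes "subspace D" shows "subspace {\<alpha> *\<^sub>R x + v |\<alpha> v. v \<in> D}"
proof -
  have "{\<alpha> *\<^sub>R x + v |\<alpha> v. v \<in> D} = {a + b |a b. a \<in> span {x} \<and> b \<in> D}"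
    by (auto simp: span_singleton)
  then show ?thesis using subspace_sums[OF subspace_span[of "{x}"] assms] by simp
qed

text \<open>A vector is extended to a section by keeping its coefficients in the local frame, and
  the coefficient of s, constant.\<close>

lemma family_section:
  fixes E :: "nat \<Rightarrow> real^'n \<Rightarrow> real^('n option)" and m :: nat
  assumes sm: "\<And>i. i < m \<Longrightarrow> smooth_on \<Omega> (E i)" and y: "y \<in> Y" and s: "smooth_on Y s" and v: "v \<in> span {E i (w y) |i. i < m}"
  shows "\<exists>t. t y = \<alpha> *\<^sub>R s y + v \<and> (\<forall>z\<in>Y. (\<exists>v\<in>span {E i (w z) |i. i < m}. t z = \<alpha> *\<^sub>R s z + v) \<and> t differentiable (at z))"
proof -
  obtain c where c: "v = (\<Sum>i<m. c i *\<^sub>R E i (w y))" using span_family[of v "\<lambda>i. E i (w y)" m] v by blast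
  define t where "t z = \<alpha> *\<^sub>R s z + (\<Sum>i<m. c i *\<^sub>R E i (w z))" for z
  have "smooth_on Y t"
    unfolding t_def
    by (intro smooth_on_add smooth_on_scaleR smooth_on_const smooth_on_sum open_Y s smooth_on_compose[OF sm smooth_w open_Y open_Omega rw(2)]) auto
  then have "\<forall>z\<in>Y. t differentiable (at z)" using smooth_on_differentiable by blast
  moreover have "(\<Sum>i<m. c i *\<^sub>R E i (w z)) \<in> span {E i (w z) |i. i < m}" for z
    by (intro span_sum span_scale span_base) auto
  ultimately show ?thesis using c by (intro exI[of _ t]) (auto simp: t_def)
qed

text \<open>The minus signs make the Hessian metric positive definite. In the slot for the second
  derivative of e the vectors are exchanged because \<open>d2\<close> lists the direction of the
  outer derivative last.\<close>

lemma splitting: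
  "hessian_splitting Y (\<lambda>z u v. - d2 F z u v) (\<lambda>z u v x. - d3 F z u v x) (\<lambda>z u v x x'. - d4 F z u v x x') e (d1 e) (\<lambda>z x u. d2 e z u x)
    B2 B3 ((lam3\<^sup>2 - lam) / kap\<^sup>2) ((lam2\<^sup>2 - lam) / kap\<^sup>2)"
proof (rule hessian_splitting.intro)
  show "((\<lambda>z. - d2 F z u v) has_derivative (\<lambda>x. - d3 F z x u v)) (at z)" if "z \<in> Y" for z u v
    using has_derivative_minus[OF d3_deriv[OF that, of u v]] d3_sym12[OF that] d3_sym23[OF that] by simp
  show "((\<lambda>z. - d3 F z u v x') has_derivative (\<lambda>x. - d4 F z x u v x')) (at z)" if "z \<in> Y" for z u v x'
    using has_derivative_minus[OF d4_deriv[OF that, of u v x']] d4_sym12[OF that] d4_sym23[OF that] d4_sym34[OF that] by simp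
  show "linear (\<lambda>u. - d2 F z u v)" if "z \<in> Y" for z v
    by (rule linear_compose_neg[OF d2_linear1[OF that]])
  show "- d2 F z u u > 0" if "z \<in> Y" "u \<noteq> 0" for z u using d2_negative[OF that] by simp
  show "subspace (B2 z)" "subspace (B3 z)" if "z \<in> Y" for z
    unfolding B2_def B3_def by (intro subspace_line_plus subspaces that)+
  show "e z \<in> B2 z" if "z \<in> Y" for z
    unfolding B2_def using subspaces(1)[OF that, THEN subspace_0] by (intro CollectI exI[of _ "1::real"] exI[of _ 0]) simp
  show "z - e z \<in> B3 z" if "z \<in> Y" for z
    unfolding B3_def using subspaces(2)[OF that, THEN subspace_0] by (intro CollectI exI[of _ "1::real"] exI[of _ 0]) simp
  show "\<exists>v\<in>B2 z. \<exists>v'\<in>B3 z. u = v + v'" if z: "z \<in> Y" for z u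
  proof -
    obtain \<alpha> a where u: "u = \<alpha> *\<^sub>R f (w z) + d1 f (w z) a" by (rule decompose[OF z])
    obtain \<beta> v v' where v: "v \<in> D2 (w z)" "v' \<in> D3 (w z)" "d1 f (w z) a = \<beta> *\<^sub>R T (w z) + v + v'"
      using tangent_decomp[OF z, of "d1 f (w z) a"] by blast
    have rz: "r z > 0" by (rule rw(1)[OF z])
    have rf: "e z + (z - e z) = r z *\<^sub>R f (w z)" using rw(3)[OF z] by simp
    have ff: "f (w z) = (1 / r z) *\<^sub>R (e z + (z - e z))"
      unfolding rf using rz by simp
    \<comment> \<open>The definition of e is inverted to write T and f, and hence any vector,
      through e and z - e.\<close>
    have "(kap / r z) *\<^sub>R e z = T (w z) - lam3 *\<^sub>R f (w z)"
      unfolding e_def using rz kap_nz by simp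
    then have "T (w z) = (kap / r z) *\<^sub>R e z + lam3 *\<^sub>R f (w z)" by simp
    then have "u = (\<alpha> + \<beta> * lam3) *\<^sub>R f (w z) + (\<beta> * (kap / r z)) *\<^sub>R e z + v + v'"
      unfolding u v(3) by (simp add: algebra_simps)
    then have u1: "u = (\<alpha> + \<beta> * lam3) *\<^sub>R ((1 / r z) *\<^sub>R (e z + (z - e z))) + (\<beta> * (kap / r z)) *\<^sub>R e z + v + v'"
      unfolding ff .
    have gen: "p *\<^sub>R (k *\<^sub>R (a + b)) + q *\<^sub>R a + v + v' = (p * k + q) *\<^sub>R a + v + ((p * k) *\<^sub>R b + v')"
      for p k q :: real and a b by (simp add: algebra_simps)
    have "u = ((\<alpha> + \<beta> * lam3) * (1 / r z) + \<beta> * (kap / r z)) *\<^sub>R e z + v + (((\<alpha> + \<beta> * lam3) * (1 / r z)) *\<^sub>R (z - e z) + v')"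
      by (rule trans[OF u1 gen])
    then show ?thesis unfolding B2_def B3_def using v by blast
  qed
  show "- d2 F z v w0 = 0" "- d3 F z v w0 x = 0" if z: "z \<in> Y" and vw: "v \<in> B2 z" "w0 \<in> B3 z" for z v w0 x
  proof -
    obtain \<alpha> v' where v: "v = \<alpha> *\<^sub>R e z + v'" "v' \<in> D2 (w z)" using vw(1) unfolding B2_def by blast
    obtain \<beta> w' where w': "w0 = \<beta> *\<^sub>R (z - e z) + w'" "w' \<in> D3 (w z)" using vw(2) unfolding B3_def by blast
    show "- d2 F z v w0 = 0"
      unfolding v(1) w'(1) lin_add[OF z] using d2_eV[OF z] d2_e_eps[OF z] d2_VW[OF z v(2) w'(2)] v(2) w'(2) by simp
    show "- d3 F z v w0 x = 0"
      unfolding v(1) w'(1) lin_add[OF z] using d3_e_eps[OF z] d3_V_eps[OF z v(2)] d3_eW[OF z w'(2)] d3_VW[OF z v(2) w'(2)] by simp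
  qed
  show "- d3 F z (e z) v x = - 2 * - d2 F z v x" if z: "z \<in> Y" and v: "v \<in> B2 z" for z v x
  proof -
    obtain \<alpha> v' where v: "v = \<alpha> *\<^sub>R e z + v'" "v' \<in> D2 (w z)" using v unfolding B2_def by blast
    show ?thesis unfolding v(1) lin_add[OF z] using d3_ee[OF z, of x] d3_eV[OF z v(2), of x] by simp
  qed
  show "- d3 F z (z - e z) v x = - 2 * - d2 F z v x" if z: "z \<in> Y" and v: "v \<in> B3 z" for z v x
  proof -
    obtain \<alpha> v' where v: "v = \<alpha> *\<^sub>R (z - e z) + v'" "v' \<in> D3 (w z)" using v unfolding B3_def by blast
    show ?thesis unfolding v(1) lin_add[OF z] using d3_eps_eps[OF z, of x] d3_eps_W[OF z v(2), of x] by simp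
  qed
  show "- d2 F z (e z) (e z) = (lam3\<^sup>2 - lam) / kap\<^sup>2" "- d2 F z (z - e z) (z - e z) = (lam2\<^sup>2 - lam) / kap\<^sup>2" if "z \<in> Y" for z
    using d2_ee[OF that] d2_eps_eps[OF that] by simp_all
  show "\<exists>s. s z = v \<and> (\<forall>y\<in>Y. s y \<in> B2 y \<and> s differentiable (at y))" if z: "z \<in> Y" and v: "v \<in> B2 z" for z v
  proof -
    obtain \<alpha> v' where v: "v = \<alpha> *\<^sub>R e z + v'" "v' \<in> D2 (w z)" using v unfolding B2_def by blast
    have "v' \<in> span {E2 i (w z) |i. i < m2}" using v(2) D2(2)[OF rw(2)[OF z]] by simp
    from family_section[OF D2(1) z smooth_e this, where \<alpha> = \<alpha>]
    obtain t where t: "t z = v" "\<And>y. y \<in> Y \<Longrightarrow> (\<exists>v\<in>span {E2 i (w y) |i. i < m2}. t y = \<alpha> *\<^sub>R e y + v) \<and> t differentiable (at y)"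
      using v(1) by blast
    have "t y \<in> B2 y \<and> t differentiable (at y)" if "y \<in> Y" for y
      using t(2)[OF that] D2(2)[OF rw(2)[OF that]] unfolding B2_def by auto
    then show ?thesis using t(1) by blast
  qed
  show "\<exists>s. s z = v \<and> (\<forall>y\<in>Y. s y \<in> B3 y \<and> s differentiable (at y))" if z: "z \<in> Y" and v: "v \<in> B3 z" for z v
  proof -
    obtain \<alpha> v' where v: "v = \<alpha> *\<^sub>R (z - e z) + v'" "v' \<in> D3 (w z)" using v unfolding B3_def by blast
    have sm: "smooth_on Y (\<lambda>z. z - e z)" by (intro smooth_intros open_Y smooth_e)
    have "v' \<in> span {E3 i (w z) |i. i < m3}" using v(2) D3(2)[OF rw(2)[OF z]] by simp
    from family_section[OF D3(1) z sm this, where \<alpha> = \<alpha>]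
    obtain t where t: "t z = v" "\<And>y. y \<in> Y \<Longrightarrow> (\<exists>v\<in>span {E3 i (w y) |i. i < m3}. t y = \<alpha> *\<^sub>R (y - e y) + v) \<and> t differentiable (at y)"
      using v(1) by blast
    have "t y \<in> B3 y \<and> t differentiable (at y)" if "y \<in> Y" for y
      using t(2)[OF that] D3(2)[OF rw(2)[OF that]] unfolding B3_def by auto
    then show ?thesis using t(1) by blast
  qed
  show "open Y" by (rule open_Y)
  show "- d2 F z u v = - d2 F z v u" if "z \<in> Y" for z u v using d2_sym[OF that] by simp
  show "- d3 F z u v x = - d3 F z v u x" if "z \<in> Y" for z u v x using d3_sym12[OF that] by simp
  show "- d3 F z u v x = - d3 F z u x v" if "z \<in> Y" for z u v x using d3_sym23[OF that] by simp
  show "- d4 F z x u v x' = - d4 F z u x v x'" if "z \<in> Y" for z u v x x' using d4_sym12[OF that] by simp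
  show "- d4 F z x u v x' = - d4 F z x v u x'" if "z \<in> Y" for z u v x x' using d4_sym23[OF that] by simp
  show "- d4 F z x u v x' = - d4 F z x u x' v" if "z \<in> Y" for z u v x x' using d4_sym34[OF that] by simp
  show "(e has_derivative d1 e z) (at z)" if "z \<in> Y" for z by (rule e.d1_deriv[OF that])
  show "((\<lambda>z. d1 e z u) has_derivative d2 e z u) (at z)" if "z \<in> Y" for z u by (rule e.d2_deriv[OF that])
  show "d2 e z v u = d2 e z u v" if "z \<in> Y" for z u v by (rule e.d2_sym[OF that])
qed

end

section \<open>Determinants\<close>

text \<open>A is placed on the indices in the range of \<tau> and padded by the identity elsewhere.
  This handles block matrices over an index type that is only partitioned by two injections, not
  given as a sum type.\<close>

definition ext_matrix :: "('a \<Rightarrow> 'c) \<Rightarrow> real^'a^'a \<Rightarrow> real^'c^'c" where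
  "ext_matrix \<tau> A = (\<chi> i j. if i \<in> range \<tau> \<and> j \<in> range \<tau> then A $ inv \<tau> i $ inv \<tau> j else of_bool (i = j))"

lemma sum_range_split:
  fixes \<tau> :: "'a::finite \<Rightarrow> 'c::finite" and g :: "'c \<Rightarrow> real"
  assumes "inj \<tau>"
  shows "(\<Sum>k\<in>UNIV. g k) = (\<Sum>k\<in>UNIV. g (\<tau> k)) + (\<Sum>k\<in>- range \<tau>. g k)"
proof -
  have "(\<Sum>k\<in>UNIV. g k) = (\<Sum>k\<in>range \<tau>. g k) + (\<Sum>k\<in>- range \<tau>. g k)"
    by (metis Compl_partition finite sum.union_disjoint Compl_disjoint)
  also have "(\<Sum>k\<in>range \<tau>. g k) = (\<Sum>k\<in>UNIV. g (\<tau> k))"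
    using assms by (simp add: sum.reindex)
  finally show ?thesis .
qed

lemma ext_matrix_mult:
  fixes \<tau> :: "'a::finite \<Rightarrow> 'c::finite"
  assumes "inj \<tau>"
  shows "ext_matrix \<tau> (A ** B) = ext_matrix \<tau> A ** ext_matrix \<tau> B"
proof -
  have "(\<Sum>k\<in>UNIV. ext_matrix \<tau> A $ i $ k * ext_matrix \<tau> B $ k $ j) = ext_matrix \<tau> (A ** B) $ i $ j" for i j
  proof (cases "i \<in> range \<tau> \<and> j \<in> range \<tau>")
    case True
    then have "(\<Sum>k\<in>- range \<tau>. ext_matrix \<tau> A $ i $ k * ext_matrix \<tau> B $ k $ j) = 0"
      by (intro sum.neutral) (auto simp: ext_matrix_def)
    then show ?thesis
      using True assms by (simp add: sum_range_split[OF assms]) (simp add: ext_matrix_def matrix_matrix_mult_def inv_f_f)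
  next
    case False
    then have zero: "ext_matrix \<tau> A $ i $ \<tau> k * ext_matrix \<tau> B $ \<tau> k $ j = 0" for k
      by (auto simp: ext_matrix_def)
    have "(\<Sum>k\<in>- range \<tau>. ext_matrix \<tau> A $ i $ k * ext_matrix \<tau> B $ k $ j) = (\<Sum>k\<in>- range \<tau>. if k = i then of_bool (i = j) else 0)"
      by (rule sum.cong) (auto simp: ext_matrix_def)
    also have "\<dots> = of_bool (i = j)"
      using False by (cases "i = j") (auto simp: sum.delta)
    finally have 2: "(\<Sum>k\<in>- range \<tau>. ext_matrix \<tau> A $ i $ k * ext_matrix \<tau> B $ k $ j) = of_bool (i = j)" .
    have 1: "(\<Sum>k\<in>UNIV. ext_matrix \<tau> A $ i $ \<tau> k * ext_matrix \<tau> B $ \<tau> k $ j) = 0"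
      by (rule sum.neutral) (use zero in blast)
    have "ext_matrix \<tau> (A ** B) $ i $ j = of_bool (i = j)"
      using False by (auto simp: ext_matrix_def)
    then show ?thesis
      using sum_range_split[OF assms, of "\<lambda>k. ext_matrix \<tau> A $ i $ k * ext_matrix \<tau> B $ k $ j"] 1 2 by simp
  qed
  then show ?thesis by (simp add: vec_eq_iff matrix_matrix_mult_def)
qed

lemma det_transposed_identity:
  assumes "m \<noteq> n" shows "det (\<chi> i j. mat 1 $ i $ Transposition.transpose m n j :: real^'n^'n) = - 1"
  using det_permute_columns[OF permutes_swap_id[of m UNIV n], of "mat 1 :: real^'n^'n"] assms by (simp add: sign_swap_id)

lemma det_shear:
  assumes "m \<noteq> n" shows "det (\<chi> i j. if i = m \<and> j = n then c else of_bool (i = j) :: real^'n^'n) = 1"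
proof -
  have "(\<chi> i j. if i = m \<and> j = n then c else of_bool (i = j) :: real^'n^'n) =
      (\<chi> k. if k = m then row m (mat 1) + c *s row n (mat 1) else row k (mat 1))"
    using assms by (auto simp: vec_eq_iff row_def mat_def)
  then show ?thesis using det_row_operation[OF assms, of "mat 1 :: real^'n^'n" c] by simp
qed

text \<open>Padding is multiplicative and sends each kind of elementary matrix to one of the same
  kind, so induction over elementary matrices applies.\<close>

lemma det_ext_matrix:
  fixes \<tau> :: "'a::finite \<Rightarrow> 'c::finite"
  assumes \<tau>: "inj \<tau>" shows "det (ext_matrix \<tau> A) = det A"
proof (induction A rule: induct_matrix_elementary)
  case (1 A B)
  then show ?case by (simp add: ext_matrix_mult[OF \<tau>] det_mul)
next
  case (2 A i)
  have "row (\<tau> i) (ext_matrix \<tau> A) = 0"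
    using 2 by (auto simp: row_def ext_matrix_def vec_eq_iff inv_f_f[OF \<tau>])
  with 2 show ?case by (simp add: det_zero_row)
next
  case (3 A)
  have "ext_matrix \<tau> A $ i $ j = 0" if "i \<noteq> j" for i j
    using that \<tau> by (auto simp: ext_matrix_def inv_f_f intro!: 3)
  then have "det (ext_matrix \<tau> A) = (\<Prod>i\<in>UNIV. ext_matrix \<tau> A $ i $ i)" by (rule det_diagonal)
  also have "\<dots> = (\<Prod>i\<in>range \<tau>. ext_matrix \<tau> A $ i $ i)"
    by (rule prod.mono_neutral_right) (auto simp: ext_matrix_def)
  also have "\<dots> = (\<Prod>i\<in>UNIV. A $ i $ i)"
    using \<tau> by (simp add: prod.reindex ext_matrix_def inv_f_f)
  also have "\<dots> = det A" using 3 by (simp add: det_diagonal)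
  finally show ?case .
next
  case (4 m n)
  have "ext_matrix \<tau> (\<chi> i j. mat 1 $ i $ Transposition.transpose m n j) = (\<chi> i j. mat 1 $ i $ Transposition.transpose (\<tau> m) (\<tau> n) j)"
    using \<tau> by (auto simp: vec_eq_iff ext_matrix_def mat_def inv_f_f Transposition.transpose_def inj_eq)
  then show ?case using 4 \<tau> by (simp add: det_transposed_identity inj_eq)
next
  case (5 m n c)
  have "ext_matrix \<tau> (\<chi> i j. if i = m \<and> j = n then c else of_bool (i = j)) = (\<chi> i j. if i = \<tau> m \<and> j = \<tau> n then c else of_bool (i = j))"
    using \<tau> by (auto simp: vec_eq_iff ext_matrix_def inv_f_f inj_eq)
  then show ?case using 5 \<tau> by (simp add: det_shear inj_eq)
qed

text \<open>A block diagonal matrix is the product of its two padded blocks.\<close>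

lemma det_block:
  fixes \<sigma> :: "'a::finite \<Rightarrow> 'c::finite" and \<tau> :: "'b::finite \<Rightarrow> 'c" and A :: "real^'c^'c"
  assumes "inj \<sigma>" "inj \<tau>" "range \<tau> = - range \<sigma>"
    and zero: "\<And>i j. A $ \<sigma> i $ \<tau> j = 0" "\<And>i j. A $ \<tau> j $ \<sigma> i = 0"
  shows "det A = det (\<chi> i j. A $ \<sigma> i $ \<sigma> j) * det (\<chi> i j. A $ \<tau> i $ \<tau> j)"
proof -
  let ?B = "\<chi> i j. A $ \<sigma> i $ \<sigma> j" and ?C = "\<chi> i j. A $ \<tau> i $ \<tau> j"
  have "(\<Sum>k\<in>UNIV. ext_matrix \<sigma> ?B $ i $ k * ext_matrix \<tau> ?C $ k $ j) = A $ i $ j" for i j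
  proof (cases "i \<in> range \<sigma>")
    case True
    then obtain i' where i: "i = \<sigma> i'" by blast
    have 0: "(\<Sum>k\<in>- range \<sigma>. ext_matrix \<sigma> ?B $ i $ k * ext_matrix \<tau> ?C $ k $ j) = 0"
      using True by (intro sum.neutral) (auto simp: ext_matrix_def)
    have "\<sigma> k \<notin> range \<tau>" for k using assms(3) by auto
    then have "(\<Sum>k\<in>UNIV. ext_matrix \<sigma> ?B $ i $ \<sigma> k * ext_matrix \<tau> ?C $ \<sigma> k $ j) = (\<Sum>k\<in>UNIV. A $ \<sigma> i' $ \<sigma> k * of_bool (\<sigma> k = j))"
      using i assms(1) by (simp add: ext_matrix_def inv_f_f)
    also have "\<dots> = A $ i $ j"
    proof (cases "j \<in> range \<sigma>")
      case True
      then obtain j' where "j = \<sigma> j'" by blast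
      then have "(\<Sum>k\<in>UNIV. A $ \<sigma> i' $ \<sigma> k * of_bool (\<sigma> k = j)) = (\<Sum>k\<in>UNIV. if k = j' then A $ \<sigma> i' $ \<sigma> j' else 0)"
        using assms(1) by (intro sum.cong) (auto simp: inj_eq)
      then show ?thesis using i \<open>j = \<sigma> j'\<close> by simp
    next
      case False
      then obtain j' where j: "j = \<tau> j'" using assms(3) by blast
      have "of_bool (\<sigma> k = j) = (0::real)" for k using False by auto
      then show ?thesis using zero(1) i j by simp
    qed
    finally show ?thesis using 0 by (simp add: sum_range_split[OF assms(1)])
  next
    case False
    then have "(\<Sum>k\<in>UNIV. ext_matrix \<sigma> ?B $ i $ k * ext_matrix \<tau> ?C $ k $ j) = (\<Sum>k\<in>UNIV. if k = i then ext_matrix \<tau> ?C $ i $ j else 0)"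
      by (intro sum.cong) (auto simp: ext_matrix_def)
    also have "\<dots> = ext_matrix \<tau> ?C $ i $ j" by simp
    also have "\<dots> = A $ i $ j"
    proof -
      obtain i' where i: "i = \<tau> i'" using False assms(3) by blast
      show ?thesis
      proof (cases "j \<in> range \<tau>")
        case True
        then show ?thesis using i assms(2) by (auto simp: ext_matrix_def inv_f_f)
      next
        case F: False
        then obtain j' where "j = \<sigma> j'" using assms(3) by blast
        moreover have "\<sigma> j' \<noteq> \<tau> i'" using assms(3) by blast
        ultimately show ?thesis using i F zero(2) by (simp add: ext_matrix_def)
      qed
    qed
    finally show ?thesis .
  qed
  then have "A = ext_matrix \<sigma> ?B ** ext_matrix \<tau> ?C"
    by (simp add: vec_eq_iff matrix_matrix_mult_def)
  then have "det A = det (ext_matrix \<sigma> ?B ** ext_matrix \<tau> ?C)" by (rule arg_cong)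
  then show ?thesis by (simp only: det_mul det_ext_matrix[OF assms(1)] det_ext_matrix[OF assms(2)])
qed

lemma det_option_block:
  fixes A :: "real^('k::finite option)^('k option)"
  assumes "\<And>i. A $ None $ Some i = 0" "\<And>i. A $ Some i $ None = 0"
  shows "det A = A $ None $ None * det (\<chi> i j. A $ Some i $ Some j)"
proof -
  let ?n = "\<lambda>_::unit. None :: 'k option"
  have "det A = det (\<chi> i j. A $ Some i $ Some j) * det (\<chi> i j. A $ ?n i $ ?n j)"
    by (rule det_block) (use assms in \<open>auto simp: inj_on_def notin_range_Some\<close>)
  also have "det (\<chi> i j. A $ ?n i $ ?n j) = A $ None $ None"
    by (subst det_diagonal) auto
  finally show ?thesis by simp
qed

lemma det_scale_matrix:
  fixes A :: "real^'k::finite^'k" shows "det (\<chi> i j. c * A $ i $ j) = c ^ CARD('k) * det A"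
proof -
  have "(\<chi> i j. c * A $ i $ j) = (\<chi> i j. if i = j then c else 0) ** A"
    by (simp add: vec_eq_iff matrix_matrix_mult_def if_distrib[where f = "\<lambda>x. x * _"] cong: if_cong)
  moreover have "det (\<chi> i j. if i = j then c else 0 :: real^'k^'k) = c ^ CARD('k)"
    by (subst det_diagonal) auto
  ultimately show ?thesis by (simp add: det_mul)
qed

text \<open>The Gram matrix of the rows of Z is Z G \<open>transpose Z\<close>, with G the Gram
  matrix of the standard basis.\<close>

lemma det_gram:
  fixes B :: "real^'n \<Rightarrow> real^'n \<Rightarrow> real" and Z :: "real^'n::finite^'n"
  assumes "\<And>v. linear (B v)" "\<And>v. linear (\<lambda>u. B u v)"
  shows "det (\<chi> i j. B (Z $ i) (Z $ j)) = (det Z)\<^sup>2 * det (\<chi> i j. B (axis i 1) (axis j 1))"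
proof -
  let ?G = "\<chi> i j. B (axis i 1) (axis j 1)"
  have rep: "v = (\<Sum>a\<in>UNIV. v $ a *\<^sub>R axis a 1)" for v :: "real^'n"
    by (simp add: vec_eq_iff axis_def if_distrib cong: if_cong)
  have B: "B u v = (\<Sum>a\<in>UNIV. \<Sum>b\<in>UNIV. u $ a * (B (axis a 1) (axis b 1) * v $ b))" for u v
  proof -
    have "B u v = B (\<Sum>a\<in>UNIV. u $ a *\<^sub>R axis a 1) v" by (rule arg_cong[OF rep[of u]])
    also have "\<dots> = (\<Sum>a\<in>UNIV. u $ a * B (axis a 1) v)"
      unfolding linear_sum[OF assms(2)] linear_cmul[OF assms(2)] by simp
    also have "\<dots> = (\<Sum>a\<in>UNIV. u $ a * B (axis a 1) (\<Sum>b\<in>UNIV. v $ b *\<^sub>R axis b 1))"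
      by (rule sum.cong[OF refl]) (rule arg_cong[OF rep[of v]])
    also have "\<dots> = (\<Sum>a\<in>UNIV. u $ a * (\<Sum>b\<in>UNIV. v $ b * B (axis a 1) (axis b 1)))"
      unfolding linear_sum[OF assms(1)] linear_cmul[OF assms(1)] by simp
    finally show ?thesis by (simp add: sum_distrib_left mult_ac)
  qed
  have "(\<chi> i j. B (Z $ i) (Z $ j)) = Z ** (?G ** transpose Z)"
    unfolding B[of "Z $ _" "Z $ _"] by (simp add: vec_eq_iff matrix_matrix_mult_def transpose_def sum_distrib_left)
  then show ?thesis by (simp add: det_mul power2_eq_square)
qed

section \<open>Hyperspheres as level sets of homogeneous potentials\<close>

lemma smooth_manifold_open:
  fixes B :: "'e::euclidean_space set"
  assumes "open B" shows "smooth_manifold (open_manifold B)"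
proof -
  have "second_countable (euclidean :: 'e topology)"
  proof -
    obtain \<B> :: "'e set set" where \<B>: "countable \<B>" "topological_basis \<B>"
      using ex_countable_basis by blast
    have "\<exists>V\<in>\<B>. y \<in> V \<and> V \<subseteq> U" if "open U" "y \<in> U" for U y
      using topological_basisE[OF \<B>(2) that] by metis
    then show ?thesis
      unfolding second_countable_def using \<B> topological_basis_open[OF \<B>(2)] by (intro exI[of _ \<B>]) auto
  qed
  then have "second_countable (top_of_set B)" by (rule second_countable_subtopology)
  moreover have "Hausdorff_space (top_of_set B)" by (intro Hausdorff_space_subtopology Hausdorff_space_euclidean)
  moreover have "homeomorphic_map (subtopology (top_of_set B) B) (top_of_set B) id"
    by (simp add: subtopology_subtopology)
  moreover have "smooth_on B (id \<circ> inv_into B id)"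
    by (rule smooth_on_cong[OF smooth_on_id assms]) (simp add: inv_into_f_eq)
  ultimately show ?thesis
    using assms by (simp add: smooth_manifold_def open_manifold_def)
qed

text \<open>The level P = 0 is to be a hypersphere with affine normal equal to its position vector.
  The constant \<kappa> is the logarithmic degree of P, and the prescribed determinant is the value
  for which this normal satisfies the volume condition.\<close>

locale factor_potential =
  fixes S :: "(real^('k::finite option)) set" and P :: "real^('k option) \<Rightarrow> real" and \<kappa> :: real and B :: "(real^'k) set"
  assumes open_S': "open S" and smooth_P: "smooth_on S P" and \<kappa>: "\<kappa> > 0"
    and radial: "\<And>a. a \<in> S \<Longrightarrow> d1 P a a = \<kappa>"
    and neg: "\<And>a v. a \<in> S \<Longrightarrow> v \<noteq> 0 \<Longrightarrow> d2 P a v v < 0"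
    and scale: "\<And>a s. a \<in> S \<Longrightarrow> s > 0 \<Longrightarrow> s *\<^sub>R a \<in> S \<Longrightarrow> P (s *\<^sub>R a) = P a + \<kappa> * ln s"
    and det: "\<And>a. a \<in> S \<Longrightarrow> P a = 0 \<Longrightarrow> det (\<chi> i j. - d2 P a (axis i 1) (axis j 1)) = \<kappa> ^ (CARD('k) + 1)"
    and open_B: "open B"
    and B: "\<And>p. p \<in> B \<Longrightarrow> vcons 1 p \<in> S" "\<And>p. p \<in> B \<Longrightarrow> exp (- P (vcons 1 p) / \<kappa>) *\<^sub>R vcons 1 p \<in> S"
begin

sublocale smooth_function S P
  by unfold_locales (rule open_S' smooth_P)+

text \<open>The factor that moves (1, p) along its ray onto the level P = 0; it is read off from the
  logarithmic homogeneity. The level is thus parametrised projectively.\<close>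

definition \<rho> :: "real^'k \<Rightarrow> real" where "\<rho> p = exp (- P (vcons 1 p) / \<kappa>)"

definition \<psi> :: "real^'k \<Rightarrow> real^('k option)" where "\<psi> p = \<rho> p *\<^sub>R vcons 1 p"

lemma \<psi>_S: "p \<in> B \<Longrightarrow> \<psi> p \<in> S"
  using B(2) by (simp add: \<psi>_def \<rho>_def)

lemma \<rho>_pos: "\<rho> p > 0"
  by (simp add: \<rho>_def)

lemma P_\<psi>: "p \<in> B \<Longrightarrow> P (\<psi> p) = 0"
  using scale[OF B(1) \<rho>_pos] \<psi>_S \<kappa> by (simp add: \<psi>_def \<rho>_def)

lemma smooth_\<rho>: "smooth_on B \<rho>"
  unfolding \<rho>_def using \<kappa>
  by (intro smooth_intros open_B smooth_on_compose[OF smooth_P _ open_B open_S']) (auto intro: B(1))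

lemma smooth_\<psi>: "smooth_on B \<psi>"
  unfolding \<psi>_def by (intro smooth_intros open_B smooth_\<rho>)

lemma vcons_affine: "vcons r p = r *\<^sub>R axis None 1 + vcons 0 p"
  by (simp add: vec_eq_iff vcons_def axis_def split: option.split)

lemma linear_vcons0: "linear (vcons 0 :: real^'k \<Rightarrow> _)"
  by (rule linearI) (simp_all add: vec_eq_iff vcons_def split: option.split)

lemma d1_\<psi>:
  assumes p: "p \<in> B" shows "d1 \<psi> p a = d1 \<rho> p a *\<^sub>R vcons 1 p + \<rho> p *\<^sub>R vcons 0 a"
proof -
  have "(vcons 1 has_derivative vcons 0) (at p)"
    unfolding vcons_affine[of 1 "_"]
    using bounded_linear_imp_has_derivative[OF linear_vcons0[unfolded linear_conv_bounded_linear], of "at p"]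
    by (auto intro!: derivative_eq_intros)
  then have "(\<psi> has_derivative (\<lambda>a. \<rho> p *\<^sub>R vcons 0 a + d1 \<rho> p a *\<^sub>R vcons 1 p)) (at p)"
    unfolding \<psi>_def by (rule has_derivative_scaleR[OF smooth_on_has_derivative[OF smooth_\<rho> p]])
  then show ?thesis
    using fun_cong[OF frechet_derivative_at, of \<psi> _ p a] by (simp add: add.commute)
qed

lemma inj_d\<psi>:
  assumes p: "p \<in> B" shows "inj (d1 \<psi> p)"
proof (subst linear_injective_0[OF smooth_on_linear[OF smooth_\<psi> p]], intro allI impI)
  fix a assume "d1 \<psi> p a = 0"
  then have eq: "d1 \<rho> p a *\<^sub>R vcons 1 p + \<rho> p *\<^sub>R vcons 0 a = 0" using d1_\<psi>[OF p] by simp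
  then have "(d1 \<rho> p a *\<^sub>R vcons 1 p + \<rho> p *\<^sub>R vcons 0 a) $ None = 0" by simp
  then have "d1 \<rho> p a = 0" by simp
  then have "vcons 0 a = 0" using eq \<rho>_pos[of p] by simp
  then have "vtl (vcons 0 a) = vtl 0" by simp
  then show "a = 0" by (simp add: vtl_def vec_eq_iff)
qed

lemma d1P_\<psi>:
  assumes p: "p \<in> B" shows "d1 P (\<psi> p) (d1 \<psi> p a) = 0"
  by (rule has_derivative_constant_on[OF has_derivative_compose[OF smooth_on_has_derivative[OF smooth_\<psi> p] d1_deriv[OF \<psi>_S[OF p]]] open_B p P_\<psi>])

text \<open>The tangent space is the kernel of dP: it is contained in it, and the radial direction
  is complementary because dP takes the value \<kappa> > 0 on \<psi>.\<close>

lemma range_d\<psi>: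
  assumes p: "p \<in> B" shows "w \<in> range (d1 \<psi> p) \<longleftrightarrow> d1 P (\<psi> p) w = 0"
proof
  show "w \<in> range (d1 \<psi> p) \<Longrightarrow> d1 P (\<psi> p) w = 0" using d1P_\<psi>[OF p] by auto
  assume w: "d1 P (\<psi> p) w = 0"
  \<comment> \<open>Chosen so that w and the image of a differ only by a multiple of (1, p), hence
    of \<psi>; dP then forces this multiple to be zero.\<close>
  define a where "a = (1 / \<rho> p) *\<^sub>R (vtl w - (w $ None) *\<^sub>R p)"
  have "\<rho> p *\<^sub>R vcons 0 a = vcons 0 (\<rho> p *\<^sub>R a)" by (simp add: linear_cmul[OF linear_vcons0])
  also have "\<rho> p *\<^sub>R a = vtl w - (w $ None) *\<^sub>R p" using \<rho>_pos[of p] by (simp add: a_def)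
  finally have 1: "d1 \<psi> p a = d1 \<rho> p a *\<^sub>R vcons 1 p + vcons 0 (vtl w - (w $ None) *\<^sub>R p)"
    using d1_\<psi>[OF p] by simp
  have "w = (w $ None) *\<^sub>R vcons 1 p + vcons 0 (vtl w - (w $ None) *\<^sub>R p)"
    by (simp add: vec_eq_iff vcons_def vtl_def split: option.split)
  then have "w - d1 \<psi> p a = (w $ None - d1 \<rho> p a) *\<^sub>R vcons 1 p"
    using 1 by (metis add_diff_cancel_right scaleR_left_diff_distrib)
  also have "\<dots> = ((w $ None - d1 \<rho> p a) / \<rho> p) *\<^sub>R \<psi> p"
    using \<rho>_pos[of p] by (simp add: \<psi>_def)
  finally have eq: "w - d1 \<psi> p a = ((w $ None - d1 \<rho> p a) / \<rho> p) *\<^sub>R \<psi> p" .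
  have "d1 P (\<psi> p) (w - d1 \<psi> p a) = 0"
    using w d1P_\<psi>[OF p] linear_diff[OF d1_linear[OF \<psi>_S[OF p]]] by simp
  then have zero: "(w $ None - d1 \<rho> p a) / \<rho> p = 0"
    unfolding eq using linear_cmul[OF d1_linear[OF \<psi>_S[OF p]]] radial[OF \<psi>_S[OF p]] \<kappa> by simp
  have "w - d1 \<psi> p a = 0" unfolding eq zero by simp
  then have "w = d1 \<psi> p a" by simp
  then show "w \<in> range (d1 \<psi> p)" by blast
qed

lemma d2_radial:
  assumes a: "a \<in> S" shows "d2 P a a v = - d1 P a v" "d2 P a v a = - d1 P a v"
proof -
  have "((\<lambda>z. d1 P z z) has_derivative (\<lambda>x. d2 P a a x + d1 P a x)) (at a)"
    by (rule has_derivative_linear_argument[OF open_S a d1_linear d2_deriv[OF a] d2_linear1[OF a] has_derivative_ident])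
  then have "d2 P a a v + d1 P a v = 0"
    by (rule has_derivative_constant_on[OF _ open_S a]) (rule radial)
  then show "d2 P a a v = - d1 P a v" by simp
  then show "d2 P a v a = - d1 P a v" using d2_sym[OF a] by simp
qed

abbreviation M\<^sub>B :: "(real^'k, real^'k) manifold" where "M\<^sub>B \<equiv> open_manifold B"

lemma M_simps: "carrier_mfd M\<^sub>B = B" "atlas M\<^sub>B = {(B, id)}" "mfd_top M\<^sub>B = top_of_set B"
  by (simp_all add: open_manifold_def)

lemma inv_id: "u \<in> B \<Longrightarrow> inv_into B id u = u"
  by (simp add: inv_into_f_eq)

sublocale c: chart_of_manifold M\<^sub>B B id
  by unfold_locales (simp_all add: smooth_manifold_open open_B M_simps)

lemma chart_d1:
  assumes "smooth_on U g" "open U" "U \<subseteq> B" "p \<in> U"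
  shows "d1 (g \<circ> inv_into B id) p = d1 g p"
  by (rule d1_cong[symmetric, OF assms(2,4) smooth_on_differentiable[OF assms(1,4)]]) (use assms(3) inv_id in auto)

lemma imm: "immersion M\<^sub>B \<psi>"
proof -
  have sm: "smooth_on B (\<psi> \<circ> inv_into B id)"
    by (rule smooth_on_cong[OF smooth_\<psi> open_B]) (simp add: inv_id)
  show ?thesis
    unfolding immersion_def smooth_fun_on_def using sm inj_d\<psi> chart_d1[OF smooth_\<psi> open_B order_refl]
    by (simp add: M_simps chart_deriv_def)
qed

sublocale ic: immersed_chart M\<^sub>B B id \<psi>
  by unfold_locales (rule imm)

lemma tangent_\<psi>: "p \<in> B \<Longrightarrow> tangent_space M\<^sub>B \<psi> p = range (d1 \<psi> p)"
  using ic.tangent_space_chart[of p] chart_d1[OF smooth_\<psi> open_B order_refl, of p] by (simp add: inv_id)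

lemma openin_B: "openin (mfd_top M\<^sub>B) U \<longleftrightarrow> open U \<and> U \<subseteq> B"
  using open_B by (simp add: M_simps openin_open_eq conj_commute)

lemma smooth_fun_B:
  assumes "open U" "U \<subseteq> B" shows "smooth_fun_on M\<^sub>B U g \<longleftrightarrow> smooth_on U g"
proof -
  have "smooth_on U (g \<circ> inv_into B id) \<longleftrightarrow> smooth_on U g"
  proof
    assume "smooth_on U (g \<circ> inv_into B id)"
    then show "smooth_on U g"
      by (rule smooth_on_cong[OF _ assms(1)]) (use assms(2) inv_id in auto)
  next
    assume "smooth_on U g"
    then show "smooth_on U (g \<circ> inv_into B id)"
      by (rule smooth_on_cong[OF _ assms(1)]) (use assms(2) inv_id in auto)
  qed
  moreover have "B \<inter> U = U" using assms(2) by blast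
  ultimately show ?thesis by (simp add: smooth_fun_on_def M_simps)
qed

lemma deriv_along_\<psi>:
  assumes "open U" "U \<subseteq> B" "smooth_on U g" "p \<in> U"
  shows "deriv_along M\<^sub>B \<psi> (d1 \<psi> p a) g p = d1 g p a"
proof -
  have pB: "p \<in> B" using assms by blast
  have "deriv_along M\<^sub>B \<psi> (d1 (\<psi> \<circ> inv_into B id) p a) g (inv_into B id p) = d1 (g \<circ> inv_into B id) p a"
    by (rule ic.deriv_along_f) (use assms pB inv_id smooth_fun_B openin_B in auto)
  then show ?thesis
    using chart_d1[OF smooth_\<psi> open_B order_refl pB] chart_d1[OF assms(3,1,2,4)] by (simp add: inv_id pB)
qed

text \<open>The normalisation by \<kappa> comes from the normal \<psi>, on which dP equals
  \<kappa>.\<close>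

definition h :: "real^'k \<Rightarrow> real^('k option) \<Rightarrow> real^('k option) \<Rightarrow> real" where
  "h p X Y = - d2 P (\<psi> p) X Y / \<kappa>"

text \<open>Differentiating dP(Y) = 0 along X gives the Hessian on (Y, X) plus dP of the flat
  derivative; subtracting h \<psi> puts the latter into the kernel of dP.\<close>

lemma fundamental_form: "affine_fundamental_form M\<^sub>B \<psi> \<psi> h"
  unfolding affine_fundamental_form_def
proof (intro allI impI ballI, elim conjE)
  fix U X Y p
  assume U: "openin (mfd_top M\<^sub>B) U" and X: "vector_field_on M\<^sub>B \<psi> U X" and Y: "vector_field_on M\<^sub>B \<psi> U Y" and p: "p \<in> U"
  have U': "open U" "U \<subseteq> B" using U by (simp_all add: openin_B)
  have pB: "p \<in> B" using U' p by blast
  have Y': "smooth_on U Y" "d1 P (\<psi> q) (Y q) = 0" if "q \<in> U" for q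
  proof -
    have qB: "q \<in> B" using that U' by blast
    show "smooth_on U Y" using Y smooth_fun_B[OF U'] unfolding vector_field_on_def by blast
    have "Y q \<in> range (d1 \<psi> q)" using Y that tangent_\<psi>[OF qB] unfolding vector_field_on_def by blast
    then show "d1 P (\<psi> q) (Y q) = 0" using range_d\<psi>[OF qB] by blast
  qed
  note Y' = Y'(1)[OF p] Y'(2)
  obtain a where a: "X p = d1 \<psi> p a"
    using X p tangent_\<psi>[OF pB] unfolding vector_field_on_def by blast
  have "((\<lambda>q. d1 P (\<psi> q) (Y q)) has_derivative (\<lambda>x. d2 P (\<psi> p) (Y p) (d1 \<psi> p x) + d1 P (\<psi> p) (d1 Y p x))) (at p)"
  proof (rule has_derivative_linear_argument[OF U'(1) p, where g = "\<lambda>q. d1 P (\<psi> q)" and g' = "\<lambda>x u. d2 P (\<psi> p) u (d1 \<psi> p x)"])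
    show "((\<lambda>z. d1 P (\<psi> z) u) has_derivative (\<lambda>x. d2 P (\<psi> p) u (d1 \<psi> p x))) (at p)" for u
      by (rule has_derivative_compose[OF smooth_on_has_derivative[OF smooth_\<psi> pB] d2_deriv[OF \<psi>_S[OF pB]]])
  qed (use U' d1_linear d2_linear1 \<psi>_S pB smooth_on_has_derivative[OF Y'(1) p] in auto)
  then have "d2 P (\<psi> p) (Y p) (X p) + d1 P (\<psi> p) (d1 Y p a) = 0"
    unfolding a by (rule has_derivative_constant_on[OF _ U'(1) p]) (rule Y'(2))
  then have "d1 P (\<psi> p) (d1 Y p a - h p (X p) (Y p) *\<^sub>R \<psi> p) = 0"
    using \<kappa> radial[OF \<psi>_S[OF pB]] d2_sym[OF \<psi>_S[OF pB], of "X p"]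
    by (simp add: h_def linear_add[OF d1_linear[OF \<psi>_S[OF pB]]] linear_diff[OF d1_linear[OF \<psi>_S[OF pB]]] linear_cmul[OF d1_linear[OF \<psi>_S[OF pB]]])
  then show "deriv_along M\<^sub>B \<psi> (X p) Y p - h p (X p) (Y p) *\<^sub>R \<psi> p \<in> tangent_space M\<^sub>B \<psi> p"
    unfolding a deriv_along_\<psi>[OF U' Y'(1) p] tangent_\<psi>[OF pB] range_d\<psi>[OF pB] .
qed

text \<open>The Gram determinant of - \<open>d2 P\<close> in the frame (X, \<psi>) is computed
  twice: by change of basis it is the squared frame determinant times \<kappa> to the power k + 1,
  and by blocks it is \<kappa> for \<psi> times \<kappa> to the power k times det h.\<close>

lemma volume:
  assumes p: "p \<in> B" and X: "\<And>i. X i \<in> range (d1 \<psi> p)"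
  shows "\<bar>det (\<chi> a. case a of Some i \<Rightarrow> X i | None \<Rightarrow> \<psi> p)\<bar> = sqrt \<bar>det (\<chi> i j. h p (X i) (X j))\<bar>"
proof -
  define Z :: "real^('k option)^('k option)" where "Z = (\<chi> a. case a of Some i \<Rightarrow> X i | None \<Rightarrow> \<psi> p)"
  let ?G = "\<lambda>u v. - d2 P (\<psi> p) u v"
  note \<psi> = \<psi>_S[OF p]
  have Xz: "d1 P (\<psi> p) (X i) = 0" for i using X[of i] range_d\<psi>[OF p] by blast
  have "det (\<chi> i j. ?G (Z $ i) (Z $ j)) = (det Z)\<^sup>2 * det (\<chi> i j. ?G (axis i 1) (axis j 1))"
    by (rule det_gram) (intro linear_compose_neg d2_linear d2_linear1 \<psi>)+
  then have 1: "det (\<chi> i j. ?G (Z $ i) (Z $ j)) = (det Z)\<^sup>2 * \<kappa> ^ (CARD('k) + 1)"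
    using det[OF \<psi> P_\<psi>[OF p]] by simp
  have "det (\<chi> i j. ?G (Z $ i) (Z $ j)) = (\<chi> i j. ?G (Z $ i) (Z $ j)) $ None $ None * det (\<chi> i j. (\<chi> i j. ?G (Z $ i) (Z $ j)) $ Some i $ Some j)"
    by (rule det_option_block) (simp_all add: Z_def d2_radial[OF \<psi>] Xz)
  also have "\<dots> = \<kappa> * det (\<chi> i j. ?G (X i) (X j))"
    by (simp add: Z_def d2_radial[OF \<psi>] radial[OF \<psi>])
  also have "(\<chi> i j. ?G (X i) (X j)) = (\<chi> i j. \<kappa> * (\<chi> i j. h p (X i) (X j)) $ i $ j)"
    using \<kappa> by (simp add: h_def)
  also have "det \<dots> = \<kappa> ^ CARD('k) * det (\<chi> i j. h p (X i) (X j))" by (rule det_scale_matrix)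
  finally have "\<kappa> ^ (CARD('k) + 1) * (det Z)\<^sup>2 = \<kappa> ^ (CARD('k) + 1) * det (\<chi> i j. h p (X i) (X j))"
    using 1 by (simp add: mult_ac)
  then have "(det Z)\<^sup>2 = det (\<chi> i j. h p (X i) (X j))" using \<kappa> by simp
  then have "\<bar>det Z\<bar> = sqrt \<bar>det (\<chi> i j. h p (X i) (X j))\<bar>"
    by (metis abs_power2 real_sqrt_abs)
  then show ?thesis unfolding Z_def .
qed

text \<open>Since the normal is the position vector, its derivative along w is w, so the shape
  operator is minus the identity.\<close>

theorem hypersphere: "hyperbolic_affine_hypersphere M\<^sub>B \<psi> \<psi> h (- 1)" "center_at M\<^sub>B \<psi> \<psi> 0"
proof -
  have d\<psi>: "deriv_along M\<^sub>B \<psi> w \<psi> p = w" if "p \<in> B" "w \<in> range (d1 \<psi> p)" for p w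
    using that deriv_along_\<psi>[OF open_B order_refl smooth_\<psi> that(1)] by auto
  have trans: "\<psi> p \<notin> range (d1 \<psi> p)" if "p \<in> B" for p
    using range_d\<psi>[OF that, of "\<psi> p"] radial[OF \<psi>_S[OF that]] \<kappa> by simp
  have pos: "h p w w > 0" if "p \<in> B" "w \<noteq> 0" for p w
    using neg[OF \<psi>_S[OF that(1)] that(2)] \<kappa> by (simp add: h_def divide_neg_pos)
  have "affine_normal_metric M\<^sub>B \<psi> \<psi> h"
    unfolding affine_normal_metric_def
  proof (intro conjI ballI allI impI)
    show "smooth_fun_on M\<^sub>B (carrier_mfd M\<^sub>B) \<psi>"
      using smooth_fun_B[OF open_B order_refl, of \<psi>] smooth_\<psi> by (simp add: M_simps)
    show "\<psi> p \<notin> tangent_space M\<^sub>B \<psi> p" if "p \<in> carrier_mfd M\<^sub>B" for p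
      using that trans tangent_\<psi> by (simp add: M_simps)
    show "deriv_along M\<^sub>B \<psi> w \<psi> p \<in> tangent_space M\<^sub>B \<psi> p" if "p \<in> carrier_mfd M\<^sub>B" "w \<in> tangent_space M\<^sub>B \<psi> p" for p w
      using that d\<psi> tangent_\<psi> by (simp add: M_simps)
    show "\<bar>det (\<chi> a. case a of Some i \<Rightarrow> X i | None \<Rightarrow> \<psi> p)\<bar> = sqrt \<bar>det (\<chi> i j. h p (X i) (X j))\<bar>"
      if "p \<in> carrier_mfd M\<^sub>B" "\<forall>i. X i \<in> tangent_space M\<^sub>B \<psi> p" for p X
      using that volume[of p X] tangent_\<psi> by (simp add: M_simps)
  qed (rule fundamental_form)
  then show "hyperbolic_affine_hypersphere M\<^sub>B \<psi> \<psi> h (- 1)"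
    unfolding hyperbolic_affine_hypersphere_def affine_hypersphere_def
    using imm smooth_manifold_open[OF open_B] pos d\<psi> tangent_\<psi> by (simp add: M_simps shape_operator_def)
  show "center_at M\<^sub>B \<psi> \<psi> 0"
    unfolding center_at_def by (intro ballI exI[of _ "- 1"]) simp
qed

end

section \<open>Potentials that split\<close>

text \<open>On the segment from the identity to A the matrices stay positive definite, so the
  determinant never vanishes and keeps the sign it has at the identity.\<close>

lemma det_positive_definite:
  fixes A :: "real^'n::finite^'n"
  assumes pos: "\<And>v. v \<noteq> 0 \<Longrightarrow> v \<bullet> (A *v v) > 0"
  shows "det A > 0"
proof -
  let ?f = "\<lambda>t::real. det ((1 - t) *\<^sub>R mat 1 + t *\<^sub>R A)"
  have cont: "continuous_on UNIV ?f"
    by (rule smooth_on_continuous, rule smooth_on_det) (auto intro!: smooth_intros)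
  have nz: "?f t \<noteq> 0" if t: "0 \<le> t" "t \<le> 1" for t
  proof
    assume "?f t = 0"
    then have "\<not> invertible ((1 - t) *\<^sub>R mat 1 + t *\<^sub>R A)" by (simp add: invertible_det_nz)
    then obtain v where v: "((1 - t) *\<^sub>R mat 1 + t *\<^sub>R A) *v v = 0" "v \<noteq> 0"
      using invertible_left_inverse matrix_left_invertible_ker by blast
    have "((1 - t) *\<^sub>R mat 1 + t *\<^sub>R A) *v v = (1 - t) *\<^sub>R v + t *\<^sub>R (A *v v)"
      by (simp add: matrix_vector_mult_add_rdistrib scaleR_matrix_vector_assoc[symmetric])
    then have "v \<bullet> ((1 - t) *\<^sub>R v + t *\<^sub>R (A *v v)) = 0" using v(1) by simp
    then have sum: "(1 - t) * (v \<bullet> v) + t * (v \<bullet> (A *v v)) = 0" by (simp add: inner_add_right)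
    have p: "v \<bullet> v > 0" "v \<bullet> (A *v v) > 0" using v(2) pos by auto
    show False
    proof (cases "t = 0")
      case True then show False using sum p by simp
    next
      case False
      then have "t * (v \<bullet> (A *v v)) > 0" "(1 - t) * (v \<bullet> v) \<ge> 0" using p t by auto
      then show False using sum by linarith
    qed
  qed
  show ?thesis
  proof (rule ccontr)
    assume "\<not> det A > 0"
    then have "?f 1 \<le> 0" "0 \<le> ?f 0" by simp_all
    then have "\<exists>t\<ge>0. t \<le> 1 \<and> ?f t = 0"
      by (intro IVT2') (auto intro: continuous_on_subset[OF cont])
    then show False using nz by blast
  qed
qed

lemma det_gram_positive:
  fixes G :: "'v::real_vector \<Rightarrow> 'v \<Rightarrow> real" and J :: "real^'k::finite \<Rightarrow> 'v"
  assumes J: "linear J" "inj J" and G: "\<And>v. linear (G v)" "\<And>v. linear (\<lambda>u. G u v)" "\<And>v. v \<noteq> 0 \<Longrightarrow> G v v > 0"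
  shows "det (\<chi> i j. G (J (axis i 1)) (J (axis j 1))) > 0"
proof (rule det_positive_definite)
  fix v :: "real^'k" assume "v \<noteq> 0"
  then have "J v \<noteq> 0" using J linear_injective_0 by blast
  have rep: "v = (\<Sum>a\<in>UNIV. v $ a *\<^sub>R axis a 1)"
    by (simp add: vec_eq_iff axis_def if_distrib cong: if_cong)
  have Jv: "J v = (\<Sum>a\<in>UNIV. v $ a *\<^sub>R J (axis a 1))"
    by (rule trans[OF arg_cong[OF rep]]) (simp add: linear_sum[OF J(1)] linear_cmul[OF J(1)])
  have "G (J v) (J v) = (\<Sum>a\<in>UNIV. \<Sum>b\<in>UNIV. v $ a * (v $ b * G (J (axis a 1)) (J (axis b 1))))"
    unfolding Jv linear_sum[OF G(1)] linear_sum[OF G(2)] linear_cmul[OF G(1)] linear_cmul[OF G(2)]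
    by (simp add: sum_distrib_left, subst sum.swap, simp add: mult_ac)
  also have "\<dots> = v \<bullet> ((\<chi> i j. G (J (axis i 1)) (J (axis j 1))) *v v)"
    by (simp add: inner_vec_def matrix_vector_mult_def sum_distrib_left mult_ac)
  finally show "v \<bullet> ((\<chi> i j. G (J (axis i 1)) (J (axis j 1))) *v v) > 0"
    using G(3)[OF \<open>J v \<noteq> 0\<close>] by simp
qed

lemma segment_constant:
  fixes g :: "'a::real_normed_vector \<Rightarrow> real"
  assumes g: "smooth_on S g" and seg: "\<And>t. 0 \<le> t \<Longrightarrow> t \<le> 1 \<Longrightarrow> z + t *\<^sub>R (z' - z) \<in> S"
    and zero: "\<And>t. 0 \<le> t \<Longrightarrow> t \<le> 1 \<Longrightarrow> d1 g (z + t *\<^sub>R (z' - z)) (z' - z) = 0"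
  shows "g z' = g z"
proof -
  have "\<exists>t>0. t < 1 \<and> g (z + 1 *\<^sub>R (z' - z)) - g (z + 0 *\<^sub>R (z' - z)) = (1 - 0) * d1 g (z + t *\<^sub>R (z' - z)) (z' - z)"
  proof (rule MVT2)
    fix t :: real assume "0 \<le> t" "t \<le> 1"
    then show "((\<lambda>t. g (z + t *\<^sub>R (z' - z))) has_real_derivative d1 g (z + t *\<^sub>R (z' - z)) (z' - z)) (at t)"
      unfolding has_real_derivative_iff_has_vector_derivative by (intro derivative_along_line[OF g] seg)
  qed simp
  then show ?thesis using zero by auto
qed

lemma convex_segment: "convex S \<Longrightarrow> z \<in> S \<Longrightarrow> z' \<in> S \<Longrightarrow> 0 \<le> t \<Longrightarrow> t \<le> 1 \<Longrightarrow> z + t *\<^sub>R (z' - z) \<in> S"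
proof -
  assume a: "convex S" "z \<in> S" "z' \<in> S" "0 \<le> t" "t \<le> 1"
  have "z + t *\<^sub>R (z' - z) = (1 - t) *\<^sub>R z + t *\<^sub>R z'" by (simp add: algebra_simps)
  then show ?thesis using convexD_alt[OF a(1-5)] by simp
qed

section \<open>Potentials with a constant orthogonal projection\<close>

locale split_potential = smooth_function S F
  for S :: "(real^('n::finite option)) set" and F :: "real^('n option) \<Rightarrow> real" +
  fixes \<pi> :: "real^('n option) \<Rightarrow> real^('n option)" and y0 :: "real^('n option)" and k2 k3 c0 :: real
  assumes S: "convex S" "y0 \<in> S" and F0: "F y0 = 0"
    and lin_pi: "linear \<pi>" and idem: "\<And>v. \<pi> (\<pi> v) = \<pi> v"
    and d1_pi: "\<And>z. z \<in> S \<Longrightarrow> d1 F z (\<pi> z) = k2" "\<And>z. z \<in> S \<Longrightarrow> d1 F z (z - \<pi> z) = k3"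
    and k_pos: "k2 > 0" "k3 > 0"
    and orth: "\<And>z u v. z \<in> S \<Longrightarrow> d2 F z (\<pi> u) (v - \<pi> v) = 0"
    and neg: "\<And>z v. z \<in> S \<Longrightarrow> v \<noteq> 0 \<Longrightarrow> d2 F z v v < 0"
    and MA: "\<And>z. z \<in> S \<Longrightarrow> F z = 0 \<Longrightarrow> det (\<chi> i j. - d2 F z (axis i 1) (axis j 1)) = c0"
begin

lemma swap_potential: "split_potential S F (\<lambda>v. v - \<pi> v) y0 k3 k2 c0"
proof (rule split_potential.intro[OF smooth_function_axioms split_potential_axioms.intro])
  show "linear (\<lambda>v. v - \<pi> v)" by (intro linear_compose_sub linear_ident lin_pi)
  show "(v - \<pi> v) - \<pi> (v - \<pi> v) = v - \<pi> v" for v by (simp add: linear_diff[OF lin_pi] idem)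
  show "d2 F z (u - \<pi> u) (v - (v - \<pi> v)) = 0" if "z \<in> S" for z u v
    using orth[OF that, of v u] d2_sym[OF that] by simp
qed (use S F0 d1_pi k_pos neg MA in simp_all)

text \<open>Moving inside a fibre of \<pi> means moving in the kernel, along which
  \<open>orth\<close> kills the derivative.\<close>

lemma d1_pi_depends:
  assumes z: "z \<in> S" "z' \<in> S" "\<pi> z = \<pi> z'" shows "d1 F z' (\<pi> u) = d1 F z (\<pi> u)"
proof (rule segment_constant[OF smooth_d1])
  show inS: "z + t *\<^sub>R (z' - z) \<in> S" if "0 \<le> t" "t \<le> 1" for t by (rule convex_segment[OF S(1) z(1,2) that])
  have "\<pi> (z' - z) = 0" using z(3) linear_diff[OF lin_pi] by simp
  then show "d2 F (z + t *\<^sub>R (z' - z)) (\<pi> u) (z' - z) = 0" if "0 \<le> t" "t \<le> 1" for t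
    using orth[OF inS[OF that], of u "z' - z"] by simp
qed

lemma d2_pi_depends:
  assumes z: "z \<in> S" "z' \<in> S" "\<pi> z = \<pi> z'" shows "d2 F z' (\<pi> u) (\<pi> v) = d2 F z (\<pi> u) (\<pi> v)"
proof (rule segment_constant[OF smooth_d2])
  show inS: "z + t *\<^sub>R (z' - z) \<in> S" if "0 \<le> t" "t \<le> 1" for t by (rule convex_segment[OF S(1) z(1,2) that])
  have ker: "\<pi> (z' - z) = 0" using z(3) linear_diff[OF lin_pi] by simp
  \<comment> \<open>The fixed vector z' - z lies in the kernel, so \<open>orth\<close> holds for it
    throughout S and may be differentiated along \<pi> v.\<close>
  have "d3 F w (\<pi> u) (z' - z) (\<pi> v) = 0" if "w \<in> S" for w
    by (rule has_derivative_constant_on[OF d3_deriv[OF that] open_S that]) (use orth[of _ u "z' - z"] ker in simp)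
  then show "d3 F (z + t *\<^sub>R (z' - z)) (\<pi> u) (\<pi> v) (z' - z) = 0" if "0 \<le> t" "t \<le> 1" for t
    using inS[OF that] d3_sym23 by simp
qed

lemma d2_pi: assumes z: "z \<in> S" shows "d2 F z (\<pi> z) x = - d1 F z (\<pi> x)"
proof -
  have "((\<lambda>z. d1 F z (\<pi> z)) has_derivative (\<lambda>x. d2 F z (\<pi> z) x + d1 F z (\<pi> x))) (at z)"
    by (rule has_derivative_linear_argument[OF open_S z d1_linear d2_deriv[OF z] d2_linear1[OF z]])
      (auto intro: bounded_linear_imp_has_derivative simp: lin_pi linear_conv_bounded_linear[symmetric])
  then have "d2 F z (\<pi> z) x + d1 F z (\<pi> x) = 0"
    by (rule has_derivative_constant_on[OF _ open_S z]) (rule d1_pi)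
  then show ?thesis by simp
qed

lemma d3_pi: assumes z: "z \<in> S" shows "d3 F z (\<pi> u) (\<pi> v) (\<pi> z) = - 2 * d2 F z (\<pi> u) (\<pi> v)"
proof -
  have "((\<lambda>z. d2 F z (\<pi> z) (\<pi> v)) has_derivative (\<lambda>x. d3 F z (\<pi> z) (\<pi> v) x + d2 F z (\<pi> x) (\<pi> v))) (at z)"
    by (rule has_derivative_linear_argument[OF open_S z d2_linear1 d3_deriv[OF z] d3_linear1[OF z]])
      (auto intro: bounded_linear_imp_has_derivative simp: lin_pi linear_conv_bounded_linear[symmetric])
  moreover have "((\<lambda>z. - d1 F z (\<pi> v)) has_derivative (\<lambda>x. - d2 F z (\<pi> v) x)) (at z)"
    by (intro has_derivative_minus d2_deriv[OF z])
  ultimately have "d3 F z (\<pi> z) (\<pi> v) (\<pi> u) + d2 F z (\<pi> (\<pi> u)) (\<pi> v) = - d2 F z (\<pi> v) (\<pi> u)"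
    by (rule has_derivative_eq_on[OF _ _ open_S z]) (use d2_pi[of _ "\<pi> v"] idem in simp)
  moreover have "d3 F z (\<pi> z) (\<pi> v) (\<pi> u) = d3 F z (\<pi> u) (\<pi> v) (\<pi> z)"
    using d3_sym12[OF z] d3_sym23[OF z] by metis
  ultimately show ?thesis using d2_sym[OF z, of "\<pi> v"] idem by simp
qed

text \<open>S is convex but not assumed conical, so the straight segment is used. On it both
  components are merely rescaled, by a and b, and \<open>d1_pi\<close> gives the derivative k2 a' /
  a + k3 b' / b.\<close>

lemma F_scale:
  assumes \<alpha>: "\<pi> \<alpha> = \<alpha>" and \<beta>: "\<pi> \<beta> = 0" and s: "s > 0" and t: "t > 0"
    and S1: "\<alpha> + \<beta> \<in> S" and S2: "s *\<^sub>R \<alpha> + t *\<^sub>R \<beta> \<in> S"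
  shows "F (s *\<^sub>R \<alpha> + t *\<^sub>R \<beta>) = F (\<alpha> + \<beta>) + k2 * ln s + k3 * ln t"
proof -
  let ?d = "(s - 1) *\<^sub>R \<alpha> + (t - 1) *\<^sub>R \<beta>"
  define a where "a x = 1 + x * (s - 1)" for x :: real
  define b where "b x = 1 + x * (t - 1)" for x :: real
  have pos: "a x > 0" "b x > 0" if "0 \<le> x" "x \<le> 1" for x
  proof -
    have "a x = (1 - x) + x * s" "b x = (1 - x) + x * t" by (simp_all add: a_def b_def algebra_simps)
    then show "a x > 0" "b x > 0"
      using that s t by (cases "x = 0"; simp add: add_nonneg_pos)+
  qed
  let ?z = "\<lambda>x. (\<alpha> + \<beta>) + x *\<^sub>R ?d"
  have zx: "?z x = a x *\<^sub>R \<alpha> + b x *\<^sub>R \<beta>" for x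
    by (simp add: a_def b_def algebra_simps)
  have inS: "?z x \<in> S" if "0 \<le> x" "x \<le> 1" for x
  proof -
    have "?d = (s *\<^sub>R \<alpha> + t *\<^sub>R \<beta>) - (\<alpha> + \<beta>)" by (simp add: algebra_simps)
    then show ?thesis using convex_segment[OF S(1) S1 S2 that] by simp
  qed
  have pz: "\<pi> (?z x) = a x *\<^sub>R \<alpha>" "?z x - \<pi> (?z x) = b x *\<^sub>R \<beta>" for x
    unfolding zx using \<alpha> \<beta> by (simp_all add: linear_add[OF lin_pi] linear_cmul[OF lin_pi])
  have "\<exists>x::real. x > 0 \<and> x < 1 \<and> (F (?z 1) - k2 * ln (a 1) - k3 * ln (b 1)) - (F (?z 0) - k2 * ln (a 0) - k3 * ln (b 0)) = (1 - 0) * 0"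
  proof (rule MVT2[of 0 1 "\<lambda>x. F (?z x) - k2 * ln (a x) - k3 * ln (b x)" "\<lambda>_. 0"])
    fix x :: real assume x: "0 \<le> x" "x \<le> 1"
    note lin = linear_add[OF d1_linear[OF inS[OF x]]] linear_cmul[OF d1_linear[OF inS[OF x]]]
    have "a x * d1 F (?z x) \<alpha> = k2" "b x * d1 F (?z x) \<beta> = k3"
      using d1_pi(1)[OF inS[OF x], unfolded pz(1)] d1_pi(2)[OF inS[OF x], unfolded pz(2)] unfolding lin by simp_all
    then have eqs: "d1 F (?z x) \<alpha> = k2 / a x" "d1 F (?z x) \<beta> = k3 / b x" using pos[OF x] by (simp_all add: field_simps)
    have "d1 F (?z x) ?d = (s - 1) * k2 / a x + (t - 1) * k3 / b x"
      by (simp only: lin) (simp add: eqs)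
    moreover have "((\<lambda>x. F (?z x)) has_real_derivative d1 F (?z x) ?d) (at x)"
      unfolding has_real_derivative_iff_has_vector_derivative by (rule derivative_along_line[OF smooth_F inS[OF x]])
    moreover have "(a has_real_derivative (s - 1)) (at x)" "(b has_real_derivative (t - 1)) (at x)"
      unfolding a_def b_def by (auto intro!: derivative_eq_intros)
    ultimately show "((\<lambda>x. F (?z x) - k2 * ln (a x) - k3 * ln (b x)) has_real_derivative 0) (at x)"
      using pos[OF x] by (auto intro!: derivative_eq_intros simp: field_simps)
  qed simp
  then have "F (?z 1) - k2 * ln (a 1) - k3 * ln (b 1) = F (?z 0) - k2 * ln (a 0) - k3 * ln (b 0)" by auto
  then show ?thesis unfolding zx by (simp add: a_def b_def)
qed

text \<open>Two parallel segments with the same projection are compared: by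
  \<open>d1_pi_depends\<close> F has the same derivative along both, and it vanishes at y0, the
  start of the second one.\<close>

lemma F_additive:
  assumes \<alpha>: "\<pi> \<alpha> = \<alpha>" and \<beta>: "\<pi> \<beta> = 0"
    and S1: "\<alpha> + \<beta> \<in> S" and S2: "\<alpha> + (y0 - \<pi> y0) \<in> S" and S3: "\<pi> y0 + \<beta> \<in> S"
  shows "F (\<alpha> + \<beta>) = F (\<alpha> + (y0 - \<pi> y0)) + F (\<pi> y0 + \<beta>)"
proof -
  let ?b = "y0 - \<pi> y0" and ?d = "\<alpha> - \<pi> y0"
  let ?z = "\<lambda>x. (\<pi> y0 + \<beta>) + x *\<^sub>R ?d" and ?w = "\<lambda>x. (\<pi> y0 + ?b) + x *\<^sub>R ?d"
  have z: "?z x \<in> S" "?w x \<in> S" if "0 \<le> x" "x \<le> 1" for x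
    using convex_segment[OF S(1) S3 S1 that] convex_segment[OF S(1) _ S2 that, of y0] S(2) by simp_all
  have pd: "\<pi> ?d = ?d" and pzw: "\<pi> (?z x) = \<pi> (?w x)" for x
    using \<alpha> \<beta> by (simp_all add: linear_add[OF lin_pi] linear_diff[OF lin_pi] linear_cmul[OF lin_pi] idem)
  have "\<exists>x::real. x > 0 \<and> x < 1 \<and> (F (?z 1) - F (?w 1)) - (F (?z 0) - F (?w 0)) = (1 - 0) * 0"
  proof (rule MVT2[of 0 1 "\<lambda>x. F (?z x) - F (?w x)" "\<lambda>_. 0"])
    fix x :: real assume x: "0 \<le> x" "x \<le> 1"
    have "d1 F (?z x) ?d - d1 F (?w x) ?d = 0"
      using d1_pi_depends[OF z[OF x] pzw, of ?d] pd by simp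
    then show "((\<lambda>x. F (?z x) - F (?w x)) has_real_derivative 0) (at x)"
      unfolding has_real_derivative_iff_has_vector_derivative
      using has_vector_derivative_diff[OF derivative_along_line[OF smooth_F z(1)[OF x]] derivative_along_line[OF smooth_F z(2)[OF x]]] by simp
  qed simp
  then have "F (?z 1) - F (?w 1) = F (?z 0) - F (?w 0)" by auto
  moreover have "?z 1 = \<alpha> + \<beta>" "?w 1 = \<alpha> + (y0 - \<pi> y0)" "?z 0 = \<pi> y0 + \<beta>" "?w 0 = y0"
    by (simp_all add: algebra_simps)
  ultimately show ?thesis using F0 by (metis add.commute diff_add_cancel diff_zero)
qed

text \<open>On the range of \<pi> the Hessian has degree - 2 under scaling of the first component
  alone.\<close>

lemma d2_scale:
  assumes z: "z \<in> S" and s: "s > 0" and z': "s *\<^sub>R \<pi> z + (z - \<pi> z) \<in> S"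
  shows "s\<^sup>2 * d2 F (s *\<^sub>R \<pi> z + (z - \<pi> z)) (\<pi> u) (\<pi> v) = d2 F z (\<pi> u) (\<pi> v)"
proof -
  let ?z' = "s *\<^sub>R \<pi> z + (z - \<pi> z)"
  let ?q = "\<lambda>y. d2 F y (\<pi> u) (\<pi> v)"
  \<comment> \<open>Along the scaling F grows by k2 ln s, so the exponential grows like the square
    of s and compensates the degree - 2 of the Hessian; g is therefore constant.\<close>
  define g where "g y = exp (2 / k2 * F y) * ?q y" for y
  have g': "(g has_derivative (\<lambda>x. exp (2 / k2 * F y) * d3 F y (\<pi> u) (\<pi> v) x + ((2 / k2 * d1 F y x) * exp (2 / k2 * F y)) * ?q y)) (at y)"
    if y: "y \<in> S" for y
    unfolding g_def by (intro has_derivative_mult has_derivative_exp has_derivative_mult_right d1_deriv[OF y] d3_deriv[OF y])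
  have sm: "smooth_on S g"
    unfolding g_def by (intro smooth_intros smooth_on_mult[OF open_S] smooth_on_exp[OF open_S] open_S smooth_F smooth_d2)
  have "g ?z' = g z"
  proof (rule segment_constant[OF sm])
    fix t :: real assume t: "0 \<le> t" "t \<le> 1"
    let ?y = "z + t *\<^sub>R (?z' - z)"
    show y: "?y \<in> S" by (rule convex_segment[OF S(1) z z' t])
    have py: "\<pi> ?y = (1 + t * (s - 1)) *\<^sub>R \<pi> z"
      by (simp add: linear_add[OF lin_pi] linear_diff[OF lin_pi] linear_cmul[OF lin_pi] idem algebra_simps)
    have pos: "1 + t * (s - 1) > 0"
    proof -
      have eq: "1 + t * (s - 1) = (1 - t) + t * s" by (simp add: algebra_simps)
      show ?thesis unfolding eq using t s by (cases "t = 0"; simp add: add_nonneg_pos)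
    qed
    have "?z' - z = (s - 1) *\<^sub>R \<pi> z" by (simp add: algebra_simps)
    also have "\<dots> = ((s - 1) / (1 + t * (s - 1))) *\<^sub>R \<pi> ?y" unfolding py using pos by simp
    finally have dir: "?z' - z = ((s - 1) / (1 + t * (s - 1))) *\<^sub>R \<pi> ?y" .
    have "d1 g ?y (\<pi> ?y) = exp (2 / k2 * F ?y) * d3 F ?y (\<pi> u) (\<pi> v) (\<pi> ?y) + ((2 / k2 * d1 F ?y (\<pi> ?y)) * exp (2 / k2 * F ?y)) * ?q ?y"
      by (rule fun_cong[OF frechet_derivative_at[OF g'[OF y], symmetric]])
    also have "\<dots> = 0"
      unfolding d3_pi[OF y] d1_pi[OF y] using k_pos by simp
    finally have zero: "d1 g ?y (\<pi> ?y) = 0" .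
    have "d1 g ?y (((s - 1) / (1 + t * (s - 1))) *\<^sub>R \<pi> ?y) = 0"
      unfolding linear_cmul[OF smooth_on_linear[OF sm y]] zero by simp
    then show "d1 g ?y (?z' - z) = 0" using dir by metis
  qed
  moreover have "F ?z' = F z + k2 * ln s"
    using F_scale[of "\<pi> z" "z - \<pi> z" s 1] z z' s by (simp add: linear_diff[OF lin_pi] idem)
  ultimately have "exp (2 / k2 * F z + 2 * ln s) * ?q ?z' = exp (2 / k2 * F z) * ?q z"
    using k_pos by (simp add: g_def distrib_left)
  moreover have "exp (2 * ln s) = s\<^sup>2" using s by (simp add: exp_double)
  ultimately show ?thesis by (simp add: exp_add)
qed

end

section \<open>One factor in linear coordinates\<close>

locale split_factor = split_potential S F \<pi> y0 k2 k3 c0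
  for S :: "(real^('n::finite option)) set" and F \<pi> y0 k2 k3 c0 +
  fixes J :: "real^('k::finite option) \<Rightarrow> real^('n option)"
  assumes J_linear: "linear J" and J_inj: "inj J" and J_pi: "\<And>a. \<pi> (J a) = J a" and J_base: "J (axis None 1) = \<pi> y0"
    and gram: "\<And>z. z \<in> S \<Longrightarrow> F z = 0 \<Longrightarrow> z - \<pi> z = y0 - \<pi> y0 \<Longrightarrow>
      det (\<chi> i j. - d2 F z (J (axis i 1)) (J (axis j 1))) = k2 ^ (CARD('k) + 1)"
begin

text \<open>The affine slice through y0 on which the other factor is frozen; restricting F to it
  gives the potential of one factor.\<close>

definition emb :: "real^('k option) \<Rightarrow> real^('n option)" where "emb a = J a + (y0 - \<pi> y0)"

definition S\<^sub>J :: "(real^('k option)) set" where "S\<^sub>J = emb -` S"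

definition P :: "real^('k option) \<Rightarrow> real" where "P a = F (emb a)"

lemma emb_deriv: "(emb has_derivative J) (at a)"
  unfolding emb_def using bounded_linear_imp_has_derivative[OF J_linear[unfolded linear_conv_bounded_linear], of "at a"]
  by (auto intro!: derivative_eq_intros)

lemma emb_pi: "\<pi> (emb a) = J a" "emb a - \<pi> (emb a) = y0 - \<pi> y0"
  by (simp_all add: emb_def linear_add[OF lin_pi] linear_diff[OF lin_pi] J_pi idem)

lemma continuous_emb: "continuous_on UNIV emb"
  using emb_deriv has_derivative_continuous by (simp add: continuous_on_eq_continuous_at) blast

lemma open_SJ: "open S\<^sub>J"
  unfolding S\<^sub>J_def by (rule open_vimage[OF open_S continuous_emb])

lemma smooth_emb: "open U \<Longrightarrow> smooth_on U emb"
  unfolding emb_def by (intro smooth_on_add smooth_on_linear_compose[OF J_linear] smooth_on_id smooth_on_const)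

lemma smooth_PJ: "smooth_on S\<^sub>J P"
  unfolding P_def by (rule smooth_on_compose[OF smooth_F smooth_emb[OF open_SJ] open_SJ open_S]) (simp add: S\<^sub>J_def)

lemma d1_P: assumes a: "a \<in> S\<^sub>J" shows "d1 P a u = d1 F (emb a) (J u)"
proof -
  have "(P has_derivative (\<lambda>u. d1 F (emb a) (J u))) (at a)"
    unfolding P_def by (rule has_derivative_compose[OF emb_deriv d1_deriv]) (use a S\<^sub>J_def in simp)
  then show ?thesis by (rule fun_cong[OF frechet_derivative_at, symmetric])
qed

lemma d2_P: assumes a: "a \<in> S\<^sub>J" shows "d2 P a u v = d2 F (emb a) (J u) (J v)"
proof -
  have "((\<lambda>a. d1 F (emb a) (J u)) has_derivative (\<lambda>v. d2 F (emb a) (J u) (J v))) (at a)"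
    by (rule has_derivative_compose[OF emb_deriv d2_deriv]) (use a S\<^sub>J_def in simp)
  then have "((\<lambda>a. d1 P a u) has_derivative (\<lambda>v. d2 F (emb a) (J u) (J v))) (at a)"
    by (rule has_derivative_transform_within_open[OF _ open_SJ a]) (simp add: d1_P)
  then show ?thesis by (rule fun_cong[OF frechet_derivative_at, symmetric])
qed

lemma base_in: "vcons 1 0 \<in> S\<^sub>J" "P (vcons 1 0) = 0"
proof -
  have "vcons 1 0 = (axis None 1 :: real^('k option))"
    by (simp add: vec_eq_iff vcons_def axis_def split: option.split)
  then have "emb (vcons 1 0) = y0" by (simp add: emb_def J_base)
  then show "vcons 1 0 \<in> S\<^sub>J" "P (vcons 1 0) = 0" using S(2) F0 by (simp_all add: S\<^sub>J_def P_def)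
qed

definition \<rho> :: "real^'k \<Rightarrow> real" where "\<rho> p = exp (- P (vcons 1 p) / k2)"

text \<open>The membership conditions that \<open>factor_potential\<close> imposes on parameters. It
  is an open neighbourhood of 0, where the parametrisation passes through y0.\<close>

definition dom :: "(real^'k) set" where "dom = {p. vcons 1 p \<in> S\<^sub>J \<and> \<rho> p *\<^sub>R vcons 1 p \<in> S\<^sub>J}"

lemma open_dom: "open dom" and zero_dom: "0 \<in> dom"
proof -
  let ?U = "vcons 1 -` S\<^sub>J :: (real^'k) set"
  have U: "open ?U"
    by (rule open_vimage[OF open_SJ smooth_on_continuous]) (intro smooth_intros open_UNIV)
  have "smooth_on ?U (\<lambda>p. P (vcons 1 p))"
    by (rule smooth_on_compose[OF smooth_PJ _ U open_SJ]) (auto intro: smooth_intros U)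
  then have "smooth_on ?U (\<lambda>p. exp (- P (vcons 1 p) / k2) *\<^sub>R (vcons 1 p :: real^('k option)))"
    by (intro smooth_on_scaleR[OF U] smooth_on_exp[OF U] smooth_on_divide[OF U] smooth_on_minus[OF U] smooth_on_const smooth_vcons[OF U] smooth_on_id)
      (use k_pos in auto)
  then have "open (?U \<inter> (\<lambda>p. exp (- P (vcons 1 p) / k2) *\<^sub>R vcons 1 p) -` S\<^sub>J)"
    by (intro continuous_open_preimage[OF _ U open_SJ] smooth_on_continuous)
  then show "open dom" by (simp add: dom_def \<rho>_def vimage_def Collect_conj_eq)
  show "0 \<in> dom" using base_in by (simp add: dom_def \<rho>_def)
qed

lemma factor:
  assumes B: "open B" "B \<subseteq> dom" shows "factor_potential S\<^sub>J P k2 B"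
proof
  show "open S\<^sub>J" "smooth_on S\<^sub>J P" "k2 > 0" "open B" by (fact open_SJ smooth_PJ k_pos B)+
  show "d1 P a a = k2" if "a \<in> S\<^sub>J" for a
    using d1_pi(1)[of "emb a"] that emb_pi(1) by (simp add: d1_P S\<^sub>J_def)
  show "d2 P a v v < 0" if "a \<in> S\<^sub>J" "v \<noteq> 0" for a v
    using neg[of "emb a" "J v"] that linear_injective_0[OF J_linear] J_inj by (auto simp: d2_P S\<^sub>J_def)
  show "P (s *\<^sub>R a) = P a + k2 * ln s" if "a \<in> S\<^sub>J" "s > 0" "s *\<^sub>R a \<in> S\<^sub>J" for a s
    using F_scale[of "J a" "y0 - \<pi> y0" s 1] that
    by (simp add: P_def S\<^sub>J_def emb_def J_pi linear_diff[OF lin_pi] idem linear_cmul[OF J_linear])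
  show "det (\<chi> i j. - d2 P a (axis i 1) (axis j 1)) = k2 ^ (CARD('k) + 1)" if "a \<in> S\<^sub>J" "P a = 0" for a
    using gram[of "emb a"] that emb_pi(2) by (simp add: d2_P S\<^sub>J_def P_def)
  show "vcons 1 p \<in> S\<^sub>J" "exp (- P (vcons 1 p) / k2) *\<^sub>R vcons 1 p \<in> S\<^sub>J" if "p \<in> B" for p
    using that B(2) by (auto simp: dom_def \<rho>_def)
qed

end

text \<open>An isometry onto the fixed space is composed with a rotation and a scaling by
  \<open>norm a\<close>, which together carry the distinguished axis to the prescribed vector
  v0.\<close>

lemma frame_exists:
  fixes \<pi> :: "'v::euclidean_space \<Rightarrow> 'v"
  assumes lin: "linear \<pi>" and dim: "dim {v. \<pi> v = v} = CARD('k option)" and v0: "\<pi> v0 = v0" "v0 \<noteq> 0"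
  obtains J :: "real^('k::finite option) \<Rightarrow> 'v" where "linear J" "inj J" "\<And>a. \<pi> (J a) = J a" "J (axis None 1) = v0"
    "\<And>v. \<pi> v = v \<Longrightarrow> v \<in> range J"
proof -
  have sub: "subspace {v. \<pi> v = v}"
    by (simp add: subspace_def linear_0[OF lin] linear_add[OF lin] linear_cmul[OF lin])
  have "dim (UNIV :: (real^('k option)) set) = dim {v. \<pi> v = v}" using dim by simp
  then obtain f :: "real^('k option) \<Rightarrow> 'v" and g where f: "linear f" "f ` UNIV = {v. \<pi> v = v}" "\<And>x. g (f x) = x"
    and g: "linear g" "\<And>x. \<pi> x = x \<Longrightarrow> f (g x) = x"
    by (rule isometries_subspaces[OF subspace_UNIV sub]) auto
  define a where "a = g v0"
  have fa: "f a = v0" using g(2)[OF v0(1)] by (simp add: a_def)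
  then have a0: "a \<noteq> 0" using v0(2) linear_0[OF f(1)] by auto
  obtain R :: "real^('k option) \<Rightarrow> real^('k option)" where R: "orthogonal_transformation R" "R (norm a *\<^sub>R axis None 1) = a"
    by (rule orthogonal_transformation_exists[of "norm a *\<^sub>R axis None 1" a]) (simp add: norm_axis_1)
  define J where "J x = f (R (norm a *\<^sub>R x))" for x
  have Rl: "linear R" using R(1) by (simp add: orthogonal_transformation_def)
  have "linear J"
    unfolding J_def using linear_compose[OF linear_compose[OF linear_scale_self Rl] f(1), of "norm a"] by (simp add: o_def)
  moreover have "inj J"
  proof (rule injI)
    fix x y assume "J x = J y"
    then have "R (norm a *\<^sub>R x) = R (norm a *\<^sub>R y)" using f(3) unfolding J_def by metis
    then have "norm a *\<^sub>R x = norm a *\<^sub>R y" using orthogonal_transformation_inj[OF R(1)] by (simp add: inj_eq)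
    then show "x = y" using a0 by simp
  qed
  moreover have "\<pi> (J x) = J x" for x unfolding J_def using f(2) by auto
  moreover have "J (axis None 1) = v0" unfolding J_def R(2) by (rule fa)
  moreover have "v \<in> range J" if "\<pi> v = v" for v
  proof -
    obtain y where "R y = g v" using orthogonal_transformation_surj[OF R(1)] by (metis surjD)
    then have "J ((1 / norm a) *\<^sub>R y) = v" using a0 g(2)[OF that] by (simp add: J_def)
    then show ?thesis by blast
  qed
  ultimately show ?thesis by (rule that)
qed

lemma disjoint_injections:
  assumes "CARD('a::finite) + CARD('b::finite) = CARD('c::finite)"
  obtains \<sigma> :: "'a::finite \<Rightarrow> 'c::finite" and \<tau> :: "'b::finite \<Rightarrow> 'c" where "inj \<sigma>" "inj \<tau>" "range \<tau> = - range \<sigma>"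
proof -
  obtain \<sigma> :: "'a \<Rightarrow> 'c" where \<sigma>: "inj \<sigma>"
    using card_le_inj[of "UNIV :: 'a set" "UNIV :: 'c set"] assms by auto
  have "card (- range \<sigma>) = CARD('b)"
    using card_image[OF \<sigma>] assms by (simp add: Compl_eq_Diff_UNIV card_Diff_subset)
  then obtain \<tau> :: "'b \<Rightarrow> 'c" where "bij_betw \<tau> UNIV (- range \<sigma>)"
    using finite_same_card_bij[of "UNIV :: 'b set" "- range \<sigma>"] by auto
  then show ?thesis using that[OF \<sigma>, of \<tau>] by (simp add: bij_betw_def)
qed

section \<open>Gram determinants of the two factors\<close>

context split_potential
begin

text \<open>In a frame adapted to the splitting the Hessian is block diagonal, and its full
  determinant on F = 0 is given by the Monge-Ampere equation; c is the squared frame determinant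
  times c0.\<close>

lemma gram_product:
  fixes J2 :: "real^('k::finite option) \<Rightarrow> real^('n option)" and J3 :: "real^('l::finite option) \<Rightarrow> real^('n option)"
  assumes card: "CARD('k option) + CARD('l option) = CARD('n option)"
    and J: "\<And>a. \<pi> (J2 a) = J2 a" "\<And>a. \<pi> (J3 a) = 0"
  shows "\<exists>c. \<forall>z\<in>S. F z = 0 \<longrightarrow>
    det (\<chi> i j. - d2 F z (J2 (axis i 1)) (J2 (axis j 1))) * det (\<chi> i j. - d2 F z (J3 (axis i 1)) (J3 (axis j 1))) = c"
proof -
  obtain \<sigma> :: "'k option \<Rightarrow> 'n option" and \<tau> :: "'l option \<Rightarrow> 'n option" where st: "inj \<sigma>" "inj \<tau>" "range \<tau> = - range \<sigma>"
    by (rule disjoint_injections[OF card])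
  \<comment> \<open>The rows are the two frames, interleaved by the injections \<sigma> and
    \<tau>.\<close>
  define Z :: "real^('n option)^('n option)" where
    "Z = (\<chi> i. if i \<in> range \<sigma> then J2 (axis (inv \<sigma> i) 1) else J3 (axis (inv \<tau> i) 1))"
  have Z: "Z $ \<sigma> i = J2 (axis i 1)" "Z $ \<tau> j = J3 (axis j 1)" for i j
  proof -
    show "Z $ \<sigma> i = J2 (axis i 1)" by (simp add: Z_def inv_f_f[OF st(1)])
    have "\<tau> j \<notin> range \<sigma>" using st(3) by auto
    then show "Z $ \<tau> j = J3 (axis j 1)" by (simp add: Z_def inv_f_f[OF st(2)])
  qed
  have "det (\<chi> i j. - d2 F z (J2 (axis i 1)) (J2 (axis j 1))) * det (\<chi> i j. - d2 F z (J3 (axis i 1)) (J3 (axis j 1))) = (det Z)\<^sup>2 * c0"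
    if z: "z \<in> S" "F z = 0" for z
  proof -
    let ?G = "\<chi> i j. - d2 F z (Z $ i) (Z $ j)"
    have "det ?G = (det Z)\<^sup>2 * c0"
      unfolding MA[OF z, symmetric] by (rule det_gram) (intro linear_compose_neg d2_linear d2_linear1 z)+
    moreover have orthZ: "d2 F z (J2 a) (J3 b) = 0" for a b
      using orth[OF z(1), of "J2 a" "J3 b"] J by simp
    moreover have "det ?G = det (\<chi> i j. ?G $ \<sigma> i $ \<sigma> j) * det (\<chi> i j. ?G $ \<tau> i $ \<tau> j)"
      by (rule det_block[OF st]) (use orthZ d2_sym[OF z(1)] in \<open>simp_all add: Z\<close>)
    ultimately show ?thesis by (simp add: Z)
  qed
  then show ?thesis by blast
qed

lemma gram_depends:
  fixes J :: "real^('k::finite option) \<Rightarrow> real^('n option)"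
  assumes "\<And>a. \<pi> (J a) = J a" "z \<in> S" "z' \<in> S" "\<pi> z = \<pi> z'"
  shows "det (\<chi> i j. - d2 F z' (J (axis i 1)) (J (axis j 1))) = det (\<chi> i j. - d2 F z (J (axis i 1)) (J (axis j 1)))"
proof -
  have "d2 F z' (J a) (J b) = d2 F z (J a) (J b)" for a b
    using d2_pi_depends[OF assms(2-4), of "J a" "J b"] assms(1) by simp
  then show ?thesis by simp
qed

lemma gram_scale:
  fixes J :: "real^('k::finite option) \<Rightarrow> real^('n option)"
  assumes "\<And>a. \<pi> (J a) = J a" "z \<in> S" "s > 0" "s *\<^sub>R \<pi> z + (z - \<pi> z) \<in> S"
  shows "(s\<^sup>2) ^ CARD('k option) * det (\<chi> i j. - d2 F (s *\<^sub>R \<pi> z + (z - \<pi> z)) (J (axis i 1)) (J (axis j 1))) =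
    det (\<chi> i j. - d2 F z (J (axis i 1)) (J (axis j 1)))"
proof -
  let ?G = "\<chi> i j. - d2 F (s *\<^sub>R \<pi> z + (z - \<pi> z)) (J (axis i 1)) (J (axis j 1))"
  have "s\<^sup>2 * d2 F (s *\<^sub>R \<pi> z + (z - \<pi> z)) (J a) (J b) = d2 F z (J a) (J b)" for a b
    using d2_scale[OF assms(2-4), of "J a" "J b"] assms(1) by simp
  then have "(\<chi> i j. s\<^sup>2 * ?G $ i $ j) = (\<chi> i j. - d2 F z (J (axis i 1)) (J (axis j 1)))" by simp
  then show ?thesis using det_scale_matrix[of "s\<^sup>2" ?G] by metis
qed

lemma gram_positive:
  fixes J :: "real^('k::finite option) \<Rightarrow> real^('n option)"
  assumes "linear J" "inj J" "z \<in> S"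
  shows "det (\<chi> i j. - d2 F z (J (axis i 1)) (J (axis j 1))) > 0"
proof (rule det_gram_positive[OF assms(1,2), where G = "\<lambda>u v. - d2 F z u v"])
  show "linear (\<lambda>v. - d2 F z u v)" "linear (\<lambda>v. - d2 F z v u)" for u
    by (intro linear_compose_neg d2_linear d2_linear1 assms(3))+
  show "- d2 F z v v > 0" if "v \<noteq> 0" for v using neg[OF assms(3) that] by simp
qed

lemma pi_y0: "\<pi> y0 \<noteq> 0" "y0 - \<pi> y0 \<noteq> 0"
  using d1_pi[OF S(2)] k_pos linear_0[OF d1_linear[OF S(2)]] by (metis less_irrefl)+

text \<open>Comparing the two Gram determinants along the curve \<open>exp \<tau> \<pi> y0 + exp (- \<tau> k2 / k3) (y0 - \<pi> y0)\<close>,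
  on which \<open>F\<close> vanishes, determines the ratio of \<open>k2\<close> and \<open>k3\<close>.\<close>

lemma dimension_ratio:
  fixes J2 :: "real^('k::finite option) \<Rightarrow> real^('n option)" and J3 :: "real^('l::finite option) \<Rightarrow> real^('n option)"
  assumes card: "CARD('k option) + CARD('l option) = CARD('n option)"
    and J2: "linear J2" "inj J2" "\<And>a. \<pi> (J2 a) = J2 a"
    and J3: "linear J3" "inj J3" "\<And>a. \<pi> (J3 a) = 0"
  shows "real CARD('k option) * k3 = real CARD('l option) * k2"
proof -
  interpret sw: split_potential S F "\<lambda>v. v - \<pi> v" y0 k3 k2 c0 by (rule swap_potential)
  let ?a = "\<pi> y0" and ?b = "y0 - \<pi> y0"
  \<comment> \<open>With this rate the contributions k2 t and - k3 q t to F cancel along the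
    curve.\<close>
  define q where "q = k2 / k3"
  obtain c where c: "\<And>z. z \<in> S \<Longrightarrow> F z = 0 \<Longrightarrow>
    det (\<chi> i j. - d2 F z (J2 (axis i 1)) (J2 (axis j 1))) * det (\<chi> i j. - d2 F z (J3 (axis i 1)) (J3 (axis j 1))) = c"
    using gram_product[OF card, of J2 J3, OF J2(3) J3(3)] by blast
  have near: "\<forall>\<^sub>F t in nhds 0. exp (x * t) *\<^sub>R ?a + exp (y * t) *\<^sub>R ?b \<in> S" for x y :: real
  proof -
    let ?g = "\<lambda>t. exp (x * t) *\<^sub>R ?a + exp (y * t) *\<^sub>R ?b"
    have "isCont ?g 0" by (intro continuous_intros)
    then have "(?g \<longlongrightarrow> ?g 0) (nhds 0)"
      using tendsto_at_iff_tendsto_nhds[of ?g 0] by (simp only: isCont_def)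
    then have "(?g \<longlongrightarrow> y0) (nhds 0)" by simp
    then show ?thesis using topological_tendstoD[OF _ open_S S(2)] by blast
  qed
  \<comment> \<open>Besides the point of the curve, the two points with only one component scaled
    must lie in S: each determinant is scaled in its own component and then transported along a
    fibre.\<close>
  have "\<forall>\<^sub>F t in nhds 0. exp (1 * t) *\<^sub>R ?a + exp (- q * t) *\<^sub>R ?b \<in> S \<and> exp (1 * t) *\<^sub>R ?a + exp (0 * t) *\<^sub>R ?b \<in> S \<and>
      exp (0 * t) *\<^sub>R ?a + exp (- q * t) *\<^sub>R ?b \<in> S"
    by (intro eventually_conj near)
  then have "\<forall>\<^sub>F t in at_right 0. exp (1 * t) *\<^sub>R ?a + exp (- q * t) *\<^sub>R ?b \<in> S \<and> exp (1 * t) *\<^sub>R ?a + exp (0 * t) *\<^sub>R ?b \<in> S \<and>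
      exp (0 * t) *\<^sub>R ?a + exp (- q * t) *\<^sub>R ?b \<in> S"
    by (simp add: eventually_at_filter eventually_mono)
  then have "\<forall>\<^sub>F t in at_right 0. t > 0 \<and> exp t *\<^sub>R ?a + exp (- q * t) *\<^sub>R ?b \<in> S \<and> exp t *\<^sub>R ?a + ?b \<in> S \<and> ?a + exp (- q * t) *\<^sub>R ?b \<in> S"
    using eventually_at_right_less[of 0] by eventually_elim simp
  then obtain t :: real where t: "t > 0" and inS: "exp t *\<^sub>R ?a + exp (- q * t) *\<^sub>R ?b \<in> S" "exp t *\<^sub>R ?a + ?b \<in> S" "?a + exp (- q * t) *\<^sub>R ?b \<in> S"
    by (metis (mono_tags, lifting) eventually_happens trivial_limit_at_right_real)
  let ?z = "exp t *\<^sub>R ?a + exp (- q * t) *\<^sub>R ?b"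
  have pi_ab: "\<pi> ?a = ?a" "\<pi> ?b = 0" by (simp_all add: linear_diff[OF lin_pi] idem)
  have "F ?z = F (?a + ?b) + k2 * ln (exp t) + k3 * ln (exp (- q * t))"
    by (rule F_scale[OF pi_ab]) (use inS S(2) in simp_all)
  then have Fz: "F ?z = 0" using F0 k_pos by (simp add: q_def)
  let ?D2 = "\<lambda>z. det (\<chi> i j. - d2 F z (J2 (axis i 1)) (J2 (axis j 1)))" and ?D3 = "\<lambda>z. det (\<chi> i j. - d2 F z (J3 (axis i 1)) (J3 (axis j 1)))"
  note pi_simps = linear_add[OF lin_pi] linear_cmul[OF lin_pi] linear_diff[OF lin_pi] idem
  have "?D2 ?z = ?D2 (exp t *\<^sub>R ?a + ?b)"
    by (rule gram_depends[OF J2(3) inS(2,1)]) (simp add: pi_simps)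
  moreover have "((exp t)\<^sup>2) ^ CARD('k option) * ?D2 (exp t *\<^sub>R ?a + ?b) = ?D2 y0"
    by (rule gram_scale[OF J2(3) S(2)]) (use inS in simp_all)
  ultimately have A: "((exp t)\<^sup>2) ^ CARD('k option) * ?D2 ?z = ?D2 y0" by (simp only:)
  have "?D3 ?z = ?D3 (?a + exp (- q * t) *\<^sub>R ?b)"
    by (rule sw.gram_depends[OF _ inS(3,1)]) (simp_all add: J3(3) pi_simps)
  moreover have "((exp (- q * t))\<^sup>2) ^ CARD('l option) * ?D3 (exp (- q * t) *\<^sub>R ?b + (y0 - ?b)) = ?D3 y0"
    by (rule sw.gram_scale[OF _ S(2)]) (use inS in \<open>simp_all add: J3(3) add.commute\<close>)
  moreover have "exp (- q * t) *\<^sub>R ?b + (y0 - ?b) = ?a + exp (- q * t) *\<^sub>R ?b" by simp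
  ultimately have B: "((exp (- q * t))\<^sup>2) ^ CARD('l option) * ?D3 ?z = ?D3 y0" by (simp only:)
  have gen: "a * b * (c * d) = (a * c) * (b * d)" for a b c d :: real by (simp add: mult_ac)
  have "((exp t)\<^sup>2) ^ CARD('k option) * ((exp (- q * t))\<^sup>2) ^ CARD('l option) * (?D2 ?z * ?D3 ?z) =
      (((exp t)\<^sup>2) ^ CARD('k option) * ?D2 ?z) * (((exp (- q * t))\<^sup>2) ^ CARD('l option) * ?D3 ?z)"
    by (rule gen)
  then have "((exp t)\<^sup>2) ^ CARD('k option) * ((exp (- q * t))\<^sup>2) ^ CARD('l option) * (?D2 ?z * ?D3 ?z) = ?D2 y0 * ?D3 y0"
    unfolding A B .
  then have "((exp t)\<^sup>2) ^ CARD('k option) * ((exp (- q * t))\<^sup>2) ^ CARD('l option) * (?D2 y0 * ?D3 y0) = ?D2 y0 * ?D3 y0"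
    using c[OF inS(1) Fz] c[OF S(2) F0] by simp
  moreover have "?D2 y0 * ?D3 y0 > 0"
    by (intro mult_pos_pos gram_positive J2 J3 S)
  moreover have cancel: "a * c = c \<Longrightarrow> c > 0 \<Longrightarrow> a = 1" for a c :: real by simp
  ultimately have "((exp t)\<^sup>2) ^ CARD('k option) * ((exp (- q * t))\<^sup>2) ^ CARD('l option) = 1" by (intro cancel)
  moreover have "((exp x)\<^sup>2) ^ m = exp (2 * real m * x)" for x :: real and m :: nat
    by (simp add: exp_of_nat_mult exp_double mult.assoc flip: power_mult) (simp add: exp_double exp_of_nat_mult mult_ac power_mult)
  \<comment> \<open>The product of the determinants is the same positive constant at both ends, so
    the two scaling factors multiply to 1; since t > 0, the exponent gives the ratio.\<close>
  ultimately have "exp (2 * real CARD('k option) * t + 2 * real CARD('l option) * (- q * t)) = 1"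
    by (simp only: exp_add)
  then have "2 * t * (real CARD('k option) - real CARD('l option) * q) = 0"
    by (simp only: exp_eq_one_iff) (simp add: algebra_simps)
  then have "real CARD('k option) = real CARD('l option) * q" using t by simp
  then show ?thesis using k_pos by (simp add: q_def field_simps)
qed

text \<open>The determinant of the other factor is fixed when its component is fixed, so constancy
  of the product makes the determinant of this factor constant on the slice. It remains to rescale
  the frame until the constant is the prescribed one.\<close>

lemma factor_frame:
  fixes J2 :: "real^('k::finite option) \<Rightarrow> real^('n option)" and J3 :: "real^('l::finite option) \<Rightarrow> real^('n option)"
  assumes card: "CARD('k option) + CARD('l option) = CARD('n option)"
    and J2: "linear J2" "inj J2" "\<And>a. \<pi> (J2 a) = J2 a" "J2 (axis None 1) = \<pi> y0"
    and J3: "linear J3" "inj J3" "\<And>a. \<pi> (J3 a) = 0"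
  obtains J where "split_factor S F \<pi> y0 k2 k3 c0 (J :: real^('k option) \<Rightarrow> real^('n option))"
proof -
  interpret sw: split_potential S F "\<lambda>v. v - \<pi> v" y0 k3 k2 c0 by (rule swap_potential)
  obtain c where c: "\<And>z. z \<in> S \<Longrightarrow> F z = 0 \<Longrightarrow>
    det (\<chi> i j. - d2 F z (J2 (axis i 1)) (J2 (axis j 1))) * det (\<chi> i j. - d2 F z (J3 (axis i 1)) (J3 (axis j 1))) = c"
    using gram_product[OF card, of J2 J3, OF J2(3) J3(3)] by blast
  let ?D2 = "\<lambda>z. det (\<chi> i j. - d2 F z (J2 (axis i 1)) (J2 (axis j 1)))" and ?D3 = "\<lambda>z. det (\<chi> i j. - d2 F z (J3 (axis i 1)) (J3 (axis j 1)))"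
  \<comment> \<open>Only the k directions other than \<open>None\<close> are rescaled, since
    \<open>None\<close> must keep mapping to \<pi> y0; the Gram determinant then changes by the
    power 2 k of s.\<close>
  define s where "s = root (2 * CARD('k)) (k2 ^ (CARD('k) + 1) / ?D2 y0)"
  have pos: "?D2 y0 > 0" "?D3 y0 > 0" by (intro gram_positive J2 J3 S)+
  have s: "s > 0" unfolding s_def using pos k_pos by (intro real_root_gt_zero divide_pos_pos) auto
  have sk: "s ^ (2 * CARD('k)) * ?D2 y0 = k2 ^ (CARD('k) + 1)"
    unfolding s_def using pos k_pos by (subst real_root_pow_pos2) auto
  define J where "J a = J2 (vcons (a $ None) (s *\<^sub>R vtl a))" for a
  define d where "d i = (case i of None \<Rightarrow> 1 | Some _ \<Rightarrow> s)" for i :: "'k option"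
  have "linear (\<lambda>a :: real^('k option). vcons (a $ None) (s *\<^sub>R vtl a))"
    by (rule linearI) (simp_all add: vec_eq_iff vcons_def vtl_def distrib_left split: option.split)
  then have lin: "linear J" unfolding J_def using linear_compose[OF _ J2(1)] by (simp add: o_def)
  have inj: "inj J"
  proof (rule injI)
    fix x y assume "J x = J y"
    then have "vcons (x $ None) (s *\<^sub>R vtl x) = vcons (y $ None) (s *\<^sub>R vtl y)"
      unfolding J_def using J2(2) by (simp add: inj_eq)
    then have "x $ None = y $ None" "s *\<^sub>R vtl x = s *\<^sub>R vtl y" by (metis vcons_simps(1), metis vcons_simps(3))
    then show "x = y" using s by (metis real_vector.scale_cancel_left order_less_irrefl vcons_vtl)
  qed
  have ax: "J (axis i 1) = d i *\<^sub>R J2 (axis i 1)" for i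
  proof -
    have "vcons ((axis i 1 :: real^('k option)) $ None) (s *\<^sub>R vtl (axis i 1)) = d i *\<^sub>R axis i 1"
      by (cases i) (auto simp: vec_eq_iff vcons_def vtl_def axis_def d_def split: option.split)
    then show ?thesis by (simp add: J_def linear_cmul[OF J2(1)])
  qed
  have gram: "det (\<chi> i j. - d2 F z (J (axis i 1)) (J (axis j 1))) = s ^ (2 * CARD('k)) * ?D2 z" if z: "z \<in> S" for z
  proof -
    let ?E = "(\<chi> i j. if i = j then d i else 0) :: real^('k option)^('k option)"
    have "(\<chi> i j. - d2 F z (J (axis i 1)) (J (axis j 1))) = ?E ** ((\<chi> i j. - d2 F z (J2 (axis i 1)) (J2 (axis j 1))) ** ?E)"
      unfolding ax linear_cmul[OF d2_linear[OF z]] linear_cmul[OF d2_linear1[OF z]]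
      by (simp add: vec_eq_iff matrix_matrix_mult_def if_distrib[where f = "\<lambda>x. x * _"] if_distrib[where f = "\<lambda>x. _ * x"] mult_ac sum_negf cong: if_cong)
    moreover have "det ?E = s ^ CARD('k)"
    proof -
      have "det ?E = (\<Prod>i\<in>UNIV. d i)" by (subst det_diagonal) auto
      also have "\<dots> = s ^ CARD('k)"
        unfolding UNIV_option_conv by (simp add: d_def prod.reindex)
      finally show ?thesis .
    qed
    ultimately show ?thesis by (simp add: det_mul mult_ac power_mult power2_eq_square power_mult_distrib)
  qed
  have "split_factor S F \<pi> y0 k2 k3 c0 J"
  proof (rule split_factor.intro[OF split_potential_axioms split_factor_axioms.intro])
    show "linear J" "inj J" by (fact lin inj)+
    show "\<pi> (J a) = J a" for a by (simp add: J_def J2(3))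
    show "J (axis None 1) = \<pi> y0" unfolding ax J2(4) by (simp add: d_def)
    show "det (\<chi> i j. - d2 F z (J (axis i 1)) (J (axis j 1))) = k2 ^ (CARD('k) + 1)"
      if z: "z \<in> S" "F z = 0" "z - \<pi> z = y0 - \<pi> y0" for z
    proof -
      have "?D3 z = ?D3 y0"
        by (rule sw.gram_depends[OF _ S(2) z(1)]) (simp_all add: J3(3) z(3))
      then have "?D2 z * ?D3 y0 = ?D2 y0 * ?D3 y0" using c[OF z(1,2)] c[OF S(2) F0] by simp
      then have "?D2 z = ?D2 y0" using pos(2) mult_right_cancel[of "?D3 y0"] by (metis less_irrefl)
      then show ?thesis using gram[OF z(1)] sk by simp
    qed
  qed
  then show ?thesis by (rule that)
qed

end

lemma vcons_1_0: "vcons 1 0 = (axis None 1 :: real^('i::finite option))"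
  by (simp add: vec_eq_iff vcons_def axis_def split: option.split)

lemma vcons_normalize: "v $ None > 0 \<Longrightarrow> (v $ None) *\<^sub>R vcons 1 ((1 / v $ None) *\<^sub>R vtl v) = v"
  by (simp add: vec_eq_iff vcons_def vtl_def split: option.split)

section \<open>Calabi parametrisation of the zero level\<close>

context split_potential
begin

text \<open>The ambient map \<open>coord\<close> inverts the parametrisation only on F = 0, but it
  is smooth on an open set R; composing it with the immersion later yields smooth coordinates on the
  hypersurface.\<close>

theorem local_product:
  assumes card: "CARD('k::finite option) + CARD('l::finite option) = CARD('n option)"
    and dims: "dim {v. \<pi> v = v} = CARD('k option)" "dim {v. \<pi> v = 0} = CARD('l option)"
  obtains I :: "real set" and B1 :: "(real^'k) set" and B2 :: "(real^'l) set"
    and \<psi>1 :: "real^'k \<Rightarrow> real^('k option)" and \<psi>2 :: "real^'l \<Rightarrow> real^('l option)" and h1 h2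
    and L :: "(real^('k option)) \<times> (real^('l option)) \<Rightarrow> real^('n option)" and R coord
  where "open I" "is_interval I" "open B1" "open B2"
    "hyperbolic_affine_hypersphere (open_manifold B1) \<psi>1 \<psi>1 h1 (- 1)" "center_at (open_manifold B1) \<psi>1 \<psi>1 0"
    "hyperbolic_affine_hypersphere (open_manifold B2) \<psi>2 \<psi>2 h2 (- 1)" "center_at (open_manifold B2) \<psi>2 \<psi>2 0"
    "linear L" "bij L" "smooth_on (I \<times> B1 \<times> B2) (\<lambda>z. L (calabi_product 1 1 \<psi>1 \<psi>2 z))"
    "open R" "R \<subseteq> S" "y0 \<in> R" "smooth_on R coord"
    "\<And>z. z \<in> I \<times> B1 \<times> B2 \<Longrightarrow> L (calabi_product 1 1 \<psi>1 \<psi>2 z) \<in> R \<and> F (L (calabi_product 1 1 \<psi>1 \<psi>2 z)) = 0 \<and>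
      coord (L (calabi_product 1 1 \<psi>1 \<psi>2 z)) = z"
    "\<And>y. y \<in> R \<Longrightarrow> F y = 0 \<Longrightarrow> coord y \<in> I \<times> B1 \<times> B2 \<and> L (calabi_product 1 1 \<psi>1 \<psi>2 (coord y)) = y"
proof -
  interpret sw: split_potential S F "\<lambda>v. v - \<pi> v" y0 k3 k2 c0 by (rule swap_potential)
  have dim3: "dim {v. v - \<pi> v = v} = CARD('l option)"
    using dims(2) by simp
  have card': "CARD('l option) + CARD('k option) = CARD('n option)" using card by simp
  obtain J2' :: "real^('k option) \<Rightarrow> real^('n option)" where J2': "linear J2'" "inj J2'" "\<And>a. \<pi> (J2' a) = J2' a" "J2' (axis None 1) = \<pi> y0"
    by (rule frame_exists[OF lin_pi dims(1) idem pi_y0(1)]) blast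
  obtain J3' :: "real^('l option) \<Rightarrow> real^('n option)" where J3': "linear J3'" "inj J3'" "\<And>a. J3' a - \<pi> (J3' a) = J3' a" "J3' (axis None 1) = y0 - \<pi> y0"
    by (rule frame_exists[OF sw.lin_pi dim3 sw.idem pi_y0(2)]) blast
  have ker: "\<pi> (J3' a) = 0" for a using J3'(3)[of a] by simp
  obtain J2 :: "real^('k option) \<Rightarrow> real^('n option)" where J2: "split_factor S F \<pi> y0 k2 k3 c0 J2"
    by (rule factor_frame[OF card J2' J3'(1,2) ker])
  have ker2: "J2' a - \<pi> (J2' a) = 0" for a using J2'(3)[of a] by simp
  obtain J3 :: "real^('l option) \<Rightarrow> real^('n option)" where J3: "split_factor S F (\<lambda>v. v - \<pi> v) y0 k3 k2 c0 J3"
    by (rule sw.factor_frame[OF card' J3' J2'(1,2) ker2])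
  interpret A: split_factor S F \<pi> y0 k2 k3 c0 J2 by (rule J2)
  interpret B: split_factor S F "\<lambda>v. v - \<pi> v" y0 k3 k2 c0 J3 by (rule J3)
  interpret fA: factor_potential A.S\<^sub>J A.P k2 A.dom by (rule A.factor[OF A.open_dom order_refl])
  interpret fB: factor_potential B.S\<^sub>J B.P k3 B.dom by (rule B.factor[OF B.open_dom order_refl])
  have ratio: "real CARD('k option) * k3 = real CARD('l option) * k2"
    by (rule dimension_ratio[OF card J2'(1-3) J3'(1,2) ker])
  \<comment> \<open>\<mu> and - \<nu> are the exponents of the Calabi product.\<close>
  define \<mu> where "\<mu> = sqrt (real CARD('l) + 1) / sqrt (real CARD('k) + 1)"
  define \<nu> where "\<nu> = sqrt (real CARD('k) + 1) / sqrt (real CARD('l) + 1)"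
  have \<mu>: "\<mu> > 0" by (simp add: \<mu>_def)
  \<comment> \<open>This is \<open>dimension_ratio\<close> rewritten; it makes F constant in the
    parameter t.\<close>
  have k\<mu>: "k2 * \<mu> = k3 * \<nu>"
  proof -
    define a b where "a = sqrt (real CARD('k) + 1)" and "b = sqrt (real CARD('l) + 1)"
    have ab: "a > 0" "b > 0" "a * a = real CARD('k) + 1" "b * b = real CARD('l) + 1" by (simp_all add: a_def b_def)
    have "a * a * k3 = b * b * k2" using ratio unfolding ab by (simp add: add.commute)
    then show ?thesis using ab(1,2) unfolding \<mu>_def \<nu>_def a_def[symmetric] b_def[symmetric] by (simp add: field_simps)
  qed
  have J3_ker: "\<pi> (J3 b) = 0" for b using B.J_pi[of b] by simp
  define L where "L ab = J2 (fst ab) + J3 (snd ab)" for ab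
  have lin_L: "linear L"
    unfolding L_def using A.J_linear B.J_linear by (intro linear_compose_add linear_compose[OF linear_fst, unfolded o_def] linear_compose[OF linear_snd, unfolded o_def])
  have inj_L: "inj L"
  proof (subst linear_injective_0[OF lin_L], intro allI impI)
    fix ab assume "L ab = 0"
    then have sum: "J2 (fst ab) + J3 (snd ab) = 0" by (simp add: L_def)
    then have "\<pi> (J2 (fst ab) + J3 (snd ab)) = 0" using linear_0[OF lin_pi] by simp
    then have "J2 (fst ab) = 0" by (simp add: linear_add[OF lin_pi] A.J_pi J3_ker)
    moreover from this sum have "J3 (snd ab) = 0" by simp
    ultimately have "fst ab = 0" "snd ab = 0"
      using A.J_inj B.J_inj linear_injective_0[OF A.J_linear] linear_injective_0[OF B.J_linear] by blast+
    then show "ab = 0" by (simp add: prod_eq_iff)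
  qed
  have bij_L: "bij L"
  proof -
    have "dim (range L) = dim (UNIV :: ((real^('k option)) \<times> (real^('l option))) set)"
      by (rule dim_image_eq[OF lin_L]) (use inj_L in simp)
    then have "dim (range L) = DIM(real^('n option))" using card by simp
    then have "span (range L) = UNIV" using dim_eq_full[of "range L"] by simp
    then have "range L = UNIV"
      using linear_subspace_image[OF lin_L subspace_UNIV] span_eq_iff[of "range L"] by (metis (no_types))
    then show ?thesis using inj_L by (simp add: bij_def)
  qed
  define g where "g = inv L"
  have gL: "g (L ab) = ab" and Lg: "L (g y) = y" for ab y
    unfolding g_def using bij_L by (simp_all add: bij_is_inj bij_is_surj surj_f_inv_f)
  have lin_g: "linear g"
  proof (rule linearI)
    show "g (x + y) = g x + g y" for x y
      using gL[of "g x + g y"] linear_add[OF lin_L, of "g x" "g y"] Lg by simp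
    show "g (r *\<^sub>R x) = r *\<^sub>R g x" for r x
      using gL[of "r *\<^sub>R g x"] linear_cmul[OF lin_L, of r "g x"] Lg by simp
  qed
  let ?\<Phi> = "\<lambda>z. L (calabi_product 1 1 fA.\<psi> fB.\<psi> z)"
  have \<Phi>: "?\<Phi> (t, p, q) = J2 (exp (\<mu> * t) *\<^sub>R fA.\<psi> p) + J3 (exp (- \<nu> * t) *\<^sub>R fB.\<psi> q)" for t p q
    by (simp add: calabi_product_def L_def \<mu>_def \<nu>_def)
  let ?U = "UNIV \<times> A.dom \<times> B.dom :: (real \<times> (real^'k) \<times> (real^'l)) set"
  have U: "open ?U" by (intro open_Times open_UNIV A.open_dom B.open_dom)
  have smooth_\<Phi>: "smooth_on ?U ?\<Phi>"
  proof -
    have 1: "smooth_on ?U (\<lambda>z. fA.\<psi> (fst (snd z)))"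
      by (rule smooth_on_compose[OF fA.smooth_\<psi> _ U A.open_dom]) (auto intro!: smooth_intros U)
    have 2: "smooth_on ?U (\<lambda>z. fB.\<psi> (snd (snd z)))"
      by (rule smooth_on_compose[OF fB.smooth_\<psi> _ U B.open_dom]) (auto intro!: smooth_intros U)
    have "smooth_on ?U (\<lambda>z. J2 (exp (\<mu> * fst z) *\<^sub>R fA.\<psi> (fst (snd z))) + J3 (exp (- \<nu> * fst z) *\<^sub>R fB.\<psi> (snd (snd z))))"
      by (intro smooth_on_add[OF U] smooth_on_linear_compose[OF A.J_linear U] smooth_on_linear_compose[OF B.J_linear U]
          smooth_on_scaleR[OF U] smooth_on_exp[OF U] smooth_on_mult[OF U] smooth_on_const smooth_on_fst[OF U] smooth_on_id 1 2)
    moreover have "?\<Phi> = (\<lambda>z. J2 (exp (\<mu> * fst z) *\<^sub>R fA.\<psi> (fst (snd z))) + J3 (exp (- \<nu> * fst z) *\<^sub>R fB.\<psi> (snd (snd z))))"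
      using \<Phi> by (auto simp: fun_eq_iff)
    ultimately show ?thesis by simp
  qed
  have \<Phi>0: "?\<Phi> (0, 0, 0) = y0"
  proof -
    have "fA.\<psi> 0 = axis None 1" "fB.\<psi> 0 = axis None 1"
      using A.base_in(2) B.base_in(2) by (simp_all add: vcons_1_0[symmetric] fA.\<psi>_def fA.\<rho>_def fB.\<psi>_def fB.\<rho>_def)
    then show ?thesis by (simp add: \<Phi> A.J_base B.J_base)
  qed
  have "open (?U \<inter> ?\<Phi> -` S)"
    by (intro continuous_open_preimage smooth_on_continuous smooth_\<Phi> U open_S)
  moreover have "(0, 0, 0) \<in> ?U \<inter> ?\<Phi> -` S"
    using \<Phi>0 S(2) A.zero_dom B.zero_dom by simp
  ultimately obtain I' BB where I': "open I'" "open BB" "(0, 0, 0) \<in> I' \<times> BB" "I' \<times> BB \<subseteq> ?U \<inter> ?\<Phi> -` S"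
    by (rule open_prod_elim)
  then have "(0, 0) \<in> BB" by simp
  with I'(2) obtain B1 B2 where B12': "open B1" "open B2" "(0, 0) \<in> B1 \<times> B2" "B1 \<times> B2 \<subseteq> BB"
    by (rule open_prod_elim)
  have IB: "open I'" "0 \<in> I'" using I' by simp_all
  have B12: "open B1" "open B2" "0 \<in> B1" "0 \<in> B2" using B12' by simp_all
  obtain \<epsilon> where \<epsilon>: "\<epsilon> > 0" "ball 0 \<epsilon> \<subseteq> I'" using IB open_contains_ball by blast
  define I :: "real set" where "I = ball 0 \<epsilon>"
  have I: "open I" "is_interval I" "0 \<in> I" "I \<subseteq> I'"
    using \<epsilon> by (simp_all add: I_def is_interval_ball_real)
  have sub: "I \<times> B1 \<times> B2 \<subseteq> ?U \<inter> ?\<Phi> -` S"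
  proof (rule order_trans[OF _ I'(4)])
    show "I \<times> B1 \<times> B2 \<subseteq> I' \<times> BB" by (rule Sigma_mono[OF I(4)]) (rule B12'(4))
  qed
  have box: "p \<in> A.dom" "q \<in> B.dom" "?\<Phi> (t, p, q) \<in> S" if "t \<in> I" "p \<in> B1" "q \<in> B2" for t p q
    using subsetD[OF sub, of "(t, p, q)"] that by auto
  have B1: "B1 \<subseteq> A.dom" and B2: "B2 \<subseteq> B.dom" using box I(3) B12(3,4) by blast+
  interpret f1: factor_potential A.S\<^sub>J A.P k2 B1 by (rule A.factor[OF B12(1) B1])
  interpret f2: factor_potential B.S\<^sub>J B.P k3 B2 by (rule B.factor[OF B12(2) B2])
  have F\<Phi>: "F (?\<Phi> (t, p, q)) = 0" if z: "t \<in> I" "p \<in> B1" "q \<in> B2" for t p q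
  proof -
    have base: "J2 (fA.\<psi> p) + J3 (fB.\<psi> q) \<in> S" using box(3)[OF I(3) z(2,3)] by (simp add: \<Phi>)
    have e1: "F (exp (\<mu> * t) *\<^sub>R J2 (fA.\<psi> p) + exp (- \<nu> * t) *\<^sub>R J3 (fB.\<psi> q)) =
        F (J2 (fA.\<psi> p) + J3 (fB.\<psi> q)) + k2 * ln (exp (\<mu> * t)) + k3 * ln (exp (- \<nu> * t))"
      by (rule F_scale[OF A.J_pi J3_ker]) (use base box(3)[OF z] in \<open>simp_all add: \<Phi> linear_cmul[OF A.J_linear] linear_cmul[OF B.J_linear]\<close>)
    have e2: "F (J2 (fA.\<psi> p) + J3 (fB.\<psi> q)) = F (J2 (fA.\<psi> p) + (y0 - \<pi> y0)) + F (\<pi> y0 + J3 (fB.\<psi> q))"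
      by (rule F_additive[OF A.J_pi J3_ker base])
        (use fA.\<psi>_S[OF box(1)[OF z]] fB.\<psi>_S[OF box(2)[OF z]] in \<open>simp_all add: A.S\<^sub>J_def A.emb_def B.S\<^sub>J_def B.emb_def add.commute\<close>)
    have e3: "F (J2 (fA.\<psi> p) + (y0 - \<pi> y0)) = 0"
      using fA.P_\<psi>[OF box(1)[OF z]] by (simp add: A.P_def A.emb_def)
    have e4: "F (\<pi> y0 + J3 (fB.\<psi> q)) = 0"
      using fB.P_\<psi>[OF box(2)[OF z]] by (simp add: B.P_def B.emb_def add.commute)
    have "k2 * (\<mu> * t) = k3 * (\<nu> * t)" using k\<mu> by (metis mult.assoc)
    then have "F (exp (\<mu> * t) *\<^sub>R J2 (fA.\<psi> p) + exp (- \<nu> * t) *\<^sub>R J3 (fB.\<psi> q)) = 0"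
      unfolding e1 e2 e3 e4 by simp
    then show ?thesis by (simp add: \<Phi> linear_cmul[OF A.J_linear] linear_cmul[OF B.J_linear])
  qed
  define \<alpha> where "\<alpha> y = fst (g y)" for y
  define \<beta> where "\<beta> y = snd (g y)" for y
  define p where "p y = (1 / \<alpha> y $ None) *\<^sub>R vtl (\<alpha> y)" for y
  define q where "q y = (1 / \<beta> y $ None) *\<^sub>R vtl (\<beta> y)" for y
  \<comment> \<open>Inverse formulas: p and q are the projectivised components, and t comes from the
    first component alone, whose \<open>None\<close> entry is \<open>exp (\<mu> * t)\<close> times
    \<rho>.\<close>
  define coord where "coord y = (ln (\<alpha> y $ None / fA.\<rho> (p y)) / \<mu>, p y, q y)" for y
  \<comment> \<open>Positivity of both \<open>None\<close> entries makes the divisions and the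
    logarithm smooth.\<close>
  define S1 where "S1 = S \<inter> {y. \<alpha> y $ None > 0} \<inter> {y. \<beta> y $ None > 0}"
  have lin_\<alpha>\<beta>: "linear \<alpha>" "linear \<beta>"
    unfolding \<alpha>_def \<beta>_def using linear_compose[OF lin_g linear_fst] linear_compose[OF lin_g linear_snd] by (simp_all add: o_def)
  have cont: "continuous_on UNIV \<alpha>" "continuous_on UNIV \<beta>"
    using lin_\<alpha>\<beta> by (simp_all add: linear_continuous_on linear_conv_bounded_linear)
  have open_S1: "open S1"
    unfolding S1_def by (intro open_Int open_S open_Collect_less continuous_intros continuous_on_subset[OF cont(1)] continuous_on_subset[OF cont(2)] subset_UNIV)
  have sm\<alpha>: "smooth_on S1 \<alpha>" "smooth_on S1 \<beta>"
    by (intro smooth_on_linear_compose[OF lin_\<alpha>\<beta>(1) open_S1 smooth_on_id] smooth_on_linear_compose[OF lin_\<alpha>\<beta>(2) open_S1 smooth_on_id])+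
  have smp: "smooth_on S1 p" "smooth_on S1 q"
    unfolding p_def q_def
    by (intro smooth_on_scaleR[OF open_S1] smooth_on_divide[OF open_S1] smooth_on_const smooth_on_nth[OF open_S1] smooth_vtl[OF open_S1] sm\<alpha>;
        simp add: S1_def)+
  define S2 where "S2 = S1 \<inter> p -` A.dom"
  have open_S2: "open S2" unfolding S2_def by (intro continuous_open_preimage smooth_on_continuous smp open_S1 A.open_dom)
  have S21: "S2 \<subseteq> S1" by (simp add: S2_def)
  have smcoord: "smooth_on S2 coord"
  proof -
    have "smooth_on S2 (\<lambda>y. fA.\<rho> (p y))"
      by (rule smooth_on_compose[OF fA.smooth_\<rho> smooth_on_subset[OF smp(1) S21] open_S2 A.open_dom]) (simp add: S2_def)
    then have "smooth_on S2 (\<lambda>y. ln (\<alpha> y $ None / fA.\<rho> (p y)) / \<mu>)"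
      using \<mu> fA.\<rho>_pos S21
      by (intro smooth_on_divide[OF open_S2] smooth_on_ln[OF open_S2] smooth_on_const smooth_on_nth[OF open_S2] smooth_on_subset[OF sm\<alpha>(1) S21])
        (auto simp: S1_def less_imp_neq[THEN not_sym] intro!: divide_pos_pos)
    then show ?thesis unfolding coord_def
      by (intro smooth_on_Pair[OF open_S2] smooth_on_subset[OF smp(1) S21] smooth_on_subset[OF smp(2) S21])
  qed
  define R where "R = S2 \<inter> coord -` (I \<times> B1 \<times> B2)"
  have open_R: "open R"
    unfolding R_def by (intro continuous_open_preimage smooth_on_continuous smcoord open_S2 open_Times I B12)
  have coord_\<Phi>: "?\<Phi> (t, x, y) \<in> R \<and> coord (?\<Phi> (t, x, y)) = (t, x, y)" if z: "t \<in> I" "x \<in> B1" "y \<in> B2" for t x y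
  proof -
    have "g (?\<Phi> (t, x, y)) = (exp (\<mu> * t) *\<^sub>R fA.\<psi> x, exp (- \<nu> * t) *\<^sub>R fB.\<psi> y)"
      unfolding gL by (simp add: calabi_product_def \<mu>_def \<nu>_def)
    then have ab: "\<alpha> (?\<Phi> (t, x, y)) = (exp (\<mu> * t) * fA.\<rho> x) *\<^sub>R vcons 1 x" "\<beta> (?\<Phi> (t, x, y)) = (exp (- \<nu> * t) * fB.\<rho> y) *\<^sub>R vcons 1 y"
      by (simp_all add: \<alpha>_def \<beta>_def fA.\<psi>_def fB.\<psi>_def)
    have nz: "fA.\<rho> x \<noteq> 0" "fB.\<rho> y \<noteq> 0" using fA.\<rho>_pos[of x] fB.\<rho>_pos[of y] by simp_all
    have pq: "p (?\<Phi> (t, x, y)) = x" "q (?\<Phi> (t, x, y)) = y"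
      unfolding p_def q_def ab using nz by (simp_all add: linear_cmul[OF linear_vtl])
    have c: "coord (?\<Phi> (t, x, y)) = (t, x, y)"
      unfolding coord_def pq ab using nz \<mu> by simp
    moreover have "?\<Phi> (t, x, y) \<in> S2"
      unfolding S2_def S1_def using pq ab fA.\<rho>_pos[of x] fB.\<rho>_pos[of y] box[OF z] by simp
    ultimately show ?thesis using z by (simp add: R_def)
  qed
  have \<Phi>_coord: "coord y \<in> I \<times> B1 \<times> B2 \<and> ?\<Phi> (coord y) = y" if y: "y \<in> R" "F y = 0" for y
  proof -
    define t where "t = ln (\<alpha> y $ None / fA.\<rho> (p y)) / \<mu>"
    have c: "coord y = (t, p y, q y)" by (simp add: coord_def t_def)
    have z: "t \<in> I" "p y \<in> B1" "q y \<in> B2" and yS: "y \<in> S" and pos: "\<alpha> y $ None > 0" "\<beta> y $ None > 0"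
      using y(1) c unfolding R_def S2_def S1_def by auto
    have rp: "fA.\<rho> (p y) > 0" "fB.\<rho> (q y) > 0" by (rule fA.\<rho>_pos, rule fB.\<rho>_pos)
    have "exp (\<mu> * t) = \<alpha> y $ None / fA.\<rho> (p y)" using \<mu> pos rp by (simp add: t_def)
    then have a: "exp (\<mu> * t) *\<^sub>R fA.\<psi> (p y) = \<alpha> y"
      using rp vcons_normalize[OF pos(1)] by (simp add: fA.\<psi>_def p_def[symmetric])
    \<comment> \<open>The second component is recovered only up to this factor. Both y and its
      reconstruction have F = 0, so \<open>F_scale\<close> gives k3 ln \<tau> = 0.\<close>
    define \<tau> where "\<tau> = exp (- \<nu> * t) * fB.\<rho> (q y) / \<beta> y $ None"
    have \<tau>: "\<tau> > 0" using rp pos by (simp add: \<tau>_def)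
    have "\<tau> *\<^sub>R \<beta> y = \<tau> *\<^sub>R ((\<beta> y $ None) *\<^sub>R vcons 1 (q y))"
      using vcons_normalize[OF pos(2)] by (simp add: q_def)
    also have "\<dots> = exp (- \<nu> * t) *\<^sub>R fB.\<psi> (q y)" using pos by (simp add: \<tau>_def fB.\<psi>_def)
    finally have b: "exp (- \<nu> * t) *\<^sub>R fB.\<psi> (q y) = \<tau> *\<^sub>R \<beta> y" by simp
    have y_eq: "y = J2 (\<alpha> y) + J3 (\<beta> y)" using Lg[of y] by (simp add: L_def \<alpha>_def \<beta>_def)
    have P: "?\<Phi> (t, p y, q y) = 1 *\<^sub>R J2 (\<alpha> y) + \<tau> *\<^sub>R J3 (\<beta> y)"
      unfolding \<Phi> a b by (simp add: linear_cmul[OF B.J_linear])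
    have "F (1 *\<^sub>R J2 (\<alpha> y) + \<tau> *\<^sub>R J3 (\<beta> y)) = F (J2 (\<alpha> y) + J3 (\<beta> y)) + k2 * ln 1 + k3 * ln \<tau>"
      by (rule F_scale[OF A.J_pi J3_ker _ \<tau>]) (use y_eq yS box(3)[OF z] P in simp_all)
    then have "k3 * ln \<tau> = 0" using F\<Phi>[OF z] P y_eq y(2) by simp
    then have "\<tau> = 1" using k_pos \<tau> by simp
    then show ?thesis using c z P y_eq by simp
  qed
  show ?thesis
  proof (rule that[of I B1 B2 fA.\<psi> f1.h fB.\<psi> f2.h L R coord])
    show "open I" "is_interval I" "open B1" "open B2" "linear L" "bij L" "open R" by (fact I B12 lin_L bij_L open_R)+
    show "hyperbolic_affine_hypersphere (open_manifold B1) fA.\<psi> fA.\<psi> f1.h (- 1)" "center_at (open_manifold B1) fA.\<psi> fA.\<psi> 0"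
      by (fact f1.hypersphere)+
    show "hyperbolic_affine_hypersphere (open_manifold B2) fB.\<psi> fB.\<psi> f2.h (- 1)" "center_at (open_manifold B2) fB.\<psi> fB.\<psi> 0"
      by (fact f2.hypersphere)+
    show "smooth_on (I \<times> B1 \<times> B2) ?\<Phi>" by (rule smooth_on_subset[OF smooth_\<Phi>]) (use sub in blast)
    show "R \<subseteq> S" by (auto simp: R_def S2_def S1_def)
    show "y0 \<in> R" using coord_\<Phi>[OF I(3) B12(3,4)] \<Phi>0 by simp
    show "smooth_on R coord" by (rule smooth_on_subset[OF smcoord]) (simp add: R_def)
    show "?\<Phi> z \<in> R \<and> F (?\<Phi> z) = 0 \<and> coord (?\<Phi> z) = z" if "z \<in> I \<times> B1 \<times> B2" for z
      using that coord_\<Phi> F\<Phi> by (cases z) auto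
    show "coord y \<in> I \<times> B1 \<times> B2 \<and> ?\<Phi> (coord y) = y" if "y \<in> R" "F y = 0" for y
      by (rule \<Phi>_coord[OF that])
  qed
qed

end

section \<open>Decomposition of the hypersphere\<close>

lemma dim_line_plus:
  fixes D :: "'a::euclidean_space set"
  assumes "subspace D" "x \<notin> D"
  shows "dim {\<alpha> *\<^sub>R x + v |\<alpha> v. v \<in> D} = dim D + 1"
proof -
  have "{\<alpha> *\<^sub>R x + v |\<alpha> v. v \<in> D} = span (insert x D)"
  proof
    show "span (insert x D) \<subseteq> {\<alpha> *\<^sub>R x + v |\<alpha> v. v \<in> D}"
    proof
      fix y assume "y \<in> span (insert x D)"
      then obtain k where "y - k *\<^sub>R x \<in> span D" by (auto simp: span_breakdown_eq)
      then have "y - k *\<^sub>R x \<in> D" using assms(1) span_eq_iff by blast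
      moreover have "y = k *\<^sub>R x + (y - k *\<^sub>R x)" by simp
      ultimately show "y \<in> {\<alpha> *\<^sub>R x + v |\<alpha> v. v \<in> D}" by blast
    qed
    show "{\<alpha> *\<^sub>R x + v |\<alpha> v. v \<in> D} \<subseteq> span (insert x D)"
      by (auto intro!: span_add span_scale intro: span_base)
  qed
  moreover have "x \<notin> span D" using assms span_eq_iff by blast
  ultimately show ?thesis by (simp add: dim_insert)
qed

context cone_potential
begin

text \<open>The form \<open>d2 F\<close> is definite, so the three mutually orthogonal summands are
  independent, and their dimensions add up to that of the tangent space.\<close>

lemma tangent_decomposition:
  assumes y: "y \<in> Y" and sub: "subspace D2" "subspace D3" "D2 \<subseteq> range (d1 f (w y))" "D3 \<subseteq> range (d1 f (w y))"
    and T: "T \<in> range (d1 f (w y))" "hh (w y) T T = 1"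
    and orth: "\<And>v. v \<in> D2 \<Longrightarrow> hh (w y) T v = 0" "\<And>v. v \<in> D3 \<Longrightarrow> hh (w y) T v = 0"
      "\<And>v v'. v \<in> D2 \<Longrightarrow> v' \<in> D3 \<Longrightarrow> hh (w y) v v' = 0"
    and dims: "1 + dim D2 + dim D3 = CARD('n)"
    and X: "X \<in> range (d1 f (w y))"
  shows "\<exists>\<alpha>. \<exists>v\<in>D2. \<exists>v'\<in>D3. X = \<alpha> *\<^sub>R T + v + v'"
proof -
  have hd: "d2 F y v v' = lam / (r y)\<^sup>2 * hh (w y) v v'" if "v \<in> range (d1 f (w y))" "v' \<in> range (d1 f (w y))" for v v'
    using that d2_tangent[OF y] by auto
  have nz: "v = 0" if "d2 F y v v = 0" for v using d2_negative[OF y, of v] that by fastforce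
  let ?A = "{v + v' |v v'. v \<in> D2 \<and> v' \<in> D3}"
  have A: "subspace ?A" by (rule subspace_sums[OF sub(1,2)])
  have "D2 \<inter> D3 = {0}"
  proof -
    have "v = 0" if "v \<in> D2" "v \<in> D3" for v
      by (rule nz) (use hd orth(3)[OF that] sub(3) that(1) in auto)
    then show ?thesis using subspace_0[OF sub(1)] subspace_0[OF sub(2)] by auto
  qed
  then have dimA: "dim ?A = dim D2 + dim D3" using dim_sums_Int[OF sub(1,2)] by simp
  have "T \<notin> ?A"
  proof
    assume "T \<in> ?A"
    then obtain v v' where v: "v \<in> D2" "v' \<in> D3" "T = v + v'" by blast
    have "d2 F y T (v + v') = 0"
      using hd[OF T(1)] sub(3,4) v orth by (simp add: linear_add[OF d2_linear[OF y]] subset_iff)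
    then show False using v(3) nz[of T] hd[OF T(1) T(1)] T(2) lam rw(1)[OF y] by simp
  qed
  then have dimB: "dim {\<alpha> *\<^sub>R T + v |\<alpha> v. v \<in> ?A} = CARD('n)"
    using dim_line_plus[OF A, of T] dimA dims by simp
  have subr: "subspace (range (d1 f (w y)))"
    by (rule linear_subspace_image[OF smooth_on_linear[OF smooth_f rw(2)[OF y]] subspace_UNIV])
  have "{\<alpha> *\<^sub>R T + v |\<alpha> v. v \<in> ?A} \<subseteq> range (d1 f (w y))"
    using sub(3,4) T(1) by (auto intro!: subspace_add[OF subr] subspace_scale[OF subr])
  moreover have "dim (range (d1 f (w y))) = CARD('n)"
    using dim_image_eq[OF smooth_on_linear[OF smooth_f rw(2)[OF y]], of UNIV] inj_df[OF rw(2)[OF y]] by simp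
  moreover have "subspace {\<alpha> *\<^sub>R T + v |\<alpha> v. v \<in> ?A}"
    using subspace_sums[OF subspace_span[of "{T}"] A] by (simp add: span_singleton) (smt (verit) Collect_cong mem_Collect_eq rangeE rangeI)
  ultimately have "{\<alpha> *\<^sub>R T + v |\<alpha> v. v \<in> ?A} = range (d1 f (w y))"
    using dimB subr by (intro subspace_dim_equal) auto
  then have "X \<in> {\<alpha> *\<^sub>R T + v |\<alpha> v. v \<in> ?A}" using X by simp
  then show ?thesis by (auto simp: add.assoc)
qed

text \<open>The volume normalisation of the affine normal is the Monge-Ampere equation for \<open>F\<close>.\<close>

lemma monge_ampere:
  assumes y: "y \<in> Y" "r y = 1"
    and vol: "\<bar>det (\<chi> a. case a of Some i \<Rightarrow> d1 f (w y) (axis i 1) | None \<Rightarrow> (- lam) *\<^sub>R f (w y))\<bar> =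
      sqrt \<bar>det (\<chi> i j. hh (w y) (d1 f (w y) (axis i 1)) (d1 f (w y) (axis j 1)))\<bar>"
  shows "det (\<chi> i j. - d2 F y (axis i 1) (axis j 1)) = lam\<^sup>2 * (- lam) ^ CARD('n)"
proof -
  let ?X = "\<lambda>i. d1 f (w y) (axis i 1)"
  define Z :: "real^('n option)^('n option)" where "Z = (\<chi> a. case a of Some i \<Rightarrow> ?X i | None \<Rightarrow> (- lam) *\<^sub>R f (w y))"
  define H :: "real^'n^'n" where "H = (\<chi> i j. hh (w y) (?X i) (?X j))"
  let ?G = "\<chi> i j. - d2 F y (Z $ i) (Z $ j)"
  note lin = linear_cmul[OF d2_linear[OF y(1)]] linear_cmul[OF d2_linear1[OF y(1)]] linear_neg[OF d2_linear[OF y(1)]] linear_neg[OF d2_linear1[OF y(1)]]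
  have fX: "d2 F y (f (w y)) (?X i) = 0" for i using d2_f_tangent[OF y(1)] d1_tangent[OF y(1)] by simp
  have Xf: "d2 F y (?X i) (f (w y)) = 0" for i using fX d2_sym[OF y(1)] by simp
  have ff: "d2 F y (f (w y)) (f (w y)) = - 1" using d2_f_tangent[OF y(1)] d1_f[OF y(1)] y(2) by simp
  have G: "det ?G = (det Z)\<^sup>2 * det (\<chi> i j. - d2 F y (axis i 1) (axis j 1))"
    by (rule det_gram) (intro linear_compose_neg d2_linear d2_linear1 y)+
  have "det ?G = ?G $ None $ None * det (\<chi> i j. ?G $ Some i $ Some j)"
    by (rule det_option_block) (simp_all add: Z_def lin fX Xf)
  \<comment> \<open>The normal - lam f contributes the square of lam; the remaining factor of the
    constant comes from G = - lam h on the n tangent vectors.\<close>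
  moreover have "?G $ None $ None = lam\<^sup>2" by (simp add: Z_def lin ff power2_eq_square)
  moreover have sub: "(\<chi> i j. ?G $ Some i $ Some j) = (\<chi> i j. (- lam) * H $ i $ j)"
    using d2_tangent[OF y(1)] y(2) by (simp add: Z_def H_def)
  ultimately have G2: "det ?G = lam\<^sup>2 * ((- lam) ^ CARD('n) * det H)"
    by (simp only: det_scale_matrix)
  \<comment> \<open>Positivity of det H removes the absolute value in the volume condition and
    allows cancelling det H at the end.\<close>
  have "det (\<chi> i j. - d2 F y (?X i) (?X j)) > 0"
  proof (rule det_gram_positive[OF smooth_on_linear[OF smooth_f rw(2)[OF y(1)]] inj_df[OF rw(2)[OF y(1)]], where G = "\<lambda>u v. - d2 F y u v"])
    show "linear (\<lambda>v. - d2 F y u v)" "linear (\<lambda>v. - d2 F y v u)" for u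
      by (intro linear_compose_neg d2_linear d2_linear1 y(1))+
    show "- d2 F y v v > 0" if "v \<noteq> 0" for v using d2_negative[OF y(1) that] by simp
  qed
  moreover have "(\<chi> i j. - d2 F y (?X i) (?X j)) = (\<chi> i j. (- lam) * H $ i $ j)"
    using d2_tangent[OF y(1)] y(2) by (simp add: H_def)
  ultimately have "(- lam) ^ CARD('n) * det H > 0" by (simp only: det_scale_matrix)
  then have H: "det H > 0" using lam by (simp add: zero_less_mult_iff)
  have "\<bar>det Z\<bar> = sqrt (det H)" using vol[folded Z_def H_def] H by simp
  then have "(det Z)\<^sup>2 = det H" using H by (metis power2_abs real_sqrt_pow2 less_imp_le)
  then have "det H * det (\<chi> i j. - d2 F y (axis i 1) (axis j 1)) = lam\<^sup>2 * ((- lam) ^ CARD('n) * det H)"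
    using G G2 by (simp only:)
  then have "det H * det (\<chi> i j. - d2 F y (axis i 1) (axis j 1)) = det H * (lam\<^sup>2 * (- lam) ^ CARD('n))"
    by (simp only: mult_ac)
  then show ?thesis using H by simp
qed

end

text \<open>Smoothness has to be checked in every chart of M; the transition maps reduce it to
  smoothness of G and c in the single chart (V, x).\<close>

lemma (in chart_of_manifold) diffeomorphism_from_box:
  fixes I :: "real set" and B1 :: "'b::euclidean_space set" and B2 :: "'c::euclidean_space set"
    and G :: "real \<times> 'b \<times> 'c \<Rightarrow> 'e"
  assumes op: "open I" "open B1" "open B2" and W: "open W" "W \<subseteq> \<Omega>"
    and G: "smooth_on (I \<times> B1 \<times> B2) G" "\<And>z. z \<in> I \<times> B1 \<times> B2 \<Longrightarrow> G z \<in> W \<and> c (G z) = z"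
    and c: "smooth_on W c" "\<And>u. u \<in> W \<Longrightarrow> c u \<in> I \<times> B1 \<times> B2 \<and> G (c u) = u"
  shows "diffeomorphism (open_manifold I \<times>\<^sub>M\<^sub>f open_manifold B1 \<times>\<^sub>M\<^sub>f open_manifold B2) (open_submanifold M (X ` W)) (\<lambda>z. X (G z))"
proof -
  let ?D = "I \<times> B1 \<times> B2" and ?W = "X ` W"
  let ?N = "open_manifold I \<times>\<^sub>M\<^sub>f open_manifold B1 \<times>\<^sub>M\<^sub>f open_manifold B2" and ?S = "open_submanifold M ?W"
  let ?T = "\<lambda>z. X (G z)"
  have D: "open ?D" by (intro open_Times op)
  have N: "mfd_top ?N = top_of_set ?D" "atlas ?N = {(?D, id)}"
    by (simp_all add: prod_manifold_def open_manifold_def map_prod.id)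
  have WV: "?W \<subseteq> V" "?W \<subseteq> carrier_mfd M" using W V_subset by (auto intro!: X_carrier)
  have S: "mfd_top ?S = subtopology (mfd_top M) ?W" "atlas ?S = {(V' \<inter> ?W, y) |V' y. (V', y) \<in> atlas M}" "carrier_mfd ?S = ?W"
    using WV(2) by (auto simp: open_submanifold_def)
  have opW: "openin (mfd_top M) ?W" by (rule openin_X_image[OF W])
  have bij: "bij_betw ?T ?D ?W"
  proof -
    have xX: "x (X u) = u" if "u \<in> W" for u using that W by auto
    show ?thesis
    proof (rule bij_betw_byWitness[where f' = "\<lambda>p. c (x p)"])
    show "\<forall>z\<in>?D. c (x (?T z)) = z" using G(2) xX by simp
    show "\<forall>p\<in>?W. ?T (c (x p)) = p" using c(2) xX by auto
    show "?T ` ?D \<subseteq> ?W" using G(2) by blast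
    show "(\<lambda>p. c (x p)) ` ?W \<subseteq> ?D"
    proof (rule image_subsetI)
      fix p assume "p \<in> ?W"
      then obtain u where u: "u \<in> W" "p = X u" by blast
      then show "c (x p) \<in> ?D" using c(2)[OF u(1)] xX[OF u(1)] by simp
    qed
    qed
  qed
  have inv: "inv_into ?D ?T p = c (x p)" if p: "p \<in> ?W" for p
  proof (rule inv_into_f_eq)
    show "inj_on ?T ?D" using bij by (rule bij_betw_imp_inj_on)
    obtain u where u: "u \<in> W" "p = X u" using p by blast
    then have "x p = u" using W by auto
    then show "c (x p) \<in> ?D" "?T (c (x p)) = p" using c(2)[OF u(1)] u by auto
  qed
  have idD: "inv_into ?D id z = z" if "z \<in> ?D" for z using that by (simp add: inv_into_f_eq)
  have 1: "smooth_map ?N ?S ?T"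
    unfolding smooth_map_def
  proof (rule conjI)
    have preim: "open {z \<in> ?D. ?T z \<in> U}" if "openin (mfd_top M) U" for U
    proof -
      have "{z \<in> ?D. ?T z \<in> U} = ?D \<inter> G -` (x ` (V \<inter> U))"
        using G(2) W by (force simp: subset_iff)
      then show ?thesis
        using continuous_open_preimage[OF smooth_on_continuous[OF G(1)] D open_image[OF that]] by simp
    qed
    show "continuous_map (mfd_top ?N) (mfd_top ?S) ?T"
      unfolding N S continuous_map_in_subtopology
    proof (intro conjI)
      show "continuous_map (top_of_set ?D) (mfd_top M) ?T"
        unfolding continuous_map_def using G(2) WV(2) preim D by (auto simp: openin_open_eq)
      show "?T \<in> topspace (top_of_set ?D) \<rightarrow> ?W" using G(2) by auto
    qed
    have main: "smooth_on (id ` {p \<in> ?D. ?T p \<in> V' \<inter> ?W}) (y \<circ> ?T \<circ> inv_into ?D id)" if V': "(V', y) \<in> atlas M" for V' y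
    proof -
    interpret V': chart_of_manifold M V' y using M V' by unfold_locales
    let ?Q = "{z \<in> ?D. ?T z \<in> V'}"
    have Q: "open ?Q" by (rule preim[OF V'.openin_V])
    have "smooth_on ?Q (\<lambda>z. (y \<circ> X) (G z))"
      by (rule smooth_on_compose[OF transition[OF V'] smooth_on_subset[OF G(1)] Q open_image[OF V'.openin_V]])
        (use G(2) W in \<open>force simp: subset_iff\<close>)+
    then have "smooth_on ?Q (y \<circ> ?T \<circ> inv_into ?D id)"
      by (rule smooth_on_cong[OF _ Q]) (simp add: idD)
    moreover have "id ` {p \<in> ?D. ?T p \<in> V' \<inter> ?W} = ?Q" using G(2) by auto
    ultimately show ?thesis by simp
    qed
    have "\<forall>b\<in>atlas ?S. case b of (W, y) \<Rightarrow> smooth_on (id ` {p \<in> ?D. ?T p \<in> W}) (y \<circ> ?T \<circ> inv_into ?D id)"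
    proof
      fix b assume "b \<in> atlas ?S"
      then obtain V' y where b: "b = (V' \<inter> ?W, y)" and V': "(V', y) \<in> atlas M" unfolding S by blast
      show "case b of (W, y) \<Rightarrow> smooth_on (id ` {p \<in> ?D. ?T p \<in> W}) (y \<circ> ?T \<circ> inv_into ?D id)"
        unfolding b prod.case by (rule main[OF V'])
    qed
    then show "\<forall>(V, x)\<in>atlas ?N. \<forall>(W, y)\<in>atlas ?S. smooth_on (x ` {p \<in> V. ?T p \<in> W}) (y \<circ> ?T \<circ> inv_into V x)"
      unfolding N(2) by simp
  qed
  have 2: "smooth_map ?S ?N (inv_into ?D ?T)"
    unfolding smooth_map_def
  proof (rule conjI)
    show "continuous_map (mfd_top ?S) (mfd_top ?N) (inv_into ?D ?T)"
      unfolding continuous_map_def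
    proof (intro conjI allI impI)
      show "inv_into ?D ?T \<in> carrier_mfd ?S \<rightarrow> topspace (mfd_top ?N)"
        unfolding N S(3) using inv c(2) W by (auto simp: subset_iff)
      fix U assume "openin (mfd_top ?N) U"
      then have U: "open U" using D by (simp add: N openin_open_eq)
      have "{p \<in> carrier_mfd ?S. inv_into ?D ?T p \<in> U} = X ` (W \<inter> c -` U)"
        unfolding S(3) using inv W by (auto simp: subset_iff)
      moreover have "openin (mfd_top M) (X ` (W \<inter> c -` U))"
        by (intro openin_X_image continuous_open_preimage smooth_on_continuous c W U) (use W in blast)
      ultimately show "openin (mfd_top ?S) {p \<in> carrier_mfd ?S. inv_into ?D ?T p \<in> U}"
        unfolding S(1) using openin_open_subtopology[OF opW] by auto
    qed
    have main: "smooth_on (y ` {p \<in> V' \<inter> ?W. inv_into ?D ?T p \<in> ?D}) (id \<circ> inv_into ?D ?T \<circ> inv_into (V' \<inter> ?W) y)"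
      if V': "(V', y) \<in> atlas M" for V' y
    proof -
    interpret V': chart_of_manifold M V' y using M V' by unfold_locales
    let ?Q = "y ` (V' \<inter> ?W)"
    have Q: "open ?Q" by (rule V'.open_image[OF opW])
    have invy: "inv_into (V' \<inter> ?W) y (y p) = p" if "p \<in> V'" "p \<in> ?W" for p
      using that V'.inj_x by (intro inv_into_f_f) (auto intro: inj_on_subset)
    have "smooth_on ?Q (\<lambda>u. c ((x \<circ> V'.X) u))"
      by (rule smooth_on_compose[OF c(1) smooth_on_subset[OF V'.transition[OF chart]] Q W(1)]) (use WV W in \<open>auto simp: subset_iff\<close>)
    then have "smooth_on ?Q (id \<circ> inv_into ?D ?T \<circ> inv_into (V' \<inter> ?W) y)"
      by (rule smooth_on_cong[OF _ Q]) (auto simp: invy inv)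
    moreover have "y ` {p \<in> V' \<inter> ?W. inv_into ?D ?T p \<in> ?D} = ?Q"
    proof -
      have "inv_into ?D ?T p \<in> ?D" if "p \<in> ?W" for p using inv[OF that] that c(2) W by auto
      then show ?thesis by blast
    qed
    ultimately show ?thesis by simp
    qed
    have "\<forall>a\<in>atlas ?S. case a of (V, x) \<Rightarrow> smooth_on (x ` {p \<in> V. inv_into ?D ?T p \<in> ?D}) (id \<circ> inv_into ?D ?T \<circ> inv_into V x)"
    proof
      fix a assume "a \<in> atlas ?S"
      then obtain V' y where a: "a = (V' \<inter> ?W, y)" and V': "(V', y) \<in> atlas M" unfolding S by blast
      show "case a of (V, x) \<Rightarrow> smooth_on (x ` {p \<in> V. inv_into ?D ?T p \<in> ?D}) (id \<circ> inv_into ?D ?T \<circ> inv_into V x)"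
        unfolding a prod.case by (rule main[OF V'])
    qed
    then show "\<forall>(V, x)\<in>atlas ?S. \<forall>(W, y)\<in>atlas ?N. smooth_on (x ` {p \<in> V. inv_into ?D ?T p \<in> W}) (y \<circ> inv_into ?D ?T \<circ> inv_into V x)"
      unfolding N(2) by simp
  qed
  have "carrier_mfd ?N = ?D" by (simp add: N)
  then show ?thesis unfolding diffeomorphism_def S(3) using bij 1 2 by simp
qed

theorem theorem2:
  fixes M :: "('m, real ^ 'n) manifold"
    and \<phi> \<xi> T :: "'m \<Rightarrow> real ^ ('n::finite option)"
    and h :: "'m \<Rightarrow> real ^ ('n option) \<Rightarrow> real ^ ('n option) \<Rightarrow> real"
    and K :: "'m \<Rightarrow> real ^ ('n option) \<Rightarrow> real ^ ('n option) \<Rightarrow> real ^ ('n option)"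
    and D1 D2 D3 :: "'m \<Rightarrow> (real ^ ('n option)) set"
    and lam lam1 lam2 lam3 :: real
  assumes hyp: "hyperbolic_affine_hypersphere M \<phi> \<xi> h lam"
    and K: "difference_tensor M \<phi> \<xi> h K"
    and D1: "smooth_distribution M \<phi> 1 D1"
    and T: "vector_field_on M \<phi> (carrier_mfd M) T"
           "\<And>p. p \<in> carrier_mfd M \<Longrightarrow> h p (T p) (T p) = 1 \<and> D1 p = span {T p}"
    and D2: "smooth_distribution M \<phi> CARD('n2::finite) D2"
    and D3: "smooth_distribution M \<phi> CARD('n3::finite) D3"
    and dims: "1 + CARD('n2) + CARD('n3) = CARD('n)"
    and orth12: "\<And>p u v. p \<in> carrier_mfd M \<Longrightarrow> u \<in> D1 p \<Longrightarrow> v \<in> D2 p \<Longrightarrow> h p u v = 0"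
    and orth13: "\<And>p u w. p \<in> carrier_mfd M \<Longrightarrow> u \<in> D1 p \<Longrightarrow> w \<in> D3 p \<Longrightarrow> h p u w = 0"
    and orth23: "\<And>p v w. p \<in> carrier_mfd M \<Longrightarrow> v \<in> D2 p \<Longrightarrow> w \<in> D3 p \<Longrightarrow> h p v w = 0"
    and lams: "lam1 = lam2 + lam3" "lam2 * lam3 = lam"
    and KTT: "\<And>p. p \<in> carrier_mfd M \<Longrightarrow> K p (T p) (T p) = lam1 *\<^sub>R T p"
    and KTV: "\<And>p v. p \<in> carrier_mfd M \<Longrightarrow> v \<in> D2 p \<Longrightarrow> K p (T p) v = lam2 *\<^sub>R v"
    and KTW: "\<And>p w. p \<in> carrier_mfd M \<Longrightarrow> w \<in> D3 p \<Longrightarrow> K p (T p) w = lam3 *\<^sub>R w"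
    and KVW: "\<And>p v w. p \<in> carrier_mfd M \<Longrightarrow> v \<in> D2 p \<Longrightarrow> w \<in> D3 p \<Longrightarrow> K p v w = 0"
  shows "locally_calabi_product TYPE('n2) TYPE('n3) M \<phi>"
  unfolding locally_calabi_product_def
proof
  fix x0 assume x0: "x0 \<in> carrier_mfd M"
  have M: "smooth_manifold M" and imm: "immersion M \<phi>" and anm: "affine_normal_metric M \<phi> \<xi> h"
    and hpos: "\<And>p w. p \<in> carrier_mfd M \<Longrightarrow> w \<in> tangent_space M \<phi> p \<Longrightarrow> w \<noteq> 0 \<Longrightarrow> h p w w > 0"
    and shape: "\<And>p w. p \<in> carrier_mfd M \<Longrightarrow> w \<in> tangent_space M \<phi> p \<Longrightarrow> shape_operator M \<phi> \<xi> p w = lam *\<^sub>R w"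
    and lam: "lam < 0"
    using hyp unfolding hyperbolic_affine_hypersphere_def affine_hypersphere_def by auto
  have smooth_\<xi>: "smooth_fun_on M (carrier_mfd M) \<xi>"
    and trans: "\<And>p. p \<in> carrier_mfd M \<Longrightarrow> \<xi> p \<notin> tangent_space M \<phi> p"
    and aff: "affine_fundamental_form M \<phi> \<xi> h"
    and vol: "\<And>p X. p \<in> carrier_mfd M \<Longrightarrow> (\<And>i. X i \<in> tangent_space M \<phi> p) \<Longrightarrow>
        \<bar>det (\<chi> a. case a of Some i \<Rightarrow> X i | None \<Rightarrow> \<xi> p)\<bar> = sqrt \<bar>det (\<chi> i j. h p (X i) (X j))\<bar>"
    using anm unfolding affine_normal_metric_def by auto
  have "x0 \<in> (\<Union>(V, x)\<in>atlas M. V)" using M x0 unfolding smooth_manifold_def by blast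
  then obtain V x where chart: "(V, x) \<in> atlas M" "x0 \<in> V" by blast
  interpret c: immersed_chart M V x \<phi> by unfold_locales (fact M chart(1) imm)+
  obtain U2 E2 where E2: "openin (mfd_top M) U2" "x0 \<in> U2" "\<And>i. i < CARD('n2) \<Longrightarrow> vector_field_on M \<phi> U2 (E2 i)"
    "\<And>q. q \<in> U2 \<Longrightarrow> D2 q = span {E2 i q |i. i < CARD('n2)}"
    using D2 x0 unfolding smooth_distribution_def by meson
  obtain U3 E3 where E3: "openin (mfd_top M) U3" "x0 \<in> U3" "\<And>i. i < CARD('n3) \<Longrightarrow> vector_field_on M \<phi> U3 (E3 i)"
    "\<And>q. q \<in> U3 \<Longrightarrow> D3 q = span {E3 i q |i. i < CARD('n3)}"
    using D3 x0 unfolding smooth_distribution_def by meson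
  have D2t: "subspace (D2 p)" "D2 p \<subseteq> tangent_space M \<phi> p" "dim (D2 p) = CARD('n2)" if "p \<in> carrier_mfd M" for p
    using D2 that unfolding smooth_distribution_def by blast+
  have D3t: "subspace (D3 p)" "D3 p \<subseteq> tangent_space M \<phi> p" "dim (D3 p) = CARD('n3)" if "p \<in> carrier_mfd M" for p
    using D3 that unfolding smooth_distribution_def by blast+
  define u0 where "u0 = x x0"
  have "open (x ` (V \<inter> U2) \<inter> x ` (V \<inter> U3))" by (intro open_Int c.open_image E2 E3)
  moreover have "u0 \<in> x ` (V \<inter> U2) \<inter> x ` (V \<inter> U3)" using chart(2) E2(2) E3(2) by (auto simp: u0_def)
  ultimately obtain \<delta> where \<delta>: "\<delta> > 0" "ball u0 \<delta> \<subseteq> x ` (V \<inter> U2) \<inter> x ` (V \<inter> U3)"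
    using open_contains_ball by blast
  \<comment> \<open>A ball on which both local frames exist; its convexity is used to integrate the
    equation for the affine normal.\<close>
  define \<Omega> where "\<Omega> = ball u0 \<delta>"
  have \<Omega>: "open \<Omega>" "u0 \<in> \<Omega>" "convex \<Omega>" "\<Omega> \<subseteq> x ` V" "\<Omega> \<subseteq> x ` (V \<inter> U2)" "\<Omega> \<subseteq> x ` (V \<inter> U3)"
    using \<delta> by (auto simp: \<Omega>_def)
  have uO: "u \<in> x ` V" and Xc: "c.X u \<in> carrier_mfd M" and XU: "c.X u \<in> U2" "c.X u \<in> U3" if u: "u \<in> \<Omega>" for u
  proof -
    show uV: "u \<in> x ` V" using u \<Omega> by blast
    then show "c.X u \<in> carrier_mfd M" by (rule c.X_carrier)
    obtain p where "u = x p" "p \<in> V" "p \<in> U2" using u \<Omega>(5) by blast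
    then show "c.X u \<in> U2" by simp
    obtain p' where "u = x p'" "p' \<in> V" "p' \<in> U3" using u \<Omega>(6) by blast
    then show "c.X u \<in> U3" by simp
  qed
  note tang = c.tangent_space_chart[OF uO]
  have linf: "linear (d1 c.f u)" if "u \<in> \<Omega>" for u by (rule smooth_on_linear[OF c.smooth_f uO[OF that]])
  let ?\<xi> = "\<xi> \<circ> c.X"
  have sm\<xi>: "smooth_on (x ` V) ?\<xi>"
    using c.smooth_fun_onD[OF smooth_\<xi>] c.V_subset by (simp add: inf_absorb1)
  have d\<xi>: "d1 ?\<xi> u a = - lam *\<^sub>R d1 c.f u a" if "u \<in> \<Omega>" for u a
  proof -
    have "deriv_along M \<phi> (d1 c.f u a) \<xi> (c.X u) = d1 ?\<xi> u a"
      by (rule c.deriv_along_f[OF openin_topspace smooth_\<xi> uO[OF that] Xc[OF that]])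
    moreover have "shape_operator M \<phi> \<xi> (c.X u) (d1 c.f u a) = lam *\<^sub>R d1 c.f u a"
      by (rule shape[OF Xc[OF that]]) (simp add: tang[OF that])
    ultimately show ?thesis by (simp add: shape_operator_def) (metis minus_minus)
  qed
  \<comment> \<open>The center: \<phi> + (1 / lam) \<xi> has zero derivative because the derivative
    of \<xi> is - lam times that of \<phi>.\<close>
  define b where "b = c.f u0 + (1 / lam) *\<^sub>R ?\<xi> u0"
  define f0 where "f0 u = c.f u - b" for u
  have \<xi>_f0: "?\<xi> u = - lam *\<^sub>R f0 u" if "u \<in> \<Omega>" for u
  proof -
    have "((\<lambda>u. ?\<xi> u + lam *\<^sub>R c.f u) has_derivative (\<lambda>a. 0)) (at v within \<Omega>)" if v: "v \<in> \<Omega>" for v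
    proof -
      have "((\<lambda>u. ?\<xi> u + lam *\<^sub>R c.f u) has_derivative (\<lambda>a. d1 ?\<xi> v a + lam *\<^sub>R d1 c.f v a)) (at v)"
        by (intro has_derivative_add has_derivative_scaleR_right smooth_on_has_derivative[OF sm\<xi> uO[OF v]] smooth_on_has_derivative[OF c.smooth_f uO[OF v]])
      moreover have "(\<lambda>a. d1 ?\<xi> v a + lam *\<^sub>R d1 c.f v a) = (\<lambda>a. 0)" using d\<xi>[OF v] by auto
      ultimately have "((\<lambda>u. ?\<xi> u + lam *\<^sub>R c.f u) has_derivative (\<lambda>a. 0)) (at v)" by (simp only:)
      then show ?thesis by (rule has_derivative_at_withinI)
    qed
    then have "?\<xi> u + lam *\<^sub>R c.f u = ?\<xi> u0 + lam *\<^sub>R c.f u0"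
      by (rule has_derivative_zero_unique[OF \<Omega>(3) _ that \<Omega>(2)])
    then show ?thesis
      using lam by (simp add: f0_def b_def algebra_simps)
  qed
  have smooth_f: "smooth_on \<Omega> c.f" by (rule smooth_on_subset[OF c.smooth_f \<Omega>(4)])
  have smooth_f0: "smooth_on \<Omega> f0"
    unfolding f0_def by (rule smooth_on_diff[OF \<Omega>(1) smooth_f smooth_on_const])
  have df0: "d1 f0 u = d1 c.f u" if "u \<in> \<Omega>" for u
  proof -
    have "(f0 has_derivative (\<lambda>a. d1 c.f u a - 0)) (at u)"
      unfolding f0_def by (intro has_derivative_diff has_derivative_const smooth_on_has_derivative[OF smooth_f that])
    then have "(f0 has_derivative d1 c.f u) (at u)" by simp
    then show ?thesis by (rule frechet_derivative_at[symmetric])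
  qed
  have d2f0: "d2 f0 u v a = d2 c.f u v a" if "u \<in> \<Omega>" for u v a
    by (rule fun_cong[OF d1_cong[OF \<Omega>(1) that smooth_on_differentiable[OF smooth_on_derivative[OF smooth_f0] that]]]) (simp add: df0)
  define hh where "hh u = h (c.X u)" for u
  interpret ca: centroaffine \<Omega> f0 hh lam
  proof
    show "open \<Omega>" "smooth_on \<Omega> f0" "lam < 0" by (fact \<Omega> smooth_f0 lam)+
    show "inj (d1 f0 u)" if "u \<in> \<Omega>" for u using c.inj_df[OF uO[OF that]] df0[OF that] by simp
    show "f0 u \<notin> range (d1 f0 u)" if u: "u \<in> \<Omega>" for u
    proof
      assume "f0 u \<in> range (d1 f0 u)"
      then obtain a where "f0 u = d1 c.f u a" using df0[OF u] by auto
      then have "\<xi> (c.X u) = d1 c.f u ((- lam) *\<^sub>R a)" unfolding linear_cmul[OF linf[OF u]] using \<xi>_f0[OF u] by simp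
      then show False using trans[OF Xc[OF u]] tang[OF u] by blast
    qed
    show "d2 f0 u v a + (lam * hh u (d1 f0 u a) (d1 f0 u v)) *\<^sub>R f0 u \<in> range (d1 f0 u)" if "u \<in> \<Omega>" for u v a
      using c.gauss_formula[OF aff uO[OF that], of v a] \<xi>_f0[OF that]
      by (simp add: d2f0[OF that] df0[OF that] hh_def mult.commute)
    show "hh u X X > 0" if "u \<in> \<Omega>" "X \<in> range (d1 f0 u)" "X \<noteq> 0" for u X
      using hpos[OF Xc[OF that(1)], of X] that by (simp add: hh_def tang df0)
  qed
  obtain Y r w \<Omega>1 where Y: "open Y" "f0 u0 \<in> Y" "smooth_on Y r" "smooth_on Y w"
    "\<And>y. y \<in> Y \<Longrightarrow> r y > 0 \<and> w y \<in> \<Omega> \<and> y = r y *\<^sub>R f0 (w y)"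
    and \<Omega>1: "open \<Omega>1" "u0 \<in> \<Omega>1" "\<Omega>1 \<subseteq> \<Omega>" "\<And>u. u \<in> \<Omega>1 \<Longrightarrow> f0 u \<in> Y \<and> r (f0 u) = 1 \<and> w (f0 u) = u"
    and Y2: "\<And>y. y \<in> Y \<Longrightarrow> \<exists>A. open A \<and> w y \<in> A \<and> A \<subseteq> \<Omega> \<and>
      (\<forall>v\<in>A. r y *\<^sub>R f0 v \<in> Y \<and> r (r y *\<^sub>R f0 v) = r y \<and> w (r y *\<^sub>R f0 v) = v)"
    and Y3: "\<And>y. y \<in> Y \<Longrightarrow> \<exists>A. open A \<and> 1 \<in> A \<and> (\<forall>t\<in>A. t *\<^sub>R y \<in> Y \<and> r (t *\<^sub>R y) = t * r y)"
    apply (rule ca.cone_coordinates[OF \<Omega>(2)])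
    subgoal premises prems by (rule prems(1)) (fact prems)+
    done
  have Y5: "r y > 0" "w y \<in> \<Omega>" "y = r y *\<^sub>R f0 (w y)" if "y \<in> Y" for y
    using Y(5)[OF that] by (blast, blast, blast)
  interpret cp: cone_potential \<Omega> f0 hh lam Y r w
    by (rule cone_potential.intro[OF ca.centroaffine_axioms cone_potential_axioms.intro[OF Y(1,3,4) Y5 Y2 Y3]])
  obtain N where
    N: "\<And>u a v. u \<in> x ` V \<Longrightarrow> N u a v \<in> range (d1 c.f u)"
      "\<And>u a v. u \<in> x ` V \<Longrightarrow> N u a v = N u v a"
      "\<And>u a v. u \<in> x ` V \<Longrightarrow> K (c.X u) (d1 c.f u a) (d1 c.f u v) =
         d2 c.f u v a - h (c.X u) (d1 c.f u a) (d1 c.f u v) *\<^sub>R \<xi> (c.X u) - N u a v"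
    and N_metric: "\<And>A u a v v'. open A \<Longrightarrow> A \<subseteq> x ` V \<Longrightarrow> u \<in> A \<Longrightarrow> smooth_on A (\<lambda>u. h (c.X u) (d1 c.f u v) (d1 c.f u v')) \<Longrightarrow>
       d1 (\<lambda>u. h (c.X u) (d1 c.f u v) (d1 c.f u v')) u a = h (c.X u) (N u a v) (d1 c.f u v') + h (c.X u) (d1 c.f u v) (N u a v')"
    by (rule c.difference_tensor_chart[OF K]) blast
  have smT: "smooth_on \<Omega> (T \<circ> c.X)"
    by (rule smooth_on_subset[OF c.smooth_fun_onD[of "carrier_mfd M"]])
      (use T(1) \<Omega>(4) c.V_subset in \<open>auto simp: vector_field_on_def inf_absorb1\<close>)
  have Tt: "T p \<in> tangent_space M \<phi> p" if "p \<in> carrier_mfd M" for p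
    using T(1) that by (simp add: vector_field_on_def)
  have smE2: "smooth_on \<Omega> (E2 i \<circ> c.X)" if "i < CARD('n2)" for i
    by (rule smooth_on_subset[OF c.smooth_fun_onD \<Omega>(5)]) (use E2(3)[OF that] in \<open>simp add: vector_field_on_def\<close>)
  have smE3: "smooth_on \<Omega> (E3 i \<circ> c.X)" if "i < CARD('n3)" for i
    by (rule smooth_on_subset[OF c.smooth_fun_onD \<Omega>(6)]) (use E3(3)[OF that] in \<open>simp add: vector_field_on_def\<close>)
  have TD1: "T p \<in> D1 p" if "p \<in> carrier_mfd M" for p
    using T(2)[OF that] by (simp add: span_base)
  let ?D2 = "\<lambda>u. D2 (c.X u)" and ?D3 = "\<lambda>u. D3 (c.X u)"
  interpret cc: calabi_chart \<Omega> f0 hh lam Y r w "\<lambda>u. K (c.X u)" N "T \<circ> c.X" ?D2 ?D3 "\<lambda>i. E2 i \<circ> c.X" "\<lambda>i. E3 i \<circ> c.X"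
    "CARD('n2)" "CARD('n3)" lam2 lam3
  proof (rule calabi_chart.intro[OF cp.cone_potential_axioms calabi_chart_axioms.intro])
    show "N u a v \<in> range (d1 f0 u)" if "u \<in> \<Omega>" for u a v using N(1)[OF uO[OF that]] df0[OF that] by simp
    show "N u a v = N u v a" if "u \<in> \<Omega>" for u a v by (rule N(2)[OF uO[OF that]])
    show "K (c.X u) (d1 f0 u a) (d1 f0 u v) = d2 f0 u v a + (lam * hh u (d1 f0 u a) (d1 f0 u v)) *\<^sub>R f0 u - N u a v" if "u \<in> \<Omega>" for u a v
      using N(3)[OF uO[OF that], of a v] \<xi>_f0[OF that] by (simp add: d2f0[OF that] df0[OF that] hh_def mult.commute)
    show "d1 (\<lambda>u. hh u (d1 f0 u v) (d1 f0 u v')) u a = hh u (N u a v) (d1 f0 u v') + hh u (d1 f0 u v) (N u a v')"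
      if A: "open A" "A \<subseteq> \<Omega>" "u \<in> A" and sm: "smooth_on A (\<lambda>u. hh u (d1 f0 u v) (d1 f0 u v'))" for A u a v v'
    proof -
      have eq: "hh u (d1 f0 u v) (d1 f0 u v') = h (c.X u) (d1 c.f u v) (d1 c.f u v')" if "u \<in> A" for u
        using df0[of u] that A(2) by (auto simp: hh_def)
      have uOm: "u \<in> \<Omega>" using A by blast
      have sm': "smooth_on A (\<lambda>u. h (c.X u) (d1 c.f u v) (d1 c.f u v'))"
        by (rule smooth_on_cong[OF sm A(1) eq])
      have "d1 (\<lambda>u. hh u (d1 f0 u v) (d1 f0 u v')) u a = d1 (\<lambda>u. h (c.X u) (d1 c.f u v) (d1 c.f u v')) u a"
        by (rule fun_cong[OF d1_cong[OF A(1,3) smooth_on_differentiable[OF sm A(3)] eq]])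
      also have "\<dots> = h (c.X u) (N u a v) (d1 c.f u v') + h (c.X u) (d1 c.f u v) (N u a v')"
        by (rule N_metric[OF A(1) order_trans[OF A(2) \<Omega>(4)] A(3) sm'])
      finally show ?thesis by (simp add: df0[OF uOm] hh_def)
    qed
    show "smooth_on \<Omega> (T \<circ> c.X)" by (rule smT)
    show "(T \<circ> c.X) u \<in> range (d1 f0 u)" if "u \<in> \<Omega>" for u
      using Tt[OF Xc[OF that]] tang[OF that] df0[OF that] by simp
    show "hh u ((T \<circ> c.X) u) ((T \<circ> c.X) u) = 1" if "u \<in> \<Omega>" for u
      using T(2)[OF Xc[OF that]] by (simp add: hh_def)
    show "smooth_on \<Omega> (E2 i \<circ> c.X)" if "i < CARD('n2)" for i by (rule smE2[OF that])
    show "smooth_on \<Omega> (E3 i \<circ> c.X)" if "i < CARD('n3)" for i by (rule smE3[OF that])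
    show "?D2 u = span {(E2 i \<circ> c.X) u |i. i < CARD('n2)}" if "u \<in> \<Omega>" for u using E2(4)[OF XU(1)[OF that]] by simp
    show "?D3 u = span {(E3 i \<circ> c.X) u |i. i < CARD('n3)}" if "u \<in> \<Omega>" for u using E3(4)[OF XU(2)[OF that]] by simp
    show D2r: "?D2 u \<subseteq> range (d1 f0 u)" if "u \<in> \<Omega>" for u
      using D2t(2)[OF Xc[OF that]] tang[OF that] df0[OF that] by simp
    show D3r: "?D3 u \<subseteq> range (d1 f0 u)" if "u \<in> \<Omega>" for u
      using D3t(2)[OF Xc[OF that]] tang[OF that] df0[OF that] by simp
    show o12: "hh u ((T \<circ> c.X) u) v = 0" if "u \<in> \<Omega>" "v \<in> ?D2 u" for u v
      using orth12[OF Xc[OF that(1)] TD1[OF Xc[OF that(1)]] that(2)] by (simp add: hh_def)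
    show o13: "hh u ((T \<circ> c.X) u) v = 0" if "u \<in> \<Omega>" "v \<in> ?D3 u" for u v
      using orth13[OF Xc[OF that(1)] TD1[OF Xc[OF that(1)]] that(2)] by (simp add: hh_def)
    show o23: "hh u v v' = 0" if "u \<in> \<Omega>" "v \<in> ?D2 u" "v' \<in> ?D3 u" for u v v'
      using orth23[OF Xc[OF that(1)] that(2,3)] by (simp add: hh_def)
    show "\<exists>\<alpha>. \<exists>v\<in>?D2 (w y). \<exists>v'\<in>?D3 (w y). Z = \<alpha> *\<^sub>R (T \<circ> c.X) (w y) + v + v'"
      if y: "y \<in> Y" and Z: "Z \<in> range (d1 f0 (w y))" for y Z
    proof -
      have wO: "w y \<in> \<Omega>" using Y(5)[OF y] by blast
      note cw = Xc[OF wO]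
      show ?thesis
      proof (rule cp.tangent_decomposition[OF y D2t(1)[OF cw] D3t(1)[OF cw] D2r[OF wO] D3r[OF wO] _ _ o12[OF wO] o13[OF wO] o23[OF wO] _ Z])
        show "(T \<circ> c.X) (w y) \<in> range (d1 f0 (w y))" using Tt[OF cw] tang[OF wO] df0[OF wO] by simp
        show "hh (w y) ((T \<circ> c.X) (w y)) ((T \<circ> c.X) (w y)) = 1" using T(2)[OF cw] by (simp add: hh_def)
        show "1 + dim (?D2 (w y)) + dim (?D3 (w y)) = CARD('n)" using D2t(3)[OF cw] D3t(3)[OF cw] dims by simp
      qed
    qed
    show "K (c.X u) ((T \<circ> c.X) u) ((T \<circ> c.X) u) = (lam2 + lam3) *\<^sub>R (T \<circ> c.X) u" if "u \<in> \<Omega>" for u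
      using KTT[OF Xc[OF that]] lams(1) by simp
    show "K (c.X u) ((T \<circ> c.X) u) v = lam2 *\<^sub>R v" if "u \<in> \<Omega>" "v \<in> ?D2 u" for u v
      using KTV[OF Xc[OF that(1)] that(2)] by simp
    show "K (c.X u) ((T \<circ> c.X) u) v = lam3 *\<^sub>R v" if "u \<in> \<Omega>" "v \<in> ?D3 u" for u v
      using KTW[OF Xc[OF that(1)] that(2)] by simp
    show "K (c.X u) v v' = 0" if "u \<in> \<Omega>" "v \<in> ?D2 u" "v' \<in> ?D3 u" for u v v'
      by (rule KVW[OF Xc[OF that(1)] that(2,3)])
    show "lam = lam2 * lam3" using lams(2) by simp
  qed
  define y0 where "y0 = f0 u0"
  obtain \<epsilon> where \<epsilon>: "\<epsilon> > 0" "ball y0 \<epsilon> \<subseteq> Y" using Y(1,2) open_contains_ball unfolding y0_def by blast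
  \<comment> \<open>Convexity of S is what makes the projection constant and the integration along
    segments possible.\<close>
  define S where "S = ball y0 \<epsilon>"
  have S: "open S" "convex S" "y0 \<in> S" "S \<subseteq> Y" using \<epsilon> by (simp_all add: S_def)
  have SY: "y \<in> Y" if "y \<in> S" for y using that S(4) by blast
  define k2 where "k2 = (lam3\<^sup>2 - lam) / cc.kap\<^sup>2"
  define k3 where "k3 = (lam2\<^sup>2 - lam) / cc.kap\<^sup>2"
  have k_pos: "k2 > 0" "k3 > 0"
  proof -
    have "l\<^sup>2 - lam > 0" for l :: real using lam zero_le_power2[of l] by linarith
    then show "k2 > 0" "k3 > 0" unfolding k2_def k3_def using cc.kap_nz by simp_all
  qed
  interpret hs: hessian_splitting S "\<lambda>z u v. - d2 cp.F z u v" "\<lambda>z u v x. - d3 cp.F z u v x" "\<lambda>z u v x x'. - d4 cp.F z u v x x'"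
    cc.e "d1 cc.e" "\<lambda>z x u. d2 cc.e z u x" cc.B2 cc.B3 k2 k3
    unfolding k2_def k3_def by (rule hessian_splitting.restrict[OF cc.splitting S(1,4)])
  define \<pi> where "\<pi> = d1 cc.e y0"
  have par: "cc.e z = \<pi> z" "cc.B2 z = {v. \<pi> v = v}" "cc.B3 z = {v. \<pi> v = 0}" if "z \<in> S" for z
    using hs.parallel_splitting(2,3,4)[OF S(2,3) that] unfolding \<pi>_def by blast+
  have pi_in: "\<pi> v \<in> cc.B2 y0" "v - \<pi> v \<in> cc.B3 y0" for v
    unfolding \<pi>_def by (rule hs.De_in[OF S(3)])+
  \<comment> \<open>Euler's relation rewrites dF at z as the G-product with z, so its values on the
    two components of z are their squared lengths k2 and k3.\<close>
  have F1: "d1 cp.F z v = - d2 cp.F z z v" if "z \<in> Y" for z v using cp.d2_ray(1)[OF that] by simp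
  interpret sp: split_potential S cp.F \<pi> y0 k2 k3 "lam\<^sup>2 * (- lam) ^ CARD('n)"
  proof (rule split_potential.intro[OF _ split_potential_axioms.intro])
    show "smooth_function S cp.F" using S(1) smooth_on_subset[OF cp.smooth_FY S(4)] by unfold_locales
    show "convex S" "y0 \<in> S" "k2 > 0" "k3 > 0" by (fact S k_pos)+
    show "cp.F y0 = 0" using \<Omega>1(4)[OF \<Omega>1(2)] by (simp add: cp.F_def y0_def)
    show "linear \<pi>" unfolding \<pi>_def by (rule hs.De_linear[OF S(3)])
    show "\<pi> (\<pi> v) = \<pi> v" for v using pi_in(1)[of v] par(2)[OF S(3)] by simp
    show "d1 cp.F z (\<pi> z) = k2" if "z \<in> S" for z
    proof -
      have "d1 cp.F z (cc.e z) = - d2 cp.F z (cc.e z) z" using F1[OF SY[OF that]] cp.d2_sym[OF SY[OF that]] by simp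
      also have "\<dots> = - (d2 cp.F z (cc.e z) (cc.e z) + d2 cp.F z (cc.e z) (z - cc.e z))"
        using linear_add[OF cp.d2_linear[OF SY[OF that]], of "cc.e z" "cc.e z" "z - cc.e z"] by simp
      also have "\<dots> = k2" using cc.d2_ee[OF SY[OF that]] cc.d2_e_eps[OF SY[OF that]] by (simp add: k2_def)
      finally show ?thesis using par(1)[OF that] by simp
    qed
    show "d1 cp.F z (z - \<pi> z) = k3" if "z \<in> S" for z
    proof -
      have "d1 cp.F z (z - cc.e z) = - d2 cp.F z z (z - cc.e z)" by (rule F1[OF SY[OF that]])
      also have "\<dots> = - (d2 cp.F z (cc.e z) (z - cc.e z) + d2 cp.F z (z - cc.e z) (z - cc.e z))"
        using linear_add[OF cp.d2_linear1[OF SY[OF that]], of "cc.e z" "z - cc.e z" "z - cc.e z"] by simp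
      also have "\<dots> = k3" using cc.d2_eps_eps[OF SY[OF that]] cc.d2_e_eps[OF SY[OF that]] by (simp add: k3_def)
      finally show ?thesis using par(1)[OF that] by simp
    qed
    show "d2 cp.F z (\<pi> u) (v - \<pi> v) = 0" if "z \<in> S" for z u v
      using hs.G_orth[OF that, of "\<pi> u" "v - \<pi> v"] pi_in[of u] pi_in[of v] par[OF that] par[OF S(3)] by simp
    show "d2 cp.F z v v < 0" if "z \<in> S" "v \<noteq> 0" for z v by (rule cp.d2_negative[OF SY[OF that(1)] that(2)])
    show "det (\<chi> i j. - d2 cp.F z (axis i 1) (axis j 1)) = lam\<^sup>2 * (- lam) ^ CARD('n)" if z: "z \<in> S" "cp.F z = 0" for z
    proof (rule cp.monge_ampere[OF SY[OF z(1)]])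
      have wO: "w z \<in> \<Omega>" using Y(5)[OF SY[OF z(1)]] by blast
      show "r z = 1" using z(2) Y(5)[OF SY[OF z(1)]] by (simp add: cp.F_def)
      have "\<bar>det (\<chi> a. case a of Some i \<Rightarrow> d1 f0 (w z) (axis i 1) | None \<Rightarrow> \<xi> (c.X (w z)))\<bar> =
          sqrt \<bar>det (\<chi> i j. h (c.X (w z)) (d1 f0 (w z) (axis i 1)) (d1 f0 (w z) (axis j 1)))\<bar>"
        by (rule vol[OF Xc[OF wO]]) (simp add: tang[OF wO] df0[OF wO])
      moreover have "\<xi> (c.X (w z)) = (- lam) *\<^sub>R f0 (w z)" using \<xi>_f0[OF wO] by simp
      ultimately show "\<bar>det (\<chi> a. case a of Some i \<Rightarrow> d1 f0 (w z) (axis i 1) | None \<Rightarrow> (- lam) *\<^sub>R f0 (w z))\<bar> =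
          sqrt \<bar>det (\<chi> i j. hh (w z) (d1 f0 (w z) (axis i 1)) (d1 f0 (w z) (axis j 1)))\<bar>"
        by (simp only: hh_def)
    qed
  qed
  have w0: "w y0 = u0" using \<Omega>1(4)[OF \<Omega>1(2)] by (simp add: y0_def)
  \<comment> \<open>Needed for the dimensions n2 + 1 and n3 + 1. The vector e is orthogonal to D2
    but has nonzero length; dF vanishes on D3 but equals k3 on y0 - e.\<close>
  have e_notin: "cc.e y0 \<notin> ?D2 (w y0)" "y0 - cc.e y0 \<notin> ?D3 (w y0)"
  proof -
    have "d2 cp.F y0 (cc.e y0) (cc.e y0) \<noteq> 0" using cc.d2_ee[OF SY[OF S(3)]] k_pos unfolding k2_def by linarith
    then show "cc.e y0 \<notin> ?D2 (w y0)" using cc.d2_eV(1)[OF SY[OF S(3)]] by blast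
    show "y0 - cc.e y0 \<notin> ?D3 (w y0)"
    proof
      assume W: "y0 - cc.e y0 \<in> ?D3 (w y0)"
      have "d1 cp.F y0 (y0 - cc.e y0) = k3" using sp.d1_pi(2)[OF S(3)] par(1)[OF S(3)] by simp
      moreover have "d1 cp.F y0 (y0 - cc.e y0) = 0" using cp.d1_tangent[OF SY[OF S(3)]] cc.tangent(3)[OF SY[OF S(3)] W] by auto
      ultimately show False using k_pos by simp
    qed
  qed
  have dim2: "dim {v. \<pi> v = v} = CARD('n2 option)"
    using dim_line_plus[OF D2t(1)[OF Xc] e_notin(1)] par(2)[OF S(3)] D2t(3)[OF Xc] w0 \<Omega>(2) by (simp add: cc.B2_def)
  have dim3: "dim {v. \<pi> v = 0} = CARD('n3 option)"
    using dim_line_plus[OF D3t(1)[OF Xc] e_notin(2)] par(3)[OF S(3)] D3t(3)[OF Xc] w0 \<Omega>(2) by (simp add: cc.B3_def)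
  have card: "CARD('n2 option) + CARD('n3 option) = CARD('n option)" using dims by simp
  obtain I and B1 :: "(real ^ 'n2) set" and B2 :: "(real ^ 'n3) set" and \<psi>1 \<psi>2 h1 h2 L R coord where
    fac: "open I" "is_interval I" "open B1" "open B2"
      "hyperbolic_affine_hypersphere (open_manifold B1) \<psi>1 \<psi>1 h1 (- 1)" "center_at (open_manifold B1) \<psi>1 \<psi>1 0"
      "hyperbolic_affine_hypersphere (open_manifold B2) \<psi>2 \<psi>2 h2 (- 1)" "center_at (open_manifold B2) \<psi>2 \<psi>2 0"
      "linear L" "bij L"
    and sm\<Phi>: "smooth_on (I \<times> B1 \<times> B2) (\<lambda>z. L (calabi_product 1 1 \<psi>1 \<psi>2 z))"
    and R: "open R" "R \<subseteq> S" "y0 \<in> R" "smooth_on R coord"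
    and \<Phi>: "\<And>z. z \<in> I \<times> B1 \<times> B2 \<Longrightarrow> L (calabi_product 1 1 \<psi>1 \<psi>2 z) \<in> R \<and> cp.F (L (calabi_product 1 1 \<psi>1 \<psi>2 z)) = 0 \<and>
      coord (L (calabi_product 1 1 \<psi>1 \<psi>2 z)) = z"
    and coord: "\<And>y. y \<in> R \<Longrightarrow> cp.F y = 0 \<Longrightarrow> coord y \<in> I \<times> B1 \<times> B2 \<and> L (calabi_product 1 1 \<psi>1 \<psi>2 (coord y)) = y"
    by (rule sp.local_product[OF card dim2 dim3]) blast
  let ?\<Phi> = "\<lambda>z. L (calabi_product 1 1 \<psi>1 \<psi>2 z)"
  have on_M: "y = f0 (w y) \<and> w y \<in> \<Omega> \<and> r y = 1" if "y \<in> Y" "cp.F y = 0" for y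
  proof -
    have "r y = 1" using that(2) Y(5)[OF that(1)] by (simp add: cp.F_def)
    then show ?thesis using Y(5)[OF that(1)] by simp
  qed
  \<comment> \<open>The condition \<open>w (f0 u) = u\<close> is essential: the immersion need not
    be injective on \<Omega>, and another sheet may pass through R.\<close>
  define \<Omega>2 where "\<Omega>2 = {u \<in> \<Omega>. f0 u \<in> R \<and> r (f0 u) = 1 \<and> w (f0 u) = u}"
  have F\<Omega>2: "cp.F (f0 u) = 0" if "u \<in> \<Omega>2" for u using that by (simp add: \<Omega>2_def cp.F_def)
  have open_\<Omega>2: "open \<Omega>2"
  proof (rule openI)
    fix u assume u: "u \<in> \<Omega>2"
    then have fu: "f0 u \<in> Y" "r (f0 u) = 1" "w (f0 u) = u" using R(2) S(4) by (auto simp: \<Omega>2_def)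
    obtain A where A: "open A" "u \<in> A" "\<And>v. v \<in> A \<Longrightarrow> r (f0 v) = 1 \<and> w (f0 v) = v"
      \<comment> \<open>On the leaf r = 1 through f0 u the cone coordinates invert f0 near u, so the
        defining conditions persist nearby.\<close>
      using Y2[OF fu(1)] fu by auto
    have "open (A \<inter> (\<Omega> \<inter> f0 -` R))"
      by (intro open_Int A continuous_open_preimage smooth_on_continuous smooth_f0 \<Omega> R)
    moreover have "A \<inter> (\<Omega> \<inter> f0 -` R) \<subseteq> \<Omega>2" using A(3) by (auto simp: \<Omega>2_def)
    moreover have "u \<in> A \<inter> (\<Omega> \<inter> f0 -` R)" using A u by (simp add: \<Omega>2_def)
    ultimately show "\<exists>e>0. ball u e \<subseteq> \<Omega>2" using open_contains_ball by (metis order_trans)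
  qed
  have \<Omega>2: "\<Omega>2 \<subseteq> \<Omega>" "u0 \<in> \<Omega>2"
    using \<Omega>(2) R(3) \<Omega>1(4)[OF \<Omega>1(2)] by (auto simp: \<Omega>2_def y0_def)
  define G where "G z = w (?\<Phi> z)" for z
  have G: "G z \<in> \<Omega>2 \<and> f0 (G z) = ?\<Phi> z" if "z \<in> I \<times> B1 \<times> B2" for z
    using \<Phi>[OF that] on_M[of "?\<Phi> z"] R(2) S(4) by (auto simp: \<Omega>2_def G_def)
  have box: "open (I \<times> B1 \<times> B2)" by (intro open_Times fac)
  have smG: "smooth_on (I \<times> B1 \<times> B2) G"
    unfolding G_def by (rule smooth_on_compose[OF Y(4) sm\<Phi> box Y(1)]) (use \<Phi> R(2) S(4) in blast)
  have smc: "smooth_on \<Omega>2 (\<lambda>u. coord (f0 u))"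
    by (rule smooth_on_compose[OF R(4) smooth_on_subset[OF smooth_f0 \<Omega>2(1)] open_\<Omega>2 R(1)]) (simp add: \<Omega>2_def)
  have "diffeomorphism (open_manifold I \<times>\<^sub>M\<^sub>f open_manifold B1 \<times>\<^sub>M\<^sub>f open_manifold B2) (open_submanifold M (c.X ` \<Omega>2)) (\<lambda>z. c.X (G z))"
  proof (rule c.diffeomorphism_from_box[OF fac(1,3,4) open_\<Omega>2 order_trans[OF \<Omega>2(1) \<Omega>(4)] smG _ smc])
    show "G z \<in> \<Omega>2 \<and> coord (f0 (G z)) = z" if "z \<in> I \<times> B1 \<times> B2" for z using G[OF that] \<Phi>[OF that] by simp
    show "coord (f0 u) \<in> I \<times> B1 \<times> B2 \<and> G (coord (f0 u)) = u" if "u \<in> \<Omega>2" for u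
      using coord[OF _ F\<Omega>2[OF that]] that by (simp add: \<Omega>2_def G_def)
  qed
  moreover have "openin (mfd_top M) (c.X ` \<Omega>2)" by (rule c.openin_X_image[OF open_\<Omega>2 order_trans[OF \<Omega>2(1) \<Omega>(4)]])
  moreover have "x0 \<in> c.X ` \<Omega>2" using \<Omega>2(2) c.X_x[OF chart(2)] unfolding u0_def by (metis image_eqI)
  moreover have "\<phi> (c.X (G z)) = ?\<Phi> z + b" if "z \<in> I \<times> B1 \<times> B2" for z
    using G[OF that] by (simp add: f0_def algebra_simps)
  moreover have "carrier_mfd (open_manifold B1) = B1" "carrier_mfd (open_manifold B2) = B2" by (simp_all add: open_manifold_def)
  ultimately have final: "openin (mfd_top M) (c.X ` \<Omega>2) \<and> x0 \<in> c.X ` \<Omega>2 \<and> open I \<and> is_interval I \<and>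
      hyperbolic_affine_hypersphere (open_manifold B1) \<psi>1 \<psi>1 h1 (-1) \<and> center_at (open_manifold B1) \<psi>1 \<psi>1 0 \<and>
      hyperbolic_affine_hypersphere (open_manifold B2) \<psi>2 \<psi>2 h2 (-1) \<and> center_at (open_manifold B2) \<psi>2 \<psi>2 0 \<and>
      (1::real) \<noteq> 0 \<and> (1::real) \<noteq> 0 \<and>
      diffeomorphism (open_manifold I \<times>\<^sub>M\<^sub>f open_manifold B1 \<times>\<^sub>M\<^sub>f open_manifold B2) (open_submanifold M (c.X ` \<Omega>2)) (\<lambda>z. c.X (G z)) \<and>
      linear L \<and> bij L \<and>
      (\<forall>z\<in>I \<times> carrier_mfd (open_manifold B1) \<times> carrier_mfd (open_manifold B2).
         \<phi> (c.X (G z)) = L (calabi_product 1 1 \<psi>1 \<psi>2 z) + b)"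
    using fac by simp
  show "\<exists>W I (M1 :: (real ^ 'n2, real ^ 'n2) manifold) (M2 :: (real ^ 'n3, real ^ 'n3) manifold)
          \<psi>1 \<xi>1 h1 \<psi>2 \<xi>2 h2 c1 c2 \<Theta> L b.
          openin (mfd_top M) W \<and> x0 \<in> W \<and> open I \<and> is_interval I \<and>
          hyperbolic_affine_hypersphere M1 \<psi>1 \<xi>1 h1 (-1) \<and> center_at M1 \<psi>1 \<xi>1 0 \<and>
          hyperbolic_affine_hypersphere M2 \<psi>2 \<xi>2 h2 (-1) \<and> center_at M2 \<psi>2 \<xi>2 0 \<and>
          c1 \<noteq> 0 \<and> c2 \<noteq> 0 \<and>
          diffeomorphism (open_manifold I \<times>\<^sub>M\<^sub>f M1 \<times>\<^sub>M\<^sub>f M2) (open_submanifold M W) \<Theta> \<and>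
          linear L \<and> bij L \<and>
          (\<forall>z\<in>I \<times> carrier_mfd M1 \<times> carrier_mfd M2.
             \<phi> (\<Theta> z) = L (calabi_product c1 c2 \<psi>1 \<psi>2 z) + b)"
    \<comment> \<open>Both constants of the Calabi product are taken to be 1; the scale of each
      factor is carried by the frames that make up L.\<close>
    by (rule exI[of _ "c.X ` \<Omega>2"], rule exI[of _ I], rule exI[of _ "open_manifold B1"], rule exI[of _ "open_manifold B2"],
        rule exI[of _ \<psi>1], rule exI[of _ \<psi>1], rule exI[of _ h1], rule exI[of _ \<psi>2], rule exI[of _ \<psi>2], rule exI[of _ h2],
        rule exI[of _ 1], rule exI[of _ 1], rule exI[of _ "\<lambda>z. c.X (G z)"], rule exI[of _ L], rule exI[of _ b], rule final)
qed

end
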